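(* Let $I\subseteq R=\Bbbk[x_1,\dots,x_n]$ be a nonzero $\mathfrak S_n$-invariant monomial ideal. Then (i) $\mathrm{reg}(R/I)=\max\{|\mu^+|\mid\mu\in\Lambda^*(I)\}$; (ii) $\mathrm{pd}(R/I)=\max\{n-\ell(\mu)\mid\mu\in\Lambda^*(I)\}$.
   Context: $\Bbbk$ is a field; $\mathfrak S_n$ acts on $R$ by permuting variables. $\mathrm{reg}(R/I)=\max\{j-i\mid\mathrm{Tor}_i(R/I,\Bbbk)_j\ne0\}$ (standard $\mathbb Z$-grading) and $\mathrm{pd}(R/I)=\max\{i\mid\mathrm{Tor}_i(R/I,\Bbbk)\ne0\}$. (If $I=R$, both sides of each equality are maxima over the empty set, read with the same convention.) $P_n^\infty=\{(\lambda_1,\dots,\lambda_n)\in(\mathbb Z_{\ge0}\cup\{\infty\})^n\mid\lambda_1\ge\cdots\ge\lambda_n\ge0\}$, where $\infty\ge a$ for all $a$. For $\mu=(\infty,\dots,\infty,\mu_k,\dots,\mu_n)\in P_n^\infty$ with $\mu_k<\infty$ (first $k-1$ entries $\infty$, $1\le k\le n$), let $Q_\mu=\bigcap_{\sigma\in\mathfrak S_n}\sigma\big((x_k^{\mu_k+1},\dots,x_n^{\mu_n+1})\big)$, $\ell(\mu)=k-1$, and $\mu^+=(\mu_k+1,\dots,\mu_k+1,\mu_k,\dots,\mu_n)\in\mathbb Z_{\geq 0}^n$ (each $\infty$ replaced by $\mu_k+1$). There is a unique finite set $\{\mu^1,\dots,\mu^t\}$ of such elements with $I=Q_{\mu^1}\cap\cdots\cap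 Q_{\mu^t}$ and such that no $Q_{\mu^k}$ can be omitted; this set is $\Lambda^*(I)$. $|\mathbf a|=a_1+\cdots+a_n$. *)

theory Defs
  imports
    Complex_Main
    "HOL-Library.Poly_Mapping"
    "HOL-Library.Cardinality"
    "HOL-Library.Extended_Nat"
    "HOL-Combinatorics.Permutations"
begin

text \<open>
  The variables of \<open>R = k[x\<^sub>1, \<dots>, x\<^sub>n]\<close> are indexed by a finite linearly ordered type
  \<open>'n\<close> with \<open>n = CARD('n)\<close>; the order on \<open>'n\<close> plays the role of \<open>1 < \<dots> < n\<close>.
  Elements of \<open>R\<close> are finitely supported families of coefficients indexed by exponent vectors.
\<close>

type_synonym 'n expo = "'n \<Rightarrow>\<^sub>0 nat"
type_synonym ('n, 'k) mpoly = "'n expo \<Rightarrow>\<^sub>0 'k"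

definition monom :: "'n expo \<Rightarrow> ('n, 'k::field) mpoly" where
  "monom m = Poly_Mapping.single m 1"

definition Var :: "'n \<Rightarrow> ('n, 'k::field) mpoly" where
  "Var i = monom (Poly_Mapping.single i 1)"

definition total_deg :: "'n::finite expo \<Rightarrow> nat" where
  "total_deg m = (\<Sum>i\<in>UNIV. Poly_Mapping.lookup m i)"

text \<open>Degrees are integers, so for \<open>d < 0\<close> only \<open>0\<close> is homogeneous of degree \<open>d\<close>.\<close>
definition homogeneous :: "int \<Rightarrow> ('n::finite, 'k::field) mpoly \<Rightarrow> bool" where
  "homogeneous d p \<longleftrightarrow> (\<forall>m\<in>Poly_Mapping.keys p. int (total_deg m) = d)"


section \<open>Ideals and the action of the symmetric group\<close>

text \<open>An ideal is a submodule of \<open>R\<close> regarded as a module over itself.\<close>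

lemma module_times: "module ((*) :: 'a::comm_ring_1 \<Rightarrow> 'a \<Rightarrow> 'a)"
  by unfold_locales (auto simp: algebra_simps)

abbreviation ideal_gen :: "('n, 'k::field) mpoly set \<Rightarrow> ('n, 'k) mpoly set" where
  "ideal_gen S \<equiv> module.span (*) S"

definition monomial_ideal :: "('n, 'k::field) mpoly set \<Rightarrow> bool" where
  "monomial_ideal I \<longleftrightarrow> (\<exists>M. I = ideal_gen (monom ` M))"

text \<open>
  The action with \<open>\<sigma>(x\<^sub>i) = x\<^bsub>\<sigma>(i)\<^esub>\<close>: the coefficient of \<open>x\<^sup>m\<close> in \<open>\<sigma>(p)\<close> is that of
  \<open>x\<^bsup>m \<circ> \<sigma>\<^esup>\<close> in \<open>p\<close>.
\<close>
definition perm_poly :: "('n \<Rightarrow> 'n) \<Rightarrow> ('n, 'k::field) mpoly \<Rightarrow> ('n, 'k) mpoly" where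
  "perm_poly \<sigma> p = Poly_Mapping.map_key (Poly_Mapping.map_key \<sigma>) p"

lemma inj_map_key:
  assumes "bij \<sigma>"
  shows "inj (Poly_Mapping.map_key \<sigma> :: 'n expo \<Rightarrow> 'n expo)"
proof (rule injI)
  fix a b :: "'n expo"
  assume eq: "Poly_Mapping.map_key \<sigma> a = Poly_Mapping.map_key \<sigma> b"
  have inj: "inj \<sigma>" using assms by (rule bij_is_inj)
  have "Poly_Mapping.lookup a (\<sigma> i) = Poly_Mapping.lookup b (\<sigma> i)" for i
    using arg_cong[OF eq, of "\<lambda>c. Poly_Mapping.lookup c i"] by (simp add: Poly_Mapping.map_key.rep_eq inj)
  then have "Poly_Mapping.lookup a j = Poly_Mapping.lookup b j" for j
    using assms by (metis bij_pointE)
  then show "a = b" by (rule poly_mapping_eqI)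
qed

lemma lookup_perm_poly:
  assumes "bij \<sigma>"
  shows "Poly_Mapping.lookup (perm_poly \<sigma> p) m = Poly_Mapping.lookup p (Poly_Mapping.map_key \<sigma> m)"
  by (simp add: perm_poly_def Poly_Mapping.map_key.rep_eq inj_map_key[OF assms])

lemma perm_poly_Var:
  assumes "bij \<sigma>"
  shows "perm_poly \<sigma> (Var i :: ('n, 'k::field) mpoly) = Var (\<sigma> i)"
proof -
  have inj: "inj \<sigma>" using assms by (rule bij_is_inj)
  have "Poly_Mapping.map_key \<sigma> (Poly_Mapping.single (\<sigma> i) 1) = (Poly_Mapping.single i 1 :: 'n expo)"
    by (rule poly_mapping_eqI)
      (auto simp: Poly_Mapping.map_key.rep_eq inj lookup_single when_def inj_eq[OF inj])
  then have "Poly_Mapping.single i 1 = Poly_Mapping.map_key \<sigma> m \<longleftrightarrow> Poly_Mapping.single (\<sigma> i) 1 = m"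
    for m :: "'n expo"
    using inj_map_key[OF assms] by (metis injD)
  then show ?thesis
    by (intro poly_mapping_eqI)
      (simp add: lookup_perm_poly[OF assms] Var_def monom_def lookup_single when_def)
qed

definition sym_invariant :: "('n, 'k::field) mpoly set \<Rightarrow> bool" where
  "sym_invariant I \<longleftrightarrow> (\<forall>\<sigma>. \<sigma> permutes UNIV \<longrightarrow> perm_poly \<sigma> ` I = I)"


section \<open>The ideals \<open>Q\<^sub>\<mu>\<close> and the set \<open>\<Lambda>\<^sup>*(I)\<close>\<close>

text \<open>
  The elements of \<open>P\<^sub>n\<^sup>\<infinity>\<close> with at least one finite entry, i.e. those of the form
  \<open>(\<infinity>, \<dots>, \<infinity>, \<mu>\<^sub>k, \<dots>, \<mu>\<^sub>n)\<close> with \<open>1 \<le> k \<le> n\<close> and \<open>\<mu>\<^sub>k < \<infinity>\<close>.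
\<close>
definition P_inf :: "('n::linorder \<Rightarrow> enat) set" where
  "P_inf = {\<mu>. antimono \<mu> \<and> (\<exists>i. \<mu> i \<noteq> \<infinity>)}"

definition Q :: "('n \<Rightarrow> enat) \<Rightarrow> ('n, 'k::field) mpoly set" where
  "Q \<mu> = (\<Inter>\<sigma>\<in>{\<sigma>. \<sigma> permutes UNIV}.
            perm_poly \<sigma> ` ideal_gen {Var i ^ (the_enat (\<mu> i) + 1) | i. \<mu> i \<noteq> \<infinity>})"

definition ell :: "('n::finite \<Rightarrow> enat) \<Rightarrow> nat" where
  "ell \<mu> = card {i. \<mu> i = \<infinity>}"

text \<open>\<open>LEAST k. \<mu> k \<noteq> \<infinity>\<close> is the index \<open>k\<close> of the first finite entry.\<close>
definition mu_plus :: "('n::linorder \<Rightarrow> enat) \<Rightarrow> 'n \<Rightarrow> nat" where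
  "mu_plus \<mu> i =
     (if \<mu> i = \<infinity> then the_enat (\<mu> (LEAST k. \<mu> k \<noteq> \<infinity>)) + 1 else the_enat (\<mu> i))"

text \<open>For \<open>L = {}\<close> the intersection is all of \<open>R\<close>.\<close>
definition irredundant_decomp ::
  "('n::linorder, 'k::field) mpoly set \<Rightarrow> ('n \<Rightarrow> enat) set \<Rightarrow> bool" where
  "irredundant_decomp I L \<longleftrightarrow>
     finite L \<and> L \<subseteq> P_inf \<and> I = (\<Inter>\<mu>\<in>L. Q \<mu>) \<and> (\<forall>\<mu>\<in>L. I \<noteq> (\<Inter>\<nu>\<in>L - {\<mu>}. Q \<nu>))"

definition Lambda_star :: "('n::linorder, 'k::field) mpoly set \<Rightarrow> ('n \<Rightarrow> enat) set" where
  "Lambda_star I = (THE L. irredundant_decomp I L)"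


section \<open>Graded free resolutions of \<open>R/I\<close> and Tor\<close>

text \<open>
  A complex \<open>\<dots> \<rightarrow> F\<^sub>1 \<rightarrow> F\<^sub>0 \<rightarrow> R/I\<close> of free modules with chosen homogeneous bases: \<open>F\<^sub>i\<close> is free on
  the set \<open>basis i\<close>, whose element \<open>b\<close> has degree \<open>bdeg i b\<close>. The map \<open>F\<^bsub>i+1\<^esub> \<rightarrow> F\<^sub>i\<close> sends the basis
  element \<open>b\<close> to the vector \<open>diff i b\<close>, and \<open>F\<^sub>0 \<rightarrow> R/I\<close> sends \<open>b\<close> to the class of \<open>aug b\<close>.
\<close>
record 'r free_complex =
  basis :: "nat \<Rightarrow> nat set"
  bdeg :: "nat \<Rightarrow> nat \<Rightarrow> int"
  diff :: "nat \<Rightarrow> nat \<Rightarrow> nat \<Rightarrow> 'r"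
  aug :: "nat \<Rightarrow> 'r"

definition free_on :: "nat set \<Rightarrow> (nat \<Rightarrow> 'a::zero) set" where
  "free_on B = {v. \<forall>b. b \<notin> B \<longrightarrow> v b = 0}"

definition lin_map :: "nat set \<Rightarrow> (nat \<Rightarrow> nat \<Rightarrow> 'a::comm_ring_1) \<Rightarrow> (nat \<Rightarrow> 'a) \<Rightarrow> nat \<Rightarrow> 'a" where
  "lin_map B A v = (\<lambda>c. \<Sum>b\<in>B. v b * A b c)"

definition graded_free_complex :: "('n::finite, 'k::field) mpoly free_complex \<Rightarrow> bool" where
  "graded_free_complex F \<longleftrightarrow>
     (\<forall>i. finite (basis F i)) \<and>
     (\<forall>i. \<forall>b\<in>basis F (Suc i). diff F i b \<in> free_on (basis F i)) \<and>
     (\<forall>i. \<forall>b\<in>basis F (Suc i). \<forall>c\<in>basis F i.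
        homogeneous (bdeg F (Suc i) b - bdeg F i c) (diff F i b c)) \<and>
     (\<forall>b\<in>basis F 0. homogeneous (bdeg F 0 b) (aug F b))"

definition bd :: "('n, 'k::field) mpoly free_complex \<Rightarrow> nat \<Rightarrow> (nat \<Rightarrow> ('n, 'k) mpoly) \<Rightarrow> nat \<Rightarrow> ('n, 'k) mpoly" where
  "bd F i = lin_map (basis F (Suc i)) (diff F i)"

definition aug_map :: "('n, 'k::field) mpoly free_complex \<Rightarrow> (nat \<Rightarrow> ('n, 'k) mpoly) \<Rightarrow> ('n, 'k) mpoly" where
  "aug_map F v = (\<Sum>b\<in>basis F 0. v b * aug F b)"

text \<open>
  Exactness of \<open>\<dots> \<rightarrow> F\<^sub>1 \<rightarrow> F\<^sub>0 \<rightarrow> R/I \<rightarrow> 0\<close>, at \<open>R/I\<close>, at \<open>F\<^sub>0\<close> and at \<open>F\<^bsub>i+1\<^esub>\<close> respectively.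
\<close>
definition resolves :: "('n::finite, 'k::field) mpoly free_complex \<Rightarrow> ('n, 'k) mpoly set \<Rightarrow> bool" where
  "resolves F I \<longleftrightarrow>
     graded_free_complex F \<and>
     (\<forall>p. \<exists>v\<in>free_on (basis F 0). p - aug_map F v \<in> I) \<and>
     {v \<in> free_on (basis F 0). aug_map F v \<in> I} = bd F 0 ` free_on (basis F 1) \<and>
     (\<forall>i. {v \<in> free_on (basis F (i + 1)). bd F i v = (\<lambda>_. 0)}
            = bd F (i + 1) ` free_on (basis F (i + 2)))"

text \<open>
  \<open>Tor\<^sub>i(R/I, k)\<^sub>j\<close> is the degree \<open>j\<close> part of \<open>H\<^sub>i(F \<otimes>\<^sub>R k)\<close> for a chosen graded free resolution \<open>F\<close>
  of \<open>R/I\<close>; up to isomorphism it does not depend on the choice. Since \<open>k = R/(x\<^sub>1, \<dots>, x\<^sub>n)\<close>,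
  the module \<open>F\<^sub>i \<otimes>\<^sub>R k\<close> is the \<open>k\<close>-vector space on \<open>basis F i\<close>, and the entries of the
  differential are replaced by their constant coefficients. The boundaries are contained in the
  cycles, so the homology is nonzero iff the two differ.
\<close>
definition resolution :: "('n::finite, 'k::field) mpoly set \<Rightarrow> ('n, 'k) mpoly free_complex" where
  "resolution I = (SOME F. resolves F I)"

definition basis_deg :: "'r free_complex \<Rightarrow> nat \<Rightarrow> int \<Rightarrow> nat set" where
  "basis_deg F i j = {b \<in> basis F i. bdeg F i b = j}"

definition tensor_bd :: "('n, 'k::field) mpoly free_complex \<Rightarrow> nat \<Rightarrow> (nat \<Rightarrow> 'k) \<Rightarrow> nat \<Rightarrow> 'k" where
  "tensor_bd F i = lin_map (basis F (Suc i)) (\<lambda>b c. Poly_Mapping.lookup (diff F i b c) 0)"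

definition tor_cycles :: "('n, 'k::field) mpoly free_complex \<Rightarrow> nat \<Rightarrow> int \<Rightarrow> (nat \<Rightarrow> 'k) set" where
  "tor_cycles F i j =
     {w \<in> free_on (basis_deg F i j). case i of 0 \<Rightarrow> True | Suc i' \<Rightarrow> tensor_bd F i' w = (\<lambda>_. 0)}"

definition tor_boundaries :: "('n, 'k::field) mpoly free_complex \<Rightarrow> nat \<Rightarrow> int \<Rightarrow> (nat \<Rightarrow> 'k) set" where
  "tor_boundaries F i j = tensor_bd F i ` free_on (basis_deg F (Suc i) j)"

definition Tor_nonzero :: "('n::finite, 'k::field) mpoly set \<Rightarrow> nat \<Rightarrow> int \<Rightarrow> bool" where
  "Tor_nonzero I i j \<longleftrightarrow> tor_cycles (resolution I) i j \<noteq> tor_boundaries (resolution I) i j"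

text \<open>The invariants of \<open>R/I\<close>; note that \<open>Tor\<^sub>i(R/I, k)\<close> is the direct sum of its graded pieces.\<close>

definition reg_quot :: "('n::finite, 'k::field) mpoly set \<Rightarrow> int" where
  "reg_quot I = Max {j - int i | i j. Tor_nonzero I i j}"

definition pd_quot :: "('n::finite, 'k::field) mpoly set \<Rightarrow> nat" where
  "pd_quot I = Max {i. \<exists>j. Tor_nonzero I i j}"

end

theory Submission
  imports Defs "HOL-Library.Function_Algebras" "HOL-Library.Nat_Bijection"
begin

text \<open>
  The multigraded Koszul complex turns both equalities into combinatorics of exponents. Let \<open>E\<close> be
  the set of exponents of the monomials in \<open>I\<close>. The Koszul complex of \<open>x\<^sub>1, \<dots>, x\<^sub>n\<close> with
  coefficients in \<open>R/I\<close> splits by multidegree; in multidegree \<open>a\<close> it has a basis indexed by the sets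
  \<open>S\<close> of indices in the support of \<open>a\<close> with \<open>a - 1\<^sub>S \<notin> E\<close>, where \<open>1\<^sub>S\<close> is the characteristic
  vector and \<open>S\<close> has homological degree \<open>card S\<close>. Write \<open>\<Gamma>(a)\<close> for this family, which is closed
  upwards inside the support of \<open>a\<close>. Then \<open>Tor\<^sub>i(R/I, k)\<^sub>j \<noteq> 0\<close> iff \<open>H\<^sub>i(\<Gamma>(a)) \<noteq> 0\<close> for some \<open>a\<close>
  with \<open>\<bar>a\<bar> = j\<close> (\<open>Tor_nonzero_iff\<close>).

  Upper bounds. If adjoining an index \<open>v\<close> in the support of \<open>a\<close> is reversible on the \<open>i\<close>-element
  members of \<open>\<Gamma>(a)\<close>, it is a contracting homotopy in degree \<open>i\<close> (\<open>acyclic_cone\<close>). So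
  \<open>H\<^sub>i(\<Gamma>(a)) \<noteq> 0\<close> yields, for every such \<open>v\<close>, a set \<open>S\<close> of size \<open>i\<close> containing \<open>v\<close> with
  \<open>b = a - 1\<^sub>S \<notin> E\<close> and \<open>b + e\<^sub>v \<in> E\<close>. Choose \<open>v\<close> with \<open>a\<^sub>v\<close> maximal. Some permutation puts \<open>b\<close>
  below some \<open>\<mu> \<in> \<Lambda>\<^sup>*(I)\<close>, and there \<open>v\<close> meets an entry of \<open>\<mu>\<close> equal to \<open>a\<^sub>v - 1\<close>. Hence the infinite
  entries of \<open>\<mu>\<close> become at least \<open>a\<^sub>v\<close> in \<open>\<mu>\<^sup>+\<close>, so \<open>b\<close> is even below \<open>\<mu>\<^sup>+\<close> and
  \<open>\<bar>a\<bar> - i = \<bar>b\<bar> \<le> \<bar>\<mu>\<^sup>+\<bar>\<close> (\<open>regularity_upper_bound\<close>). If \<open>i\<close> exceeds the number of finite entries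
  of \<open>\<mu>\<close>, some element of \<open>S\<close> meets an infinite entry, and exchanging it with \<open>v\<close> contradicts
  \<open>b + e\<^sub>v \<in> E\<close> (\<open>projdim_upper_bound\<close>).

  Lower bounds. Let \<open>S\<^sub>0\<close> be the set of finite positions of \<open>\<mu>\<close> and \<open>a = \<mu>\<^sup>+ + 1\<^bsub>S\<^sub>0\<^esub>\<close>. If
  \<open>\<bar>\<mu>\<^sup>+\<bar>\<close> is maximal or \<open>\<ell>(\<mu>)\<close> is minimal, then \<open>\<mu>\<^sup>+ + e\<^sub>j \<in> E\<close> for all \<open>j \<in> S\<^sub>0\<close>, so \<open>S\<^sub>0\<close> is a
  cycle. It is no boundary: for \<open>W = S\<^sub>0 - {k}\<close>, with \<open>\<mu>\<^sub>k\<close> the first finite entry, every set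
  \<open>W \<union> {v}\<close> lies in \<open>\<Gamma>(a)\<close>, because \<open>k\<close> can be exchanged with an infinite position; so the
  coefficient of a boundary along \<open>W\<close>, computed in the full simplex, vanishes by \<open>\<partial>\<partial> = 0\<close>, whereas
  that of \<open>S\<^sub>0\<close> is \<open>\<plusminus>1\<close>. This class has \<open>i = n - \<ell>(\<mu>)\<close> and \<open>\<bar>a\<bar> - i = \<bar>\<mu>\<^sup>+\<bar>\<close> (\<open>koszul_class\<close>).

  It remains to relate the Koszul complex to an arbitrary graded free resolution \<open>F\<close>. In the double
  complex \<open>F \<otimes> K\<close> all rows and columns are exact away from the edges, and a staircase argument
  transfers the vanishing of homology from one edge to the other (\<open>edge_acyclic_iff\<close>). Some resolution
  exists, namely the Taylor complex of finitely many monomial generators. The Koszul complex is the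
  Taylor complex of the variables, so one lemma, \<open>taylor_exact\<close>, gives both exactness statements.
\<close>

abbreviation lookup :: "('a \<Rightarrow>\<^sub>0 'b::zero) \<Rightarrow> 'a \<Rightarrow> 'b" where
  "lookup \<equiv> Poly_Mapping.lookup"

abbreviation keys :: "('a \<Rightarrow>\<^sub>0 'b::zero) \<Rightarrow> 'a set" where
  "keys \<equiv> Poly_Mapping.keys"

section \<open>Exponents and monomial ideals\<close>

text \<open>Divisibility of monomials. The order that \<open>\<Rightarrow>\<^sub>0\<close> carries is a linear order and not this one.\<close>
definition edvd :: "'n expo \<Rightarrow> 'n expo \<Rightarrow> bool"  (infix "\<preceq>" 50) where
  "m \<preceq> a \<longleftrightarrow> (\<forall>i. lookup m i \<le> lookup a i)"

lemma edvd_refl [simp]: "m \<preceq> m"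
  by (simp add: edvd_def)

lemma edvd_trans: "m \<preceq> a \<Longrightarrow> a \<preceq> b \<Longrightarrow> m \<preceq> b"
  unfolding edvd_def by (meson order_trans)

lemma zero_edvd [simp]: "0 \<preceq> m"
  by (simp add: edvd_def)

lemma edvd_add [simp]: "m \<preceq> m + d" "m \<preceq> d + m"
  by (simp_all add: edvd_def lookup_add)

lemma edvd_diff_add: "m \<preceq> a \<Longrightarrow> a - m + m = a"
  by (rule poly_mapping_eqI) (simp add: edvd_def lookup_add lookup_minus)

lemma edvd_minus_mono: "m \<preceq> m' \<Longrightarrow> a - m' \<preceq> a - m"
  by (auto simp: edvd_def lookup_minus intro: diff_le_mono2)

lemma edvd_eqI: "m \<preceq> a \<Longrightarrow> m \<preceq> b \<Longrightarrow> a - m = b - m \<Longrightarrow> a = b"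
  by (metis edvd_diff_add)

lemma total_deg_add: "total_deg (m + d) = total_deg m + total_deg (d :: 'n::finite expo)"
  by (simp add: total_deg_def lookup_add sum.distrib)

lemma total_deg_minus:
  "m \<preceq> a \<Longrightarrow> int (total_deg (a - m)) = int (total_deg a) - int (total_deg (m :: 'n::finite expo))"
  by (metis add_diff_cancel_right' edvd_diff_add of_nat_add total_deg_add)

lemma lookup_single_mult:
  fixes p :: "('n, 'k::field) mpoly"
  shows "lookup (Poly_Mapping.single d c * p) m = (if d \<preceq> m then c * lookup p (m - d) else 0)"
proof -
  have "lookup (Poly_Mapping.single d c * p) m = c * (\<Sum>q. (lookup p q when m = d + q))"
    by (simp add: lookup_mult lookup_single when_mult)
  also have "(\<Sum>q. (lookup p q when m = d + q)) = (if d \<preceq> m then lookup p (m - d) else 0)"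
  proof (cases "d \<preceq> m")
    case True
    then have "m = d + q \<longleftrightarrow> q = m - d" for q
      by (metis add.commute add_diff_cancel_right' edvd_diff_add)
    with True show ?thesis by simp
  next
    case False
    then have "m \<noteq> d + q" for q by auto
    with False show ?thesis by simp
  qed
  finally show ?thesis by simp
qed

lemma lookup_monom_mult:
  fixes p :: "('n, 'k::field) mpoly"
  shows "lookup (monom d * p) m = (if d \<preceq> m then lookup p (m - d) else 0)"
  by (simp add: monom_def lookup_single_mult)

lemma keys_mult_edvd:
  fixes p q :: "('n, 'k::field) mpoly"
  assumes "m \<in> keys (p * q)"
  obtains m1 m2 where "m1 \<in> keys p" "m2 \<in> keys q" "m = m1 + m2"
  using assms keys_mult[of p q] by blast

lemma poly_sum_singles: "p = (\<Sum>m\<in>keys p. Poly_Mapping.single m (lookup p m))"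
  by (rule poly_mapping_eqI) (auto simp: lookup_sum lookup_single when_def in_keys_iff)

text \<open>The monomial ideal with a given set \<open>E\<close> of exponents, provided that \<open>E\<close> is closed under
  \<open>\<preceq>\<close>.\<close>
definition mideal :: "'n expo set \<Rightarrow> ('n, 'k::field) mpoly set" where
  "mideal E = {p. keys p \<subseteq> E}"

lemma mideal_add: "p \<in> mideal E \<Longrightarrow> q \<in> mideal E \<Longrightarrow> p + q \<in> mideal E"
  using keys_add[of p q] by (auto simp: mideal_def)

lemma mideal_0 [simp]: "0 \<in> mideal E"
  by (simp add: mideal_def)

lemma mideal_minus: "p \<in> mideal E \<Longrightarrow> q \<in> mideal E \<Longrightarrow> p - q \<in> mideal E"
  using keys_diff[of p q] by (auto simp: mideal_def)

lemma mideal_sum: "(\<And>x. x \<in> X \<Longrightarrow> f x \<in> mideal E) \<Longrightarrow> sum f X \<in> mideal E"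
  by (induction X rule: infinite_finite_induct) (auto intro: mideal_add)

lemma mideal_mult:
  assumes "\<And>m m'. m \<in> E \<Longrightarrow> m \<preceq> m' \<Longrightarrow> m' \<in> E" "p \<in> mideal E"
  shows "p * q \<in> mideal E"
  using assms unfolding mideal_def by (auto elim!: keys_mult_edvd)

lemma monom_in_mideal [simp]: "monom m \<in> (mideal E :: ('n, 'k::field) mpoly set) \<longleftrightarrow> m \<in> E"
  by (simp add: mideal_def monom_def)

lemma mideal_inject: "(mideal E :: ('n, 'k::field) mpoly set) = mideal E' \<longleftrightarrow> E = E'"
proof
  assume "(mideal E :: ('n, 'k) mpoly set) = mideal E'"
  then have "monom m \<in> (mideal E :: ('n, 'k) mpoly set) \<longleftrightarrow> monom m \<in> (mideal E' :: ('n, 'k) mpoly set)" for m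
    by simp
  then show "E = E'" by auto
qed simp

lemma ideal_gen_monom:
  "ideal_gen (monom ` M) = (mideal {m. \<exists>g\<in>M. g \<preceq> m} :: ('n, 'k::field) mpoly set)"
proof
  interpret mt: module "(*) :: ('n, 'k) mpoly \<Rightarrow> _" by (rule module_times)
  let ?E = "{m. \<exists>g\<in>M. g \<preceq> m}"
  show "ideal_gen (monom ` M) \<subseteq> (mideal ?E :: ('n, 'k) mpoly set)"
  proof (rule mt.span_minimal)
    show "monom ` M \<subseteq> (mideal ?E :: ('n, 'k) mpoly set)"
      by (simp add: image_subset_iff) (blast intro: edvd_refl)
    have "c * x \<in> mideal ?E" if "x \<in> mideal ?E" for c x :: "('n, 'k) mpoly"
      using mideal_mult[of ?E x c] that by (auto simp: mult.commute intro: edvd_trans)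
    then show "mt.subspace (mideal ?E :: ('n, 'k) mpoly set)"
      by (auto simp: mt.subspace_def intro: mideal_add)
  qed
  show "(mideal ?E :: ('n, 'k) mpoly set) \<subseteq> ideal_gen (monom ` M)"
  proof
    fix p :: "('n, 'k) mpoly" assume p: "p \<in> mideal ?E"
    have "Poly_Mapping.single m (lookup p m) \<in> mt.span (monom ` M)" if "m \<in> keys p" for m
    proof -
      from that p obtain g where g: "g \<in> M" "g \<preceq> m" by (auto simp: mideal_def)
      have "Poly_Mapping.single m (lookup p m)
          = Poly_Mapping.single (m - g) (lookup p m) * (monom g :: ('n, 'k) mpoly)"
        using g by (simp add: monom_def mult_single edvd_diff_add)
      with g show ?thesis by (simp add: mt.span_scale mt.span_base)
    qed
    then have "(\<Sum>m\<in>keys p. Poly_Mapping.single m (lookup p m)) \<in> mt.span (monom ` M)"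
      by (rule mt.span_sum)
    then show "p \<in> ideal_gen (monom ` M)"
      by (simp flip: poly_sum_singles)
  qed
qed

definition up_closed :: "'n expo set \<Rightarrow> bool" where
  "up_closed E \<longleftrightarrow> (\<forall>m m'. m \<in> E \<longrightarrow> m \<preceq> m' \<longrightarrow> m' \<in> E)"

section \<open>The alternating complex on a family of finite sets\<close>

definition sgn_pos :: "'v::linorder \<Rightarrow> 'v set \<Rightarrow> 'r::comm_ring_1" where
  "sgn_pos v T = (-1) ^ card {u\<in>T. u < v}"

definition altsum :: "'v::linorder set \<Rightarrow> ('v set \<Rightarrow> 'r) \<Rightarrow> 'v set \<Rightarrow> 'r::comm_ring_1" where
  "altsum V f T = (\<Sum>v\<in>V - T. sgn_pos v T * f (insert v T))"

lemma sgn_pos_sq [simp]: "sgn_pos v T * sgn_pos v T = (1 :: 'r::comm_ring_1)"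
  by (simp add: sgn_pos_def)

lemma sgn_pos_sq' [simp]: "sgn_pos v T * (sgn_pos v T * x) = (x :: 'r::comm_ring_1)"
  by (simp flip: mult.assoc)

lemma sgn_pos_insert:
  assumes "finite T" "u \<notin> T"
  shows "sgn_pos v (insert u T) = (if u < v then - sgn_pos v T else sgn_pos v T :: 'r::comm_ring_1)"
proof -
  have "{w \<in> insert u T. w < v} = (if u < v then insert u {w \<in> T. w < v} else {w \<in> T. w < v})"
    by auto
  with assms show ?thesis by (simp add: sgn_pos_def)
qed

text \<open>Of two vertices exactly one precedes the other, so exactly one of the two signs changes.\<close>
lemma sgn_pos_swap:
  assumes "finite T" "u \<notin> T" "v \<notin> T" "u \<noteq> v"
  shows "sgn_pos v T * sgn_pos u (insert v T)
       = - (sgn_pos u T * sgn_pos v (insert u T) :: 'r::comm_ring_1)"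
  using assms by (auto simp: sgn_pos_insert)

text \<open>For \<open>\<Gamma>\<close> a set of subsets, this is the vanishing of the homology in degree \<open>q\<close> of the
  complex whose chains in degree \<open>i\<close> are the functions on the \<open>i\<close>-element members of \<open>\<Gamma>\<close>, and whose
  differential removes a vertex and forgets the sets outside \<open>\<Gamma>\<close>.\<close>
definition acyclic_at :: "'r::comm_ring_1 itself \<Rightarrow> 'v::linorder set \<Rightarrow> nat \<Rightarrow> 'v set set \<Rightarrow> bool" where
  "acyclic_at _ V q \<Gamma> \<longleftrightarrow>
    (\<forall>f :: 'v set \<Rightarrow> 'r. (\<forall>T. f T \<noteq> 0 \<longrightarrow> T \<in> \<Gamma> \<and> card T = q) \<longrightarrow> (\<forall>T\<in>\<Gamma>. altsum V f T = 0) \<longrightarrow>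
      (\<exists>g. (\<forall>T. g T \<noteq> 0 \<longrightarrow> T \<in> \<Gamma> \<and> card T = Suc q) \<and> (\<forall>T\<in>\<Gamma>. f T = altsum V g T)))"

lemma altsum_cong: "(\<And>v. v \<in> V - T \<Longrightarrow> f (insert v T) = g (insert v T)) \<Longrightarrow> altsum V f T = altsum V g T"
  by (simp add: altsum_def)

text \<open>The sum over ordered pairs is antisymmetric.\<close>
lemma altsum_altsum:
  fixes f :: "'v::linorder set \<Rightarrow> 'r::comm_ring_1"
  assumes "finite V" "finite T"
  shows "altsum V (altsum V f) T = 0"
proof -
  define P where "P = {(u, v). u \<in> V - T \<and> v \<in> V - T \<and> u < v}"
  define P' where "P' = {(u, v). u \<in> V - T \<and> v \<in> V - T \<and> v < u}"
  define F where "F = (\<lambda>(u, v). sgn_pos u T * sgn_pos v (insert u T) * f (insert v (insert u T)) :: 'r)"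
  have fin: "finite P" "finite P'"
    by (rule finite_subset[of _ "V \<times> V"]; use assms in \<open>auto simp: P_def P'_def\<close>)+
  have "altsum V (altsum V f) T
      = (\<Sum>u\<in>V - T. \<Sum>v\<in>V - insert u T. F (u, v))"
    by (simp add: altsum_def F_def sum_distrib_left mult.assoc)
  also have "\<dots> = sum F (SIGMA u:V - T. V - insert u T)"
    using assms by (subst sum.Sigma) auto
  also have "(SIGMA u:V - T. V - insert u T) = P \<union> P'"
    by (auto simp: P_def P'_def)
  also have "sum F \<dots> = sum F P + sum F P'"
    using fin by (intro sum.union_disjoint) (auto simp: P_def P'_def)
  also have "sum F P' = sum (\<lambda>p. F (prod.swap p)) P"
    by (rule sum.reindex_bij_witness[of _ prod.swap prod.swap]) (auto simp: P_def P'_def)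
  also have "sum F P + \<dots> = (\<Sum>p\<in>P. F p + F (prod.swap p))"
    by (simp add: sum.distrib)
  also have "\<dots> = 0"
  proof (rule sum.neutral, clarify)
    fix u v assume "(u, v) \<in> P"
    then have uv: "u \<notin> T" "v \<notin> T" "u \<noteq> v" by (auto simp: P_def)
    show "F (u, v) + F (prod.swap (u, v)) = 0"
      using sgn_pos_swap[OF assms(2) uv, where 'r = 'r] by (simp add: F_def insert_commute)
  qed
  finally show ?thesis .
qed

text \<open>
  Adjoining \<open>v\<close> is a homotopy between the identity and zero, as on a cone with apex \<open>v\<close>. On
  chains in degree \<open>q\<close>, the homotopy formula only involves the \<open>q\<close>-element members of \<open>\<Gamma>\<close>, which is
  why the last hypothesis is limited to that size. Both bounds on the homology of the Koszul complex rest
  on this restriction.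
\<close>
lemma acyclic_cone:
  fixes \<Gamma> :: "'v::linorder set set"
  assumes "finite V" "v \<in> V0" "V0 \<subseteq> V" "\<And>T. T \<in> \<Gamma> \<Longrightarrow> T \<subseteq> V0"
    and up: "\<And>T T'. T \<in> \<Gamma> \<Longrightarrow> T \<subseteq> T' \<Longrightarrow> T' \<subseteq> V0 \<Longrightarrow> T' \<in> \<Gamma>"
    and down: "\<And>T. T \<in> \<Gamma> \<Longrightarrow> card T = q \<Longrightarrow> v \<in> T \<Longrightarrow> T - {v} \<in> \<Gamma>"
  shows "acyclic_at TYPE('r::comm_ring_1) V q \<Gamma>"
  unfolding acyclic_at_def
proof (intro allI impI)
  fix f :: "'v set \<Rightarrow> 'r"
  assume f: "\<forall>T. f T \<noteq> 0 \<longrightarrow> T \<in> \<Gamma> \<and> card T = q" and cyc: "\<forall>T\<in>\<Gamma>. altsum V f T = 0"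
  have finT: "finite T" if "T \<in> \<Gamma>" for T
    using that assms finite_subset by metis
  \<comment> \<open>the homotopy applied to \<open>f\<close>\<close>
  define g where "g = (\<lambda>S. if v \<in> S then sgn_pos v (S - {v}) * f (S - {v}) else 0)"
  have "T \<in> \<Gamma> \<and> card T = Suc q" if nz: "g T \<noteq> 0" for T
  proof -
    from nz have v: "v \<in> T" "f (T - {v}) \<noteq> 0" by (auto simp: g_def split: if_splits)
    with f have *: "T - {v} \<in> \<Gamma>" "card (T - {v}) = q" by auto
    with v(1) assms(2,4) have "T \<in> \<Gamma>" by (intro up[of "T - {v}" T]) auto
    with * v(1) finT[of T] show ?thesis by (metis card_Suc_Diff1)
  qed
  moreover have "f T = altsum V g T" if T: "T \<in> \<Gamma>" for T
  proof (cases "v \<in> T")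
    case False
    have "altsum V g T = (\<Sum>u\<in>V - T. if u = v then f T else 0)"
      unfolding altsum_def using False by (intro sum.cong) (auto simp: g_def)
    also have "\<dots> = f T" using assms(1-3) False by (subst sum.delta) auto
    finally show ?thesis by simp
  next
    case True
    define W where "W = T - {v}"
    have W: "v \<notin> W" "T = insert v W" "finite W" using True finT[OF T] by (auto simp: W_def)
    have "altsum V g T = (\<Sum>u\<in>V - T. - (sgn_pos v W * (sgn_pos u W * f (insert u W))))"
      unfolding altsum_def
    proof (intro sum.cong refl)
      fix u assume u: "u \<in> V - T"
      have "insert u T - {v} = insert u W" using W u by auto
      then have "sgn_pos u T * g (insert u T)
          = sgn_pos u (insert v W) * sgn_pos v (insert u W) * f (insert u W)"
        using W by (simp add: g_def)
      also have "sgn_pos u (insert v W) * sgn_pos v (insert u W) = - (sgn_pos v W * sgn_pos u W :: 'r)"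
        using W u by (auto simp: sgn_pos_insert)
      finally show "sgn_pos u T * g (insert u T) = - (sgn_pos v W * (sgn_pos u W * f (insert u W)))"
        by simp
    qed
    also have "\<dots> = - (sgn_pos v W * (\<Sum>u\<in>V - T. sgn_pos u W * f (insert u W)))"
      by (simp add: sum_negf sum_distrib_left)
    also have "(\<Sum>u\<in>V - T. sgn_pos u W * f (insert u W)) = altsum V f W - sgn_pos v W * f T"
    proof -
      have "V - W = insert v (V - T)" using W assms(2,3) by auto
      then have "altsum V f W = (\<Sum>u\<in>insert v (V - T). sgn_pos u W * f (insert u W))"
        by (simp only: altsum_def)
      also have "\<dots> = sgn_pos v W * f T + (\<Sum>u\<in>V - T. sgn_pos u W * f (insert u W))"
        using \<open>v \<in> T\<close> assms(1) by (subst sum.insert) (simp_all flip: W(2))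
      finally show ?thesis by simp
    qed
    finally have "altsum V g T = f T - sgn_pos v W * altsum V f W"
      by (simp add: algebra_simps)
    moreover have "f T = 0 \<and> altsum V f W = 0 \<or> altsum V f W = 0"
    proof (cases "card T = q")
      case True
      with down[OF T] \<open>v \<in> T\<close> cyc show ?thesis by (simp add: W_def)
    next
      case False
      have "altsum V f W = 0" unfolding altsum_def
      proof (intro sum.neutral ballI)
        fix u assume u: "u \<in> V - W"
        have "card (insert u W) = card T" using u W by (simp)
        with False f have "f (insert u W) = 0" by metis
        then show "sgn_pos u W * f (insert u W) = 0" by simp
      qed
      then show ?thesis by simp
    qed
    ultimately show ?thesis by auto
  qed
  ultimately show "\<exists>g. (\<forall>T. g T \<noteq> 0 \<longrightarrow> T \<in> \<Gamma> \<and> card T = Suc q) \<and> (\<forall>T\<in>\<Gamma>. f T = altsum V g T)"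
    by blast
qed

section \<open>Taylor complexes\<close>

text \<open>The exponent of the least common multiple of the monomials \<open>g v\<close> for \<open>v \<in> T\<close>.\<close>
definition lcm_expo :: "('v \<Rightarrow> 'n::finite expo) \<Rightarrow> 'v set \<Rightarrow> 'n expo" where
  "lcm_expo g T = Abs_poly_mapping (\<lambda>i. Max (insert 0 ((\<lambda>v. lookup (g v) i) ` T)))"

lemma lookup_lcm_expo: "lookup (lcm_expo g T) i = Max (insert 0 ((\<lambda>v. lookup (g v) i) ` T))"
  by (simp add: lcm_expo_def)

lemma lcm_expo_empty [simp]: "lcm_expo g {} = 0"
  by (rule poly_mapping_eqI) (simp add: lookup_lcm_expo)

lemma lcm_expo_edvd: "finite T \<Longrightarrow> lcm_expo g T \<preceq> a \<longleftrightarrow> (\<forall>v\<in>T. g v \<preceq> a)"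
  by (auto simp: edvd_def lookup_lcm_expo)

lemma lcm_expo_mono: "finite T' \<Longrightarrow> T \<subseteq> T' \<Longrightarrow> lcm_expo g T \<preceq> lcm_expo g T'"
  using lcm_expo_edvd[of T' g "lcm_expo g T'"]
  by (subst lcm_expo_edvd) (auto intro: finite_subset)

text \<open>
  The Taylor complex of the monomials \<open>g v\<close> has a basis element for each \<open>T \<subseteq> V\<close>, in multidegree
  \<open>lcm_expo g T\<close>. A chain is its family of coefficients \<open>w\<close>. For the variables \<open>g v = x\<^sub>v\<close> it is the
  Koszul complex.
\<close>
definition taylor_d ::
  "'v::linorder set \<Rightarrow> ('v \<Rightarrow> 'n::finite expo) \<Rightarrow> ('v set \<Rightarrow> ('n, 'k::field) mpoly) \<Rightarrow> 'v set \<Rightarrow> ('n, 'k) mpoly"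
where
  "taylor_d V g w T =
     (\<Sum>v\<in>V - T. sgn_pos v T * (monom (lcm_expo g (insert v T) - lcm_expo g T) * w (insert v T)))"

text \<open>
  The part of \<open>w\<close> in multidegree \<open>a\<close>: the coefficient at \<open>T\<close> can only contribute its monomial of
  exponent \<open>a - lcm_expo g T\<close>. On strands, \<open>taylor_d\<close> becomes \<open>altsum\<close>.
\<close>
definition strand ::
  "('v \<Rightarrow> 'n::finite expo) \<Rightarrow> ('v set \<Rightarrow> ('n, 'k::field) mpoly) \<Rightarrow> 'n expo \<Rightarrow> 'v set \<Rightarrow> 'k"
where
  "strand g w a T = (if lcm_expo g T \<preceq> a then lookup (w T) (a - lcm_expo g T) else 0)"

text \<open>
  The basis of the strand in multidegree \<open>a\<close> of the Taylor complex with coefficients in \<open>R/I\<close>, where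
  \<open>I\<close> has exponents \<open>E\<close>.
\<close>
definition strand_faces :: "('v \<Rightarrow> 'n::finite expo) \<Rightarrow> 'v set \<Rightarrow> 'n expo set \<Rightarrow> 'n expo \<Rightarrow> 'v set set" where
  "strand_faces g V E a = {T. T \<subseteq> V \<and> lcm_expo g T \<preceq> a \<and> a - lcm_expo g T \<notin> E}"

lemma sgn_pos_cases: "sgn_pos v T = (1 :: 'r::comm_ring_1) \<and> sgn_pos v T = (1 :: 's::comm_ring_1) \<or>
   sgn_pos v T = (-1 :: 'r) \<and> sgn_pos v T = (-1 :: 's)"
  by (cases "even (card {u \<in> T. u < v})") (simp_all add: sgn_pos_def)

lemma lookup_sgn_pos_mult:
  fixes p :: "('n, 'k::field) mpoly"
  shows "lookup (sgn_pos v T * p) m = sgn_pos v T * lookup p m"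
  using sgn_pos_cases[of v T, where 'r = "('n, 'k) mpoly" and 's = 'k] by auto

lemma strand_nz: "strand g w a T \<noteq> 0 \<Longrightarrow> w T \<noteq> 0"
  by (auto simp: strand_def split: if_splits)

lemma strand_add: "strand g w (m + lcm_expo g T) T = lookup (w T) m"
  by (simp add: strand_def)

lemma strand_diff: "strand g (\<lambda>T. w T - w' T) a T = strand g w a T - strand g w' a T"
  by (simp add: strand_def lookup_minus)

lemma strand_taylor_d:
  assumes "finite T"
  shows "strand g (taylor_d V g w) a T = altsum V (strand g w a) T"
proof (cases "lcm_expo g T \<preceq> a")
  case True
  have "lookup (monom (lcm_expo g (insert v T) - lcm_expo g T) * w (insert v T)) (a - lcm_expo g T)
      = strand g w a (insert v T)" for v
  proof -
    let ?d = "lcm_expo g (insert v T) - lcm_expo g T"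
    have le: "lcm_expo g T \<preceq> lcm_expo g (insert v T)"
      using assms by (intro lcm_expo_mono) auto
    have "?d \<preceq> a - lcm_expo g T \<longleftrightarrow> lcm_expo g (insert v T) \<preceq> a"
      using le True unfolding edvd_def by (metis diff_le_mono eq_diff_iff le_diff_iff lookup_minus)
    moreover have "a - lcm_expo g T - ?d = a - lcm_expo g (insert v T)"
      using le True by (intro poly_mapping_eqI) (simp add: edvd_def lookup_minus)
    ultimately show ?thesis by (simp add: lookup_monom_mult strand_def)
  qed
  with True show ?thesis
    by (simp add: strand_def[of g "taylor_d V g w"] taylor_d_def altsum_def lookup_sum lookup_sgn_pos_mult)
next
  case False
  have "\<not> lcm_expo g (insert v T) \<preceq> a" for v
    using False assms by (auto simp: lcm_expo_edvd)
  with False show ?thesis by (simp add: strand_def altsum_def)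
qed

lemma taylor_d_taylor_d:
  assumes "finite V" "finite T"
  shows "taylor_d V g (taylor_d V g w) T = 0"
proof (rule poly_mapping_eqI)
  fix m
  let ?a = "m + lcm_expo g T"
  have "lookup (taylor_d V g (taylor_d V g w) T) m = altsum V (strand g (taylor_d V g w) ?a) T"
    using strand_taylor_d[OF assms(2)] strand_add by metis
  also have "\<dots> = altsum V (altsum V (strand g w ?a)) T"
    using assms(2) by (intro altsum_cong strand_taylor_d) auto
  finally show "lookup (taylor_d V g (taylor_d V g w) T) m = lookup 0 m"
    using assms by (simp add: altsum_altsum)
qed

lemma strand_faces_up:
  assumes "up_closed E" "finite V" "T \<in> strand_faces g V E a" "T \<subseteq> T'" "T' \<subseteq> V" "lcm_expo g T' \<preceq> a"
  shows "T' \<in> strand_faces g V E a"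
proof -
  have "lcm_expo g T \<preceq> lcm_expo g T'"
    using assms by (intro lcm_expo_mono) (auto intro: finite_subset)
  then have "a - lcm_expo g T' \<preceq> a - lcm_expo g T" by (rule edvd_minus_mono)
  with assms show ?thesis by (auto simp: strand_faces_def up_closed_def)
qed

text \<open>
  The family is closed upwards among the sets whose least common multiple divides \<open>x\<^sup>a\<close>, so cutting a
  strand down to the family does not change the differential at its members.
\<close>
lemma altsum_strand_faces:
  assumes "up_closed E" "finite V" "T \<in> strand_faces g V E a"
  shows "altsum V (\<lambda>T. if T \<in> strand_faces g V E a then strand g w a T else 0) T = altsum V (strand g w a) T"
proof (rule altsum_cong)
  fix v assume "v \<in> V - T"
  with assms show "(if insert v T \<in> strand_faces g V E a then strand g w a (insert v T) else 0)
      = strand g w a (insert v T)"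
    using strand_faces_up[OF assms, of "insert v T"] by (auto simp: strand_def strand_faces_def)
qed

lemma strand_mideal:
  assumes "w T \<in> mideal E" "T \<in> strand_faces g V E a"
  shows "strand g w a T = 0"
  using assms by (auto simp: strand_def strand_faces_def mideal_def in_keys_iff)

definition supp_card :: "'v set \<Rightarrow> nat \<Rightarrow> ('v set \<Rightarrow> 'r::zero) \<Rightarrow> bool" where
  "supp_card V q w \<longleftrightarrow> (\<forall>T. w T \<noteq> 0 \<longrightarrow> T \<subseteq> V \<and> card T = q)"

definition multidegs :: "('v \<Rightarrow> 'n::finite expo) \<Rightarrow> ('v set \<Rightarrow> ('n, 'k::field) mpoly) \<Rightarrow> 'n expo set" where
  "multidegs g w = {m + lcm_expo g T | m T. m \<in> keys (w T)}"

text \<open>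
  A cycle modulo \<open>I\<close> bounds modulo \<open>I\<close> as soon as this holds in each of the finitely many multidegrees
  that occur in it: the bounding chains of the strands are put together as a sum of monomials. The case
  \<open>E = {}\<close> concerns the Taylor complex itself.
\<close>
lemma taylor_lift:
  fixes w :: "'v::linorder set \<Rightarrow> ('n::finite, 'k::field) mpoly"
  assumes V: "finite V" and E: "up_closed E" and w: "supp_card V q w"
    and acyc: "\<And>a. a \<in> multidegs g w \<Longrightarrow> acyclic_at TYPE('k) V q (strand_faces g V E a)"
    and cyc: "\<And>T. T \<subseteq> V \<Longrightarrow> taylor_d V g w T \<in> mideal E"
  obtains w' where "supp_card V (Suc q) w'" "multidegs g w' \<subseteq> multidegs g w"
    "\<And>T. T \<subseteq> V \<Longrightarrow> w T - taylor_d V g w' T \<in> mideal E"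
proof -
  let ?G = "strand_faces g V E" and ?A = "multidegs g w"
  have finT: "finite T" if "T \<subseteq> V" for T using that V by (rule finite_subset)
  have "?A \<subseteq> (\<Union>T\<in>Pow V. (\<lambda>m. m + lcm_expo g T) ` keys (w T))"
  proof
    fix a assume "a \<in> ?A"
    then obtain m T where m: "a = m + lcm_expo g T" "m \<in> keys (w T)" by (auto simp: multidegs_def)
    then have "w T \<noteq> 0" by auto
    then have "T \<subseteq> V" using w by (simp add: supp_card_def)
    with m show "a \<in> (\<Union>T\<in>Pow V. (\<lambda>m. m + lcm_expo g T) ` keys (w T))" by blast
  qed
  then have finA: "finite ?A" by (rule finite_subset) (use V in auto)
  define f where "f = (\<lambda>a T. if T \<in> ?G a then strand g w a T else 0)"
  have "\<exists>h. (\<forall>T. h T \<noteq> 0 \<longrightarrow> T \<in> ?G a \<and> card T = Suc q) \<and> (\<forall>T\<in>?G a. f a T = altsum V h T)"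
    if a: "a \<in> ?A" for a
  proof -
    have "\<forall>T. f a T \<noteq> 0 \<longrightarrow> T \<in> ?G a \<and> card T = q"
      using w strand_nz[of g w a] by (auto simp: f_def supp_card_def split: if_splits)
    moreover have "\<forall>T\<in>?G a. altsum V (f a) T = 0"
    proof
      fix T assume T: "T \<in> ?G a"
      then have TV: "T \<subseteq> V" by (simp add: strand_faces_def)
      have "altsum V (f a) T = altsum V (strand g w a) T"
        unfolding f_def by (rule altsum_strand_faces[OF E V T])
      also have "\<dots> = strand g (taylor_d V g w) a T"
        by (rule strand_taylor_d[symmetric]) (rule finT[OF TV])
      also have "\<dots> = 0" by (rule strand_mideal[of _ _ E]) (use cyc T TV in auto)
      finally show "altsum V (f a) T = 0" .
    qed
    ultimately show ?thesis using acyc[OF a] unfolding acyclic_at_def by blast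
  qed
  then obtain h where h: "\<And>a T. a \<in> ?A \<Longrightarrow> h a T \<noteq> 0 \<Longrightarrow> T \<in> ?G a \<and> card T = Suc q"
      and fh: "\<And>a T. a \<in> ?A \<Longrightarrow> T \<in> ?G a \<Longrightarrow> f a T = altsum V (h a) T"
    by metis
  define w' where "w' = (\<lambda>T. \<Sum>a\<in>{a\<in>?A. lcm_expo g T \<preceq> a}. Poly_Mapping.single (a - lcm_expo g T) (h a T))"
  have lookup_w': "lookup (w' T) m = (if m + lcm_expo g T \<in> ?A then h (m + lcm_expo g T) T else 0)" for T m
  proof -
    let ?L = "lcm_expo g T"
    have "lookup (w' T) m = (\<Sum>a\<in>{a\<in>?A. ?L \<preceq> a}. if a = m + ?L then h a T else 0)"
      unfolding w'_def lookup_sum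
      by (intro sum.cong refl) (auto simp: lookup_single when_def edvd_diff_add dest: sym)
    also have "\<dots> = (if m + ?L \<in> ?A then h (m + ?L) T else 0)"
      using finA by (subst sum.delta) auto
    finally show ?thesis .
  qed
  have strand_w': "strand g w' b T = (if b \<in> ?A then h b T else 0)" for b T
  proof (cases "lcm_expo g T \<preceq> b")
    case True
    then show ?thesis by (simp add: strand_def lookup_w' edvd_diff_add)
  next
    case False
    then have "b \<in> ?A \<Longrightarrow> h b T = 0" using h[of b T] by (auto simp: strand_faces_def)
    with False show ?thesis by (simp add: strand_def)
  qed
  show ?thesis
  proof (rule that)
    show "supp_card V (Suc q) w'" unfolding supp_card_def
    proof (intro allI impI)
      fix T assume "w' T \<noteq> 0"
      then obtain m where "lookup (w' T) m \<noteq> 0" by (metis poly_mapping_eqI lookup_zero)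
      then show "T \<subseteq> V \<and> card T = Suc q"
        using h[of "m + lcm_expo g T" T] by (auto simp: lookup_w' strand_faces_def split: if_splits)
    qed
    show "multidegs g w' \<subseteq> ?A"
      by (auto simp: multidegs_def[of g w'] in_keys_iff lookup_w' split: if_splits)
    fix T assume T: "T \<subseteq> V"
    show "w T - taylor_d V g w' T \<in> mideal E" unfolding mideal_def
    proof clarify
      fix m assume m: "m \<in> keys (w T - taylor_d V g w' T)"
      let ?b = "m + lcm_expo g T"
      have "strand g (\<lambda>T. w T - taylor_d V g w' T) ?b T \<noteq> 0"
        using m by (simp only: strand_add in_keys_iff simp_thms)
      then have nz: "strand g w ?b T - altsum V (strand g w' ?b) T \<noteq> 0"
        by (simp only: strand_diff strand_taylor_d[OF finT[OF T]] simp_thms)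
      show "m \<in> E"
      proof (rule ccontr)
        assume "m \<notin> E"
        then have TG: "T \<in> ?G ?b" using T by (simp add: strand_faces_def)
        show False
        proof (cases "?b \<in> ?A")
          case True
          then have "strand g w' ?b = h ?b" by (simp add: strand_w' fun_eq_iff)
          with fh[OF True TG] nz TG show False by (simp add: f_def)
        next
          case False
          then have "strand g w' ?b = (\<lambda>_. 0)" by (simp add: strand_w' fun_eq_iff)
          with nz have "strand g w ?b T \<noteq> 0" by (simp add: altsum_def)
          then have "?b \<in> ?A" unfolding strand_add multidegs_def by (auto simp: in_keys_iff)
          with False show False by simp
        qed
      qed
    qed
  qed
qed

text \<open>
  The converse: a chain on the members of \<open>strand_faces\<close> is the strand of a chain of monomial multiples
  of basis elements, concentrated in the multidegree \<open>a\<close>.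
\<close>
lemma acyclic_at_strand_facesI:
  fixes g :: "'v::linorder \<Rightarrow> 'n::finite expo"
  assumes V: "finite V" and E: "up_closed E"
    and lift: "\<And>w :: 'v set \<Rightarrow> ('n, 'k::field) mpoly. supp_card V q w \<Longrightarrow> multidegs g w \<subseteq> {a} \<Longrightarrow>
        (\<And>T. T \<subseteq> V \<Longrightarrow> taylor_d V g w T \<in> mideal E) \<Longrightarrow>
        \<exists>w'. supp_card V (Suc q) w' \<and> (\<forall>T\<subseteq>V. w T - taylor_d V g w' T \<in> mideal E)"
  shows "acyclic_at TYPE('k) V q (strand_faces g V E a)"
  unfolding acyclic_at_def
proof (intro allI impI)
  let ?G = "strand_faces g V E a"
  fix f :: "'v set \<Rightarrow> 'k"
  assume f: "\<forall>T. f T \<noteq> 0 \<longrightarrow> T \<in> ?G \<and> card T = q" and cyc: "\<forall>T\<in>?G. altsum V f T = 0"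
  have finT: "finite T" if "T \<subseteq> V" for T using that V by (rule finite_subset)
  define w where "w = (\<lambda>T. Poly_Mapping.single (a - lcm_expo g T) (f T))"
  have strand_w: "strand g w b = (if b = a then f else (\<lambda>_. 0))" for b
  proof (rule ext)
    fix T
    show "strand g w b T = (if b = a then f else (\<lambda>_. 0)) T"
    proof (cases "f T = 0")
      case False
      with f have "lcm_expo g T \<preceq> a" by (auto simp: strand_faces_def)
      then show ?thesis
        by (auto simp: strand_def w_def lookup_single when_def dest: edvd_eqI)
    qed (simp add: strand_def w_def)
  qed
  have "f T \<noteq> 0" if "w T \<noteq> 0" for T using that by (auto simp: w_def)
  then have "supp_card V q w" using f by (simp add: supp_card_def strand_faces_def)
  moreover have "multidegs g w \<subseteq> {a}"
    using f by (auto simp: multidegs_def w_def strand_faces_def edvd_diff_add split: if_splits)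
  moreover have "taylor_d V g w T \<in> mideal E" if T: "T \<subseteq> V" for T
    unfolding mideal_def
  proof clarify
    fix m assume m: "m \<in> keys (taylor_d V g w T)"
    let ?b = "m + lcm_expo g T"
    have "strand g (taylor_d V g w) ?b T \<noteq> 0"
      using m by (simp only: strand_add in_keys_iff simp_thms)
    then have nz: "altsum V (strand g w ?b) T \<noteq> 0"
      by (simp only: strand_taylor_d[OF finT[OF T]] simp_thms)
    then have b: "?b = a" by (auto simp: strand_w altsum_def split: if_splits)
    with nz have "altsum V f T \<noteq> 0" by (simp add: strand_w)
    with cyc have "T \<notin> ?G" by auto
    with T b show "m \<in> E" by (auto simp: strand_faces_def)
  qed
  ultimately obtain w' where w': "supp_card V (Suc q) w'"
      and eq: "\<And>T. T \<subseteq> V \<Longrightarrow> w T - taylor_d V g w' T \<in> mideal E"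
    using lift by blast
  define h where "h = (\<lambda>T. if T \<in> ?G then strand g w' a T else 0)"
  have "f T = altsum V h T" if T: "T \<in> ?G" for T
  proof -
    from T have TV: "T \<subseteq> V" by (simp add: strand_faces_def)
    have "altsum V h T = altsum V (strand g w' a) T"
      unfolding h_def by (rule altsum_strand_faces[OF E V T])
    moreover have "strand g (\<lambda>T. w T - taylor_d V g w' T) a T = 0"
      by (rule strand_mideal[OF _ T]) (rule eq[OF TV])
    ultimately show ?thesis
      by (simp add: strand_diff strand_taylor_d[OF finT[OF TV]] strand_w)
  qed
  moreover have "\<forall>T. h T \<noteq> 0 \<longrightarrow> T \<in> ?G \<and> card T = Suc q"
    using w' strand_nz[of g w' a] by (auto simp: h_def supp_card_def split: if_splits)
  ultimately show "\<exists>h. (\<forall>T. h T \<noteq> 0 \<longrightarrow> T \<in> ?G \<and> card T = Suc q) \<and> (\<forall>T\<in>?G. f T = altsum V h T)"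
    by blast
qed

lemma strand_faces_empty:
  "finite V \<Longrightarrow> strand_faces g V {} a = Pow {v\<in>V. g v \<preceq> a}"
  by (auto simp: strand_faces_def lcm_expo_edvd finite_subset)

text \<open>
  In multidegree \<open>a\<close> the Taylor complex is the full simplex on the vertices \<open>v\<close> with \<open>g v\<close> dividing
  \<open>x\<^sup>a\<close>, a cone unless there is no such vertex. In degree \<open>0\<close> the last hypothesis says that the cycle
  lies in the ideal generated by the monomials.
\<close>
lemma taylor_exact:
  fixes w :: "'v::linorder set \<Rightarrow> ('n::finite, 'k::field) mpoly"
  assumes V: "finite V" and w: "supp_card V q w"
    and cyc: "\<And>T. T \<subseteq> V \<Longrightarrow> taylor_d V g w T = 0"
    and zero: "q = 0 \<Longrightarrow> keys (w {}) \<subseteq> {m. \<exists>v\<in>V. g v \<preceq> m}"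
  obtains w' where "supp_card V (Suc q) w'" "multidegs g w' \<subseteq> multidegs g w"
    "\<And>T. T \<subseteq> V \<Longrightarrow> w T = taylor_d V g w' T"
proof (rule taylor_lift[OF V _ w, of "{}" g])
  show "up_closed {}" by (simp add: up_closed_def)
  show "taylor_d V g w T \<in> mideal {}" if "T \<subseteq> V" for T
    using cyc that by (simp add: mideal_def)
  fix a assume a: "a \<in> multidegs g w"
  let ?Va = "{v\<in>V. g v \<preceq> a}"
  show "acyclic_at TYPE('k) V q (strand_faces g V {} a)"
  proof (cases "?Va = {}")
    case False
    then obtain v where v: "v \<in> ?Va" by blast
    show ?thesis unfolding strand_faces_empty[OF V]
      by (rule acyclic_cone[OF V v]) auto
  next
    case True
    have "q \<noteq> 0"
    proof
      assume q: "q = 0"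
      from a obtain m T where m: "a = m + lcm_expo g T" "m \<in> keys (w T)" by (auto simp: multidegs_def)
      then have "w T \<noteq> 0" by auto
      then have "T \<subseteq> V" "card T = q" using w by (simp_all add: supp_card_def)
      with q V have "T = {}" by (auto dest: finite_subset)
      with zero[OF q] m True show False by auto
    qed
    then have f0: "f = (\<lambda>_. 0)" if "\<forall>T. f T \<noteq> 0 \<longrightarrow> T \<in> Pow {} \<and> card T = q" for f :: "'v set \<Rightarrow> 'k"
      using that by (intro ext) (metis Pow_empty card.empty singletonD)
    then show ?thesis unfolding strand_faces_empty[OF V] True
      unfolding acyclic_at_def by (intro allI impI exI[of _ "\<lambda>_. 0"]) (drule f0, simp add: altsum_def)
  qed
next
  fix w' assume "supp_card V (Suc q) w'" "multidegs g w' \<subseteq> multidegs g w"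
    "\<And>T. T \<subseteq> V \<Longrightarrow> w T - taylor_d V g w' T \<in> mideal {}"
  then show thesis by (intro that[of w']) (auto simp: mideal_def)
qed

section \<open>Graded pieces\<close>

lemma homogeneous_0 [simp]: "homogeneous d 0"
  by (simp add: homogeneous_def)

lemma homogeneous_add: "homogeneous d p \<Longrightarrow> homogeneous d q \<Longrightarrow> homogeneous d (p + q)"
  using keys_add[of p q] by (auto simp: homogeneous_def)

lemma homogeneous_minus: "homogeneous d p \<Longrightarrow> homogeneous d q \<Longrightarrow> homogeneous d (p - q)"
  using keys_diff[of p q] by (auto simp: homogeneous_def)

lemma homogeneous_sum: "(\<And>x. x \<in> X \<Longrightarrow> homogeneous d (f x)) \<Longrightarrow> homogeneous d (sum f X)"
  by (induction X rule: infinite_finite_induct) (auto intro: homogeneous_add)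

lemma homogeneous_mult: "homogeneous d p \<Longrightarrow> homogeneous e q \<Longrightarrow> homogeneous (d + e) (p * q)"
  unfolding homogeneous_def by (auto elim!: keys_mult_edvd simp: total_deg_add)

lemma homogeneous_mult': "homogeneous d p \<Longrightarrow> homogeneous e q \<Longrightarrow> c = d + e \<Longrightarrow> homogeneous c (p * q)"
  by (simp add: homogeneous_mult)

lemma homogeneous_monom: "homogeneous (int (total_deg m)) (monom m)"
  by (simp add: homogeneous_def monom_def)

lemma homogeneous_single_0: "c = 0 \<or> d = 0 \<Longrightarrow> homogeneous d (Poly_Mapping.single 0 c)"
  by (auto simp: homogeneous_def total_deg_def)

lemma homogeneous_sgn_pos: "homogeneous d p \<Longrightarrow> homogeneous d (sgn_pos v T * p)"
  by (auto simp: homogeneous_def in_keys_iff lookup_sgn_pos_mult)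

definition hcomp :: "int \<Rightarrow> ('n::finite, 'k::field) mpoly \<Rightarrow> ('n, 'k) mpoly" where
  "hcomp e p = (\<Sum>m\<in>{m\<in>keys p. int (total_deg m) = e}. Poly_Mapping.single m (lookup p m))"

lemma lookup_hcomp: "lookup (hcomp e p) m = (if int (total_deg m) = e then lookup p m else 0)"
  by (auto simp: hcomp_def lookup_sum lookup_single when_def in_keys_iff)

lemma homogeneous_hcomp [simp]: "homogeneous e (hcomp e p)"
  by (auto simp: homogeneous_def in_keys_iff lookup_hcomp split: if_splits)

lemma hcomp_homogeneous: "homogeneous e p \<Longrightarrow> hcomp e p = p"
  by (rule poly_mapping_eqI) (auto simp: homogeneous_def in_keys_iff lookup_hcomp)

lemma hcomp_add: "hcomp e (p + q) = hcomp e p + hcomp e q"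
  by (rule poly_mapping_eqI) (simp add: lookup_hcomp lookup_add)

lemma hcomp_minus: "hcomp e (p - q) = hcomp e p - hcomp e q"
  by (rule poly_mapping_eqI) (simp add: lookup_hcomp lookup_minus)

lemma hcomp_sum: "hcomp e (sum f X) = (\<Sum>x\<in>X. hcomp e (f x))"
  by (rule poly_mapping_eqI) (simp add: lookup_hcomp lookup_sum)

lemma hcomp_mideal: "p \<in> mideal E \<Longrightarrow> hcomp e p \<in> mideal E"
  by (auto simp: mideal_def in_keys_iff lookup_hcomp subset_iff split: if_splits)

text \<open>
  Splitting \<open>p\<close> into its component of degree \<open>e - d\<close> and the rest, the rest contributes to degrees other
  than \<open>e\<close> only.
\<close>
lemma hcomp_mult:
  assumes "homogeneous d q"
  shows "hcomp e (p * q) = hcomp (e - d) p * q"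
proof -
  let ?r = "p - hcomp (e - d) p"
  have "hcomp e (?r * q) = 0"
  proof (rule poly_mapping_eqI, rule ccontr)
    fix m assume "lookup (hcomp e (?r * q)) m \<noteq> lookup 0 m"
    then have m: "int (total_deg m) = e" "m \<in> keys (?r * q)"
      by (auto simp: lookup_hcomp in_keys_iff split: if_splits)
    then obtain m1 m2 where "m1 \<in> keys ?r" "m2 \<in> keys q" "m = m1 + m2"
      by (elim keys_mult_edvd)
    with assms m(1) show False
      by (auto simp: homogeneous_def in_keys_iff lookup_hcomp lookup_minus total_deg_add split: if_splits)
  qed
  moreover have "hcomp e (hcomp (e - d) p * q) = hcomp (e - d) p * q"
    using homogeneous_mult[OF homogeneous_hcomp assms, of "e - d" p] by (intro hcomp_homogeneous) simp
  moreover have "p * q = ?r * q + hcomp (e - d) p * q" by (simp add: algebra_simps)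
  ultimately show ?thesis by (simp only: hcomp_add) simp
qed

lemma lookup_mult_0:
  fixes p q :: "('n, 'k::field) mpoly"
  shows "lookup (p * q) 0 = lookup p 0 * lookup q 0"
proof -
  have "(0 = l + r) \<longleftrightarrow> r = 0 \<and> l = 0" for l r :: "'n expo"
    by (auto simp: poly_mapping_eq_iff lookup_add fun_eq_iff)
  then have "lookup (p * q) 0 = (\<Sum>l. lookup p l * (\<Sum>r. (lookup q r when r = 0) when l = 0))"
    by (simp add: lookup_mult when_when)
  then show ?thesis by (simp add: Sum_any_when_independent mult_when)
qed

section \<open>Double complexes with exact rows and columns\<close>

text \<open>
  The squares commute rather than anticommute. The last two assumptions are exactness of rows and
  columns away from the edges, where the homology of interest sits.
\<close>
locale double_complex =
  fixes C :: "nat \<Rightarrow> nat \<Rightarrow> 'a::ab_group_add set"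
    and dh dv :: "nat \<Rightarrow> 'a \<Rightarrow> 'a"
  assumes C_diff: "x \<in> C p q \<Longrightarrow> y \<in> C p q \<Longrightarrow> x - y \<in> C p q"
    and dh_in: "x \<in> C (Suc p) q \<Longrightarrow> dh p x \<in> C p q"
    and dv_in: "x \<in> C p (Suc q) \<Longrightarrow> dv q x \<in> C p q"
    and dh_diff: "dh p (x - y) = dh p x - dh p y"
    and dv_diff: "dv q (x - y) = dv q x - dv q y"
    and dh_dv: "x \<in> C (Suc p) (Suc q) \<Longrightarrow> dh p (dv q x) = dv q (dh p x)"
    and dh_dh: "x \<in> C (Suc (Suc p)) q \<Longrightarrow> dh p (dh (Suc p) x) = 0"
    and dv_dv: "x \<in> C p (Suc (Suc q)) \<Longrightarrow> dv q (dv (Suc q) x) = 0"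
    and h_exact: "x \<in> C (Suc p) q \<Longrightarrow> dh p x = 0 \<Longrightarrow> \<exists>y\<in>C (Suc (Suc p)) q. dh (Suc p) y = x"
    and v_exact: "x \<in> C p (Suc q) \<Longrightarrow> dv q x = 0 \<Longrightarrow> \<exists>y\<in>C p (Suc (Suc q)). dv (Suc q) y = x"

text \<open>
  Vanishing of the homology in degree \<open>p\<close> of the complex of the quotients \<open>C p 0 / dv 0 (C p 1)\<close>, with
  the differential induced by \<open>dh\<close>.
\<close>
definition edge_acyclic ::
  "(nat \<Rightarrow> nat \<Rightarrow> 'a::ab_group_add set) \<Rightarrow> (nat \<Rightarrow> 'a \<Rightarrow> 'a) \<Rightarrow> (nat \<Rightarrow> 'a \<Rightarrow> 'a) \<Rightarrow> nat \<Rightarrow> bool"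
where
  "edge_acyclic C dh dv p \<longleftrightarrow>
    (\<forall>y\<in>C p 0. (\<forall>p'. p = Suc p' \<longrightarrow> (\<exists>x\<in>C p' 1. dh p' y = dv 0 x)) \<longrightarrow>
       (\<exists>z\<in>C (Suc p) 0. \<exists>w\<in>C p 1. y = dh p z + dv 0 w))"

context double_complex
begin

lemma swap: "double_complex (\<lambda>p q. C q p) dv dh"
  by unfold_locales
    (simp_all add: C_diff dh_in dv_in dh_diff dv_diff dh_dv dh_dh dv_dv h_exact v_exact)

text \<open>
  The chase runs along the antidiagonal \<open>p + q = i\<close>. The condition on \<open>y\<close> provides the next element
  \<open>y'\<close> with \<open>dv y = dh y'\<close>, and row exactness the same condition for \<open>y'\<close>. The induction
  hypothesis splits \<open>y'\<close>, and column exactness carries the splitting back to \<open>y\<close>.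
\<close>
lemma staircase:
  assumes "edge_acyclic C dh dv i"
  shows "p + q = i \<Longrightarrow> y \<in> C p q \<Longrightarrow>
      (\<And>p'. p = Suc p' \<Longrightarrow> \<exists>x\<in>C p' (Suc q). dh p' y = dv q x) \<Longrightarrow>
      (\<And>q'. q = Suc q' \<Longrightarrow> \<exists>x\<in>C (Suc p) q'. dv q' y = dh p x) \<Longrightarrow>
      \<exists>z\<in>C (Suc p) q. \<exists>w\<in>C p (Suc q). y = dh p z + dv q w"
proof (induction q arbitrary: p y)
  case 0
  with assms show ?case by (simp add: edge_acyclic_def)
next
  case (Suc q)
  from Suc.prems(4)[OF refl] obtain y' where y': "y' \<in> C (Suc p) q" "dv q y = dh p y'" by blast
  have "\<exists>x\<in>C (Suc (Suc p)) q'. dv q' y' = dh (Suc p) x" if q': "q = Suc q'" for q'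
  proof -
    have "dh p (dv q' y') = dv q' (dh p y')" using dh_dv y' q' by blast
    also have "\<dots> = 0" using dv_dv y' Suc.prems(2) q' by metis
    finally show ?thesis using h_exact[of "dv q' y'" p q'] dv_in y' q' by metis
  qed
  moreover have "\<exists>x\<in>C p' (Suc q). dh p' y' = dv q x" if "Suc p = Suc p'" for p'
    using that y' Suc.prems(2) by (metis nat.inject)
  ultimately obtain z w
    where zw: "z \<in> C (Suc (Suc p)) q" "w \<in> C (Suc p) (Suc q)" "y' = dh (Suc p) z + dv q w"
    using Suc.IH[of "Suc p" y'] Suc.prems(1) y'(1) by (metis add_Suc_shift)
  then have "y' - dv q w = dh (Suc p) z" by simp
  then have "dh p y' = dh p (dv q w)"
    using dh_diff[of p y' "dv q w"] dh_dh[OF zw(1)] by simp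
  then have "dv q (y - dh p w) = 0"
    using y' zw by (simp add: dv_diff dh_dv)
  moreover have "y - dh p w \<in> C p (Suc q)"
    using Suc.prems(2) zw dh_in C_diff by blast
  ultimately obtain v where "v \<in> C p (Suc (Suc q))" "dv (Suc q) v = y - dh p w"
    using v_exact by blast
  then have "y = dh p w + dv (Suc q) v" by simp
  with zw \<open>v \<in> _\<close> show ?case by blast
qed

lemma edge_acyclic_imp:
  assumes "edge_acyclic C dh dv i"
  shows "edge_acyclic (\<lambda>p q. C q p) dv dh i"
  unfolding edge_acyclic_def
proof (intro ballI impI)
  fix y assume y: "y \<in> C 0 i" "\<forall>p'. i = Suc p' \<longrightarrow> (\<exists>x\<in>C 1 p'. dv p' y = dh 0 x)"
  then obtain z w where "z \<in> C (Suc 0) i" "w \<in> C 0 (Suc i)" "y = dh 0 z + dv i w"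
    using staircase[OF assms, of 0 i y] by auto
  then show "\<exists>z\<in>C 0 (Suc i). \<exists>w\<in>C 1 i. y = dv i z + dh 0 w"
    by (auto simp: add.commute)
qed

lemma edge_acyclic_iff: "edge_acyclic C dh dv i \<longleftrightarrow> edge_acyclic (\<lambda>p q. C q p) dv dh i"
proof -
  interpret s: double_complex "\<lambda>p q. C q p" dv dh by (rule swap)
  show ?thesis using edge_acyclic_imp s.edge_acyclic_imp by blast
qed

end

section \<open>Tor through the Koszul complex\<close>

definition var_expo :: "'n::finite \<Rightarrow> 'n expo" where
  "var_expo t = Poly_Mapping.single t 1"

lemma lookup_var_expo: "lookup (var_expo t) i = (if i = t then 1 else 0)"
  by (simp add: var_expo_def lookup_single when_def)

lemma total_deg_var_expo [simp]: "total_deg (var_expo t) = 1"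
proof -
  have "total_deg (var_expo t) = (\<Sum>i\<in>UNIV. if i = t then 1 else 0)"
    unfolding total_deg_def by (intro sum.cong) (simp_all add: lookup_var_expo)
  then show ?thesis by simp
qed

abbreviation koszul_d ::
  "('n::{finite,linorder} set \<Rightarrow> ('n, 'k::field) mpoly) \<Rightarrow> 'n set \<Rightarrow> ('n, 'k) mpoly" where
  "koszul_d \<equiv> taylor_d UNIV var_expo"

abbreviation koszul_faces :: "'n::{finite,linorder} expo set \<Rightarrow> 'n expo \<Rightarrow> 'n set set" where
  "koszul_faces \<equiv> strand_faces var_expo UNIV"

lemma lookup_lcm_var: "lookup (lcm_expo var_expo S) i = (if i \<in> S then 1 else 0)"
  for S :: "'n::finite set"
proof (cases "i \<in> S")
  case True
  have "Max (insert 0 ((\<lambda>v. lookup (var_expo v) i) ` S)) = 1"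
  proof (rule Max_eqI)
    show "1 \<in> insert 0 ((\<lambda>v. lookup (var_expo v) i) ` S)"
      using True by (auto simp: image_iff lookup_var_expo intro!: bexI[of _ i])
  qed (auto simp: lookup_var_expo)
  with True show ?thesis by (simp add: lookup_lcm_expo)
next
  case False
  have "Max (insert 0 ((\<lambda>v. lookup (var_expo v) i) ` S)) = 0"
    using False by (intro Max_eqI) (auto simp: lookup_var_expo)
  with False show ?thesis by (simp add: lookup_lcm_expo)
qed

lemma total_deg_lcm_var [simp]: "total_deg (lcm_expo var_expo S) = card S"
proof -
  have "total_deg (lcm_expo var_expo S) = (\<Sum>i\<in>UNIV. if i \<in> S then 1 else 0)"
    unfolding total_deg_def by (intro sum.cong) (simp_all add: lookup_lcm_var)
  then show ?thesis by (simp add: sum.If_cases)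
qed

lemma lcm_var_minus:
  "v \<notin> S \<Longrightarrow> lcm_expo var_expo (insert v S) - lcm_expo var_expo S = (var_expo v :: 'n::finite expo)"
  by (rule poly_mapping_eqI) (auto simp: lookup_minus lookup_lcm_var lookup_var_expo)

lemma koszul_d_eq: "koszul_d w S = (\<Sum>v\<in>-S. sgn_pos v S * (monom (var_expo v) * w (insert v S)))"
  unfolding taylor_d_def by (intro sum.cong) (auto simp: lcm_var_minus)

lemma koszul_d_diff: "koszul_d (\<lambda>S. w S - w' S) S = koszul_d w S - koszul_d w' S"
  by (simp add: koszul_d_eq algebra_simps sum_subtractf)

lemma koszul_d_mult: "koszul_d w S * p = koszul_d (\<lambda>S. w S * p) S"
  by (simp add: koszul_d_eq sum_distrib_right mult.assoc)

lemma koszul_d_sum: "koszul_d (\<lambda>S. \<Sum>b\<in>B. w b S) S = (\<Sum>b\<in>B. koszul_d (w b) S)"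
  by (simp add: koszul_d_eq sum_distrib_left) (rule sum.swap)

lemma koszul_d_0 [simp]: "koszul_d (\<lambda>_. 0) S = 0"
  by (simp add: koszul_d_eq)

lemma koszul_d_card:
  assumes "koszul_d w S \<noteq> 0" "\<And>T. w T \<noteq> 0 \<Longrightarrow> card T = q"
  shows "q = Suc (card S)"
proof -
  from assms(1) obtain v where v: "v \<notin> S" "w (insert v S) \<noteq> 0"
    unfolding koszul_d_eq by (metis (mono_tags, lifting) ComplD mult_zero_right sum.neutral)
  from assms(2)[OF v(2)] v(1) show ?thesis by simp
qed

lemma koszul_d_homogeneous:
  "(\<And>T. homogeneous (e - 1) (w T)) \<Longrightarrow> homogeneous e (koszul_d w S)"
  unfolding koszul_d_eq
  by (intro homogeneous_sum homogeneous_sgn_pos homogeneous_mult'[OF homogeneous_monom])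
    auto

lemma koszul_d_mideal:
  assumes "up_closed E" "\<And>T. w T \<in> mideal E"
  shows "koszul_d w S \<in> mideal E"
proof -
  have "sgn_pos v S * (monom (var_expo v) * w (insert v S)) \<in> mideal E" for v
    using mideal_mult[of E "w (insert v S)" "sgn_pos v S * monom (var_expo v)"] assms
    by (simp add: up_closed_def mult.commute mult.left_commute)
  then show ?thesis unfolding koszul_d_eq by (intro mideal_sum)
qed

text \<open>
  The basis element of the Koszul complex at \<open>S\<close> has degree \<open>card S\<close>, so homogeneity of a chain of
  degree \<open>q\<close> can be read off its multidegrees.
\<close>
lemma multidegs_homogeneous:
  assumes "supp_card UNIV q w"
  shows "(\<forall>S. homogeneous (e - int q) (w S)) \<longleftrightarrow> (\<forall>a\<in>multidegs var_expo w. int (total_deg a) = e)"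
proof -
  have "card S = q" if "m \<in> keys (w S)" for m S
  proof -
    from that have "w S \<noteq> 0" by auto
    with assms show ?thesis by (simp add: supp_card_def)
  qed
  then show ?thesis
    unfolding homogeneous_def multidegs_def
    by (fastforce simp: total_deg_add)
qed

subsection \<open>Vectors over a graded resolution\<close>

locale graded_resolution =
  fixes F :: "('n::{finite,linorder}, 'k::field) mpoly free_complex"
    and E :: "'n expo set"
  assumes res: "resolves F (mideal E)" and up: "up_closed E"
begin

lemma gfc: "graded_free_complex F"
  using res by (simp add: resolves_def)

lemma fin [simp]: "finite (basis F p)"
  using gfc by (simp add: graded_free_complex_def)

lemma diff_outside: "b \<in> basis F (Suc p) \<Longrightarrow> c \<notin> basis F p \<Longrightarrow> diff F p b c = 0"
  using gfc by (auto simp: graded_free_complex_def free_on_def)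

lemma diff_homogeneous: "b \<in> basis F (Suc p) \<Longrightarrow> c \<in> basis F p \<Longrightarrow>
    homogeneous (bdeg F (Suc p) b - bdeg F p c) (diff F p b c)"
  using gfc by (auto simp: graded_free_complex_def)

lemma aug_homogeneous: "b \<in> basis F 0 \<Longrightarrow> homogeneous (bdeg F 0 b) (aug F b)"
  using gfc by (auto simp: graded_free_complex_def)

lemma bd_eq: "bd F p x c = (\<Sum>b\<in>basis F (Suc p). x b * diff F p b c)"
  by (simp add: bd_def lin_map_def)

lemma bd_outside: "c \<notin> basis F p \<Longrightarrow> bd F p x c = 0"
  unfolding bd_eq by (intro sum.neutral) (simp add: diff_outside)

lemma exact_0: "v \<in> free_on (basis F 0) \<Longrightarrow> aug_map F v \<in> mideal E \<longleftrightarrow> v \<in> bd F 0 ` free_on (basis F 1)"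
  using res by (auto simp: resolves_def)

lemma aug_bd: "v \<in> free_on (basis F 1) \<Longrightarrow> aug_map F (bd F 0 v) \<in> mideal E"
  using res by (auto simp: resolves_def)

lemma exact_Suc: "v \<in> free_on (basis F (Suc p)) \<Longrightarrow>
    bd F p v = (\<lambda>_. 0) \<longleftrightarrow> v \<in> bd F (Suc p) ` free_on (basis F (Suc (Suc p)))"
proof -
  have "{v \<in> free_on (basis F (p + 1)). bd F p v = (\<lambda>_. 0)} = bd F (p + 1) ` free_on (basis F (p + 2))"
    using res unfolding resolves_def by blast
  then show "v \<in> free_on (basis F (Suc p)) \<Longrightarrow> ?thesis" by auto
qed

lemma bd_bd: "v \<in> free_on (basis F (Suc (Suc p))) \<Longrightarrow> bd F p (bd F (Suc p) v) = (\<lambda>_. 0)"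
proof -
  assume v: "v \<in> free_on (basis F (Suc (Suc p)))"
  have "bd F (Suc p) v \<in> free_on (basis F (Suc p))" by (simp add: free_on_def bd_outside)
  with v show ?thesis using exact_Suc by blast
qed

text \<open>
  Preimages can be taken homogeneous: replace the coefficients by their components of the expected
  degree.
\<close>
lemma bd_graded_preimage:
  assumes "bd F p y = x" "\<And>c. homogeneous (e - bdeg F p c) (x c)"
  obtains y' where "y' \<in> free_on (basis F (Suc p))" "\<And>b. homogeneous (e - bdeg F (Suc p) b) (y' b)"
    "bd F p y' = x"
proof
  define y' where "y' = (\<lambda>b. if b \<in> basis F (Suc p) then hcomp (e - bdeg F (Suc p) b) (y b) else 0)"
  show "y' \<in> free_on (basis F (Suc p))" by (simp add: y'_def free_on_def)
  show "homogeneous (e - bdeg F (Suc p) b) (y' b)" for b by (simp add: y'_def)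
  show "bd F p y' = x"
  proof
    fix c
    show "bd F p y' c = x c"
    proof (cases "c \<in> basis F p")
      case False
      then show ?thesis using assms(1) bd_outside by metis
    next
      case True
      have "bd F p y' c = (\<Sum>b\<in>basis F (Suc p). hcomp (e - bdeg F p c) (y b * diff F p b c))"
        unfolding bd_eq
        by (intro sum.cong refl) (simp add: y'_def hcomp_mult[OF diff_homogeneous[OF _ True]])
      also have "\<dots> = hcomp (e - bdeg F p c) (x c)"
        by (simp add: hcomp_sum bd_eq flip: assms(1))
      finally show ?thesis using assms(2) by (simp add: hcomp_homogeneous)
    qed
  qed
qed

lemma aug_graded_preimage:
  assumes "homogeneous e p"
  obtains v where "v \<in> free_on (basis F 0)" "\<And>b. homogeneous (e - bdeg F 0 b) (v b)"
    "p - aug_map F v \<in> mideal E"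
proof -
  from res obtain v where v: "v \<in> free_on (basis F 0)" "p - aug_map F v \<in> mideal E"
    unfolding resolves_def by blast
  define v' where "v' = (\<lambda>b. hcomp (e - bdeg F 0 b) (v b))"
  have "aug_map F v' = hcomp e (aug_map F v)"
    by (simp add: aug_map_def v'_def hcomp_sum hcomp_mult[OF aug_homogeneous])
  then have "p - aug_map F v' = hcomp e (p - aug_map F v)"
    using assms by (simp add: hcomp_minus hcomp_homogeneous)
  with v(2) have "p - aug_map F v' \<in> mideal E" by (simp add: hcomp_mideal)
  moreover have "v' \<in> free_on (basis F 0)" using v(1) by (simp add: v'_def free_on_def hcomp_def)
  ultimately show ?thesis by (intro that[of v']) (simp_all add: v'_def)
qed

lemma const_bd: "lookup (bd F p x c) 0 = tensor_bd F p (\<lambda>b. lookup (x b) 0) c"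
  by (simp add: bd_eq tensor_bd_def lin_map_def lookup_sum lookup_mult_0)

text \<open>
  Vectors over \<open>k\<close> are the constant coefficients of constant vectors over \<open>R\<close>, and taking constant
  coefficients commutes with the differentials, so this comes from \<open>bd \<circ> bd = 0\<close>.
\<close>
lemma tor_boundaries_subset: "tor_boundaries F p d \<subseteq> tor_cycles F p d"
proof
  fix w assume "w \<in> tor_boundaries F p d"
  then obtain u where u: "u \<in> free_on (basis_deg F (Suc p) d)" "w = tensor_bd F p u"
    by (auto simp: tor_boundaries_def)
  define x where "x = (\<lambda>b. Poly_Mapping.single 0 (u b) :: ('n, 'k) mpoly)"
  have x: "x \<in> free_on (basis F (Suc p))"
    using u(1) by (auto simp: x_def free_on_def basis_deg_def)
  have w: "w = (\<lambda>c. lookup (bd F p x c) 0)" by (simp add: const_bd x_def u(2))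
  have "w c = 0" if c: "c \<notin> basis_deg F p d" for c
  proof (cases "c \<in> basis F p")
    case False
    then show ?thesis by (simp add: w bd_outside)
  next
    case True
    have "u b * lookup (diff F p b c) 0 = 0" if b: "b \<in> basis F (Suc p)" for b
    proof (rule ccontr)
      assume nz: "u b * lookup (diff F p b c) 0 \<noteq> 0"
      with u(1) have "bdeg F (Suc p) b = d" by (auto simp: free_on_def basis_deg_def)
      moreover have "0 \<in> keys (diff F p b c)" using nz by (auto simp: in_keys_iff)
      then have "bdeg F (Suc p) b = bdeg F p c"
        using diff_homogeneous[OF b True] by (force simp: homogeneous_def total_deg_def)
      ultimately show False using c True by (simp add: basis_deg_def)
    qed
    then show ?thesis unfolding u(2) tensor_bd_def lin_map_def by (rule sum.neutral[OF ballI])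
  qed
  moreover have "tensor_bd F p' w = (\<lambda>_. 0)" if p': "p = Suc p'" for p'
  proof
    fix c
    have "tensor_bd F p' w c = lookup (bd F p' (bd F p x) c) 0" by (simp add: const_bd w)
    also have "bd F p' (bd F p x) = (\<lambda>_. 0)" using bd_bd x p' by simp
    finally show "tensor_bd F p' w c = 0" by simp
  qed
  ultimately show "w \<in> tor_cycles F p d"
    by (auto simp: tor_cycles_def free_on_def split: nat.split)
qed

text \<open>
  The degree \<open>d\<close> part of \<open>F\<^sub>p \<otimes> K\<^sub>q\<close>, where \<open>K\<close> is the Koszul complex: the coefficient of
  \<open>b \<otimes> e\<^sub>S\<close> with \<open>card S = q\<close> is homogeneous of degree \<open>d - deg b - q\<close>. The sets \<open>S\<close> of other sizes
  carry the coefficient \<open>0\<close>, which is homogeneous of every degree.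
\<close>
definition FK :: "int \<Rightarrow> nat \<Rightarrow> nat \<Rightarrow> (nat \<Rightarrow> 'n set \<Rightarrow> ('n, 'k) mpoly) set" where
  "FK d p q = {y. (\<forall>b S. y b S \<noteq> 0 \<longrightarrow> b \<in> basis F p \<and> card S = q) \<and>
                  (\<forall>b S. homogeneous (d - bdeg F p b - int q) (y b S))}"

definition dhF :: "nat \<Rightarrow> (nat \<Rightarrow> 'n set \<Rightarrow> ('n, 'k) mpoly) \<Rightarrow> nat \<Rightarrow> 'n set \<Rightarrow> ('n, 'k) mpoly" where
  "dhF p y = (\<lambda>c S. bd F p (\<lambda>b. y b S) c)"

definition dvF :: "nat \<Rightarrow> (nat \<Rightarrow> 'n set \<Rightarrow> ('n, 'k) mpoly) \<Rightarrow> nat \<Rightarrow> 'n set \<Rightarrow> ('n, 'k) mpoly" where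
  "dvF q y = (\<lambda>b. koszul_d (y b))"

lemma FK_free: "y \<in> FK d p q \<Longrightarrow> (\<lambda>b. y b S) \<in> free_on (basis F p)"
  by (auto simp: FK_def free_on_def)

lemma FK_supp: "y \<in> FK d p q \<Longrightarrow> supp_card UNIV q (y b)"
  by (auto simp: FK_def supp_card_def)

lemma FK_hom: "y \<in> FK d p q \<Longrightarrow> homogeneous (d - bdeg F p b - int q) (y b S)"
  by (simp add: FK_def)

lemma FK_diff: "x \<in> FK d p q \<Longrightarrow> y \<in> FK d p q \<Longrightarrow> x - y \<in> FK d p q"
proof -
  assume xy: "x \<in> FK d p q" "y \<in> FK d p q"
  have "x b S \<noteq> 0 \<or> y b S \<noteq> 0" if "x b S - y b S \<noteq> 0" for b S
    using that by auto
  with xy show ?thesis unfolding FK_def by (simp add: homogeneous_minus) metis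
qed

lemma bd_0 [simp]: "bd F p (\<lambda>_. 0) = (\<lambda>_. 0)"
  by (simp add: bd_eq fun_eq_iff)

lemma FK_assemble:
  assumes "\<And>S. card S = q \<Longrightarrow> v S \<in> free_on (basis F p) \<and> (\<forall>b. homogeneous (d - int q - bdeg F p b) (v S b))"
  shows "(\<lambda>b S. if card S = q then v S b else 0) \<in> FK d p q"
  using assms by (auto simp: FK_def free_on_def algebra_simps)

lemma dh_in: assumes "x \<in> FK d (Suc p) q" shows "dhF p x \<in> FK d p q"
  unfolding FK_def
proof (intro CollectI conjI allI impI)
  fix c S
  assume nz: "dhF p x c S \<noteq> 0"
  then show "c \<in> basis F p" unfolding dhF_def using bd_outside by blast
  from nz obtain b where "x b S \<noteq> 0" unfolding dhF_def bd_eq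
    by (metis (mono_tags, lifting) mult_zero_left sum.neutral)
  then show "card S = q" using assms by (simp add: FK_def)
next
  fix c S
  show "homogeneous (d - bdeg F p c - int q) (dhF p x c S)"
  proof (cases "c \<in> basis F p")
    case True
    show ?thesis unfolding dhF_def bd_eq
      by (intro homogeneous_sum homogeneous_mult'[OF FK_hom[OF assms] diff_homogeneous[OF _ True]]) auto
  qed (simp add: dhF_def bd_outside)
qed

lemma dv_in: assumes "x \<in> FK d p (Suc q)" shows "dvF q x \<in> FK d p q"
  unfolding FK_def
proof (intro CollectI conjI allI impI)
  fix b S
  assume nz: "dvF q x b S \<noteq> 0"
  show "b \<in> basis F p"
  proof (rule ccontr)
    assume "b \<notin> basis F p"
    with assms have "x b = (\<lambda>_. 0)" by (auto simp: FK_def)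
    with nz show False by (simp add: dvF_def)
  qed
  show "card S = q"
    using koszul_d_card[of "x b" S "Suc q"] nz assms by (auto simp: dvF_def FK_def)
next
  fix b S
  show "homogeneous (d - bdeg F p b - int q) (dvF q x b S)"
    unfolding dvF_def using FK_hom[OF assms, of b]
    by (intro koszul_d_homogeneous) (simp add: algebra_simps)
qed

lemma dh_dv: "dhF p (dvF q x) = dvF q (dhF p x)"
  by (simp add: dhF_def dvF_def bd_eq koszul_d_mult koszul_d_sum fun_eq_iff)

lemma dhF_row: "dhF p y = x \<longleftrightarrow> (\<forall>S. bd F p (\<lambda>b. y b S) = (\<lambda>c. x c S))"
  by (auto simp: dhF_def fun_eq_iff)

lemma dh_preimage:
  assumes "x \<in> FK d p q" "\<And>S. (\<lambda>c. x c S) \<in> bd F p ` free_on (basis F (Suc p))"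
  shows "\<exists>y\<in>FK d (Suc p) q. dhF p y = x"
proof -
  have "\<exists>y. y \<in> free_on (basis F (Suc p)) \<and> (\<forall>b. homogeneous (d - int q - bdeg F (Suc p) b) (y b))
      \<and> bd F p y = (\<lambda>c. x c S)" for S
  proof -
    from assms(2)[of S] obtain y where "bd F p y = (\<lambda>c. x c S)" by auto
    then show ?thesis
      by (rule bd_graded_preimage[where e = "d - int q"])
        (use FK_hom[OF assms(1)] in \<open>auto simp: algebra_simps\<close>)
  qed
  then obtain v where v: "\<And>S. v S \<in> free_on (basis F (Suc p))"
    "\<And>S b. homogeneous (d - int q - bdeg F (Suc p) b) (v S b)" "\<And>S. bd F p (v S) = (\<lambda>c. x c S)"
    by metis
  let ?y = "\<lambda>b S. if card S = q then v S b else 0"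
  have "?y \<in> FK d (Suc p) q" using v by (intro FK_assemble) auto
  moreover have "dhF p ?y = x" unfolding dhF_row
  proof
    fix S
    show "bd F p (\<lambda>b. ?y b S) = (\<lambda>c. x c S)"
    proof (cases "card S = q")
      case False
      then have "(\<lambda>c. x c S) = (\<lambda>_. 0)" using assms(1) by (auto simp: FK_def)
      with False show ?thesis by simp
    qed (simp add: v)
  qed
  ultimately show ?thesis by blast
qed

text \<open>
  \<open>F\<^sub>p \<otimes> K\<close> is a sum of shifted copies of \<open>K\<close>. For \<open>q = 0\<close> a cycle bounds iff its coefficients lie in
  the ideal of the variables, which means that their constant terms vanish.
\<close>
lemma dv_preimage:
  assumes x: "x \<in> FK d p q" and cyc: "\<And>b S. koszul_d (x b) S = 0"
    and zero: "q = 0 \<Longrightarrow> \<forall>b. lookup (x b {}) 0 = 0"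
  shows "\<exists>y\<in>FK d p (Suc q). dvF q y = x"
proof -
  have "\<exists>y. supp_card UNIV (Suc q) y \<and> (\<forall>S. homogeneous (d - bdeg F p b - int (Suc q)) (y S))
      \<and> (\<forall>S. x b S = koszul_d y S)" for b
  proof -
    have "keys (x b {}) \<subseteq> {m. \<exists>v\<in>UNIV. var_expo v \<preceq> m}" if "q = 0"
    proof
      fix m assume "m \<in> keys (x b {})"
      with zero[OF that] have "m \<noteq> 0" by (metis in_keys_iff)
      then obtain v where "lookup m v \<noteq> 0" by (metis lookup_zero poly_mapping_eqI)
      then have "var_expo v \<preceq> m" by (auto simp: edvd_def lookup_var_expo)
      then show "m \<in> {m. \<exists>v\<in>UNIV. var_expo v \<preceq> m}" by blast
    qed
    then obtain y where y: "supp_card UNIV (Suc q) y" "multidegs var_expo y \<subseteq> multidegs var_expo (x b)"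
      "\<And>S. x b S = koszul_d y S"
      using taylor_exact[of UNIV q "x b" var_expo] FK_supp[OF x] cyc by auto
    have "\<forall>a\<in>multidegs var_expo (x b). int (total_deg a) = d - bdeg F p b"
      using multidegs_homogeneous[OF FK_supp[OF x, of b], of "d - bdeg F p b"] FK_hom[OF x] by auto
    then have "\<forall>S. homogeneous (d - bdeg F p b - int (Suc q)) (y S)"
      using multidegs_homogeneous[OF y(1), of "d - bdeg F p b"] y(2) by auto
    with y show ?thesis by blast
  qed
  then obtain y where y: "\<And>b. supp_card UNIV (Suc q) (y b)"
    "\<And>b S. homogeneous (d - bdeg F p b - int (Suc q)) (y b S)" "\<And>b S. x b S = koszul_d (y b) S"
    by metis
  let ?y = "\<lambda>b. if b \<in> basis F p then y b else (\<lambda>_. 0)"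
  have "?y \<in> FK d p (Suc q)"
    using y by (auto simp: FK_def supp_card_def split: if_splits)
  moreover have "dvF q ?y = x"
  proof (intro ext)
    fix b S
    show "dvF q ?y b S = x b S"
      using y(3) x by (cases "b \<in> basis F p") (auto simp: dvF_def FK_def)
  qed
  ultimately show ?thesis by blast
qed

lemma FK_double_complex: "double_complex (FK d) dhF dvF"
proof
  fix x y :: "nat \<Rightarrow> 'n set \<Rightarrow> ('n, 'k) mpoly" and p q
  show "dhF p (x - y) = dhF p x - dhF p y"
    by (simp add: dhF_def bd_eq fun_eq_iff algebra_simps sum_subtractf)
  show "dvF q (x - y) = dvF q x - dvF q y"
    by (simp add: dvF_def fun_eq_iff koszul_d_diff[symmetric] fun_diff_def)
  show "dhF p (dhF (Suc p) x) = 0" if "x \<in> FK d (Suc (Suc p)) q"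
  proof (intro ext)
    fix c S
    show "dhF p (dhF (Suc p) x) c S = 0 c S"
      using bd_bd[OF FK_free[OF that]] by (simp add: dhF_def)
  qed
  show "dvF q (dvF (Suc q) x) = 0" if "x \<in> FK d p (Suc (Suc q))"
    by (simp add: dvF_def fun_eq_iff taylor_d_taylor_d)
  show "\<exists>y\<in>FK d (Suc (Suc p)) q. dhF (Suc p) y = x" if "x \<in> FK d (Suc p) q" "dhF p x = 0"
  proof (rule dh_preimage[OF that(1)])
    fix S
    have "bd F p (\<lambda>b. x b S) = (\<lambda>_. 0)" using that(2) by (simp add: dhF_def fun_eq_iff)
    then show "(\<lambda>c. x c S) \<in> bd F (Suc p) ` free_on (basis F (Suc (Suc p)))"
      using exact_Suc[OF FK_free[OF that(1)]] by blast
  qed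
  show "\<exists>y\<in>FK d p (Suc (Suc q)). dvF (Suc q) y = x" if "x \<in> FK d p (Suc q)" "dvF q x = 0"
    using that by (intro dv_preimage) (auto simp: dvF_def fun_eq_iff)
qed (auto simp: FK_diff dh_in dv_in dh_dv)

end

context graded_resolution
begin

text \<open>
  The quotient of \<open>F\<^sub>p \<otimes> K\<^sub>0 = F\<^sub>p\<close> by the image of \<open>F\<^sub>p \<otimes> K\<^sub>1\<close> is \<open>F\<^sub>p\<close> modulo the variables, i.e.
  \<open>F\<^sub>p \<otimes> k\<close>. The map \<open>con\<close> is the projection to it and \<open>emb\<close> a section.
\<close>
lemma edge_Tor: "edge_acyclic (FK d) dhF dvF p \<longleftrightarrow> tor_cycles F p d = tor_boundaries F p d"
proof -
  define emb :: "(nat \<Rightarrow> 'k) \<Rightarrow> nat \<Rightarrow> 'n set \<Rightarrow> ('n, 'k) mpoly" where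
    "emb = (\<lambda>u b S. if S = {} then Poly_Mapping.single 0 (u b) else 0)"
  define con :: "(nat \<Rightarrow> 'n set \<Rightarrow> ('n, 'k) mpoly) \<Rightarrow> nat \<Rightarrow> 'k" where
    "con = (\<lambda>y b. lookup (y b {}) 0)"
  have con_emb [simp]: "con (emb u) = u" for u by (simp add: con_def emb_def)
  have con_add: "con (x + y) b = con x b + con y b" for x y b by (simp add: con_def lookup_add)
  have con_diff: "con (x - y) b = con x b - con y b" for x y b by (simp add: con_def lookup_minus)
  have emb_in: "emb u \<in> FK d p 0" if "u \<in> free_on (basis_deg F p d)" for u p
    using that by (auto simp: emb_def FK_def free_on_def basis_deg_def intro!: homogeneous_single_0 split: if_splits)
  have con_in: "con y \<in> free_on (basis_deg F p d)" if y: "y \<in> FK d p 0" for y p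
    unfolding free_on_def
  proof (intro CollectI allI impI, rule ccontr)
    fix b assume b: "b \<notin> basis_deg F p d" "con y b \<noteq> 0"
    then have 0: "0 \<in> keys (y b {})" by (simp add: con_def in_keys_iff)
    then have "y b {} \<noteq> 0" by auto
    then have "b \<in> basis F p" using y by (auto simp: FK_def)
    moreover have "bdeg F p b = d"
      using 0 FK_hom[OF y, of b "{}"] by (auto simp: homogeneous_def total_deg_def)
    ultimately show False using b by (simp add: basis_deg_def)
  qed
  have con_dh: "con (dhF p y) = tensor_bd F p (con y)" for y p
    by (simp add: con_def dhF_def const_bd fun_eq_iff)
  have con_dv: "con (dvF 0 y) b = 0" for y b
  proof -
    have "lookup (sgn_pos v {} * (monom (var_expo v) * y b {v})) 0 = 0" for v :: 'n
    proof -
      have "\<not> var_expo v \<preceq> 0" by (auto simp: edvd_def lookup_var_expo)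
      then show ?thesis by (simp add: lookup_sgn_pos_mult lookup_monom_mult)
    qed
    then show ?thesis by (simp add: con_def dvF_def koszul_d_eq lookup_sum)
  qed
  have dv_image: "\<exists>x\<in>FK d p 1. y = dvF 0 x" if y: "y \<in> FK d p 0" and c: "\<And>b. con y b = 0" for y p
  proof -
    have "koszul_d (y b) S = 0" for b S
      using koszul_d_card[of "y b" S 0] y by (auto simp: FK_def)
    then have "\<exists>x\<in>FK d p (Suc 0). dvF 0 x = y"
      using c by (intro dv_preimage[OF y]) (auto simp: con_def)
    then show ?thesis by auto
  qed
  show ?thesis
  proof
    assume ea: "edge_acyclic (FK d) dhF dvF p"
    show "tor_cycles F p d = tor_boundaries F p d"
    proof (rule antisym[OF _ tor_boundaries_subset], rule subsetI)
      fix w assume w: "w \<in> tor_cycles F p d"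
      then have emb: "emb w \<in> FK d p 0" by (intro emb_in) (simp add: tor_cycles_def)
      have "\<exists>x\<in>FK d p' 1. dhF p' (emb w) = dvF 0 x" if p': "p = Suc p'" for p'
      proof (rule dv_image)
        show "dhF p' (emb w) \<in> FK d p' 0" using emb dh_in p' by simp
        show "con (dhF p' (emb w)) b = 0" for b
          using w p' by (simp add: con_dh tor_cycles_def)
      qed
      with ea emb obtain z x where zx: "z \<in> FK d (Suc p) 0" "emb w = dhF p z + dvF 0 x"
        unfolding edge_acyclic_def by blast
      have "w = con (emb w)" by simp
      also have "\<dots> = tensor_bd F p (con z)"
        unfolding zx(2) by (rule ext) (simp add: con_add con_dv con_dh)
      finally show "w \<in> tor_boundaries F p d"
        unfolding tor_boundaries_def using con_in[OF zx(1)] by blast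
    qed
  next
    assume tor: "tor_cycles F p d = tor_boundaries F p d"
    show "edge_acyclic (FK d) dhF dvF p" unfolding edge_acyclic_def
    proof (intro ballI impI)
      fix y assume y: "y \<in> FK d p 0" and cyc: "\<forall>p'. p = Suc p' \<longrightarrow> (\<exists>x\<in>FK d p' 1. dhF p' y = dvF 0 x)"
      have "tensor_bd F p' (con y) = (\<lambda>_. 0)" if "p = Suc p'" for p'
      proof -
        from cyc that obtain x where x: "dhF p' y = dvF 0 x" by blast
        show ?thesis unfolding con_dh[symmetric] x by (rule ext) (rule con_dv)
      qed
      then have "con y \<in> tor_cycles F p d"
        using con_in[OF y] by (auto simp: tor_cycles_def split: nat.split)
      then obtain u where u: "u \<in> free_on (basis_deg F (Suc p) d)" "con y = tensor_bd F p u"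
        unfolding tor tor_boundaries_def by blast
      have "y - dhF p (emb u) \<in> FK d p 0"
        by (intro FK_diff y dh_in emb_in u)
      moreover have "con (y - dhF p (emb u)) b = 0" for b
        by (simp add: con_diff con_dh u(2))
      ultimately obtain x where "x \<in> FK d p 1" "y - dhF p (emb u) = dvF 0 x"
        using dv_image by blast
      then have "y = dhF p (emb u) + dvF 0 x" by (simp add: algebra_simps)
      with \<open>x \<in> _\<close> emb_in[OF u(1)] show "\<exists>z\<in>FK d (Suc p) 0. \<exists>w\<in>FK d p 1. y = dhF p z + dvF 0 w"
        by blast
    qed
  qed
qed

definition augF :: "(nat \<Rightarrow> 'n set \<Rightarrow> ('n, 'k) mpoly) \<Rightarrow> 'n set \<Rightarrow> ('n, 'k) mpoly" where
  "augF y = (\<lambda>S. aug_map F (\<lambda>b. y b S))"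

lemma augF_dv: "augF (dvF q y) S = koszul_d (augF y) S"
  by (simp add: augF_def dvF_def aug_map_def koszul_d_mult koszul_d_sum)

lemma augF_diff: "augF (x - y) S = augF x S - augF y S"
  by (simp add: augF_def aug_map_def algebra_simps sum_subtractf)

lemma augF_add: "augF (x + y) S = augF x S + augF y S"
  by (simp add: augF_def aug_map_def algebra_simps sum.distrib)

lemma augF_supp:
  assumes "y \<in> FK d 0 q"
  shows "supp_card UNIV q (augF y)"
  unfolding supp_card_def
proof (intro allI impI)
  fix S assume "augF y S \<noteq> 0"
  then obtain b where "y b S \<noteq> 0" unfolding augF_def aug_map_def
    by (metis (mono_tags, lifting) mult_zero_left sum.neutral)
  with assms show "S \<subseteq> UNIV \<and> card S = q" by (simp add: FK_def)
qed

lemma augF_hom: "y \<in> FK d 0 q \<Longrightarrow> homogeneous (d - int q) (augF y S)"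
  unfolding augF_def aug_map_def
  by (intro homogeneous_sum homogeneous_mult'[OF FK_hom aug_homogeneous]) auto

text \<open>
  The augmentation identifies the quotient of \<open>F\<^sub>0 \<otimes> K\<^sub>q\<close> by the image of \<open>F\<^sub>1 \<otimes> K\<^sub>q\<close> with
  \<open>R/I \<otimes> K\<^sub>q\<close>; this is injectivity, and surjectivity is the lemma after it.
\<close>
lemma augF_kernel:
  assumes "y \<in> FK d 0 q"
  shows "(\<exists>x\<in>FK d 1 q. y = dhF 0 x) \<longleftrightarrow> (\<forall>S. augF y S \<in> mideal E)"
proof
  assume "\<exists>x\<in>FK d 1 q. y = dhF 0 x"
  then obtain x where x: "x \<in> FK d 1 q" "y = dhF 0 x" by blast
  show "\<forall>S. augF y S \<in> mideal E"
    using aug_bd[OF FK_free[OF x(1)]] by (simp add: augF_def x(2) dhF_def)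
next
  assume "\<forall>S. augF y S \<in> mideal E"
  then have "\<exists>x\<in>FK d (Suc 0) q. dhF 0 x = y"
    using exact_0[OF FK_free[OF assms]] by (intro dh_preimage[OF assms]) (simp add: augF_def)
  then show "\<exists>x\<in>FK d 1 q. y = dhF 0 x" by auto
qed

lemma augF_surj:
  assumes "supp_card UNIV q w" "\<And>S. homogeneous (d - int q) (w S)"
  obtains y where "y \<in> FK d 0 q" "\<And>S. w S - augF y S \<in> mideal E"
proof -
  have "\<exists>v. v \<in> free_on (basis F 0) \<and> (\<forall>b. homogeneous (d - int q - bdeg F 0 b) (v b))
      \<and> w S - aug_map F v \<in> mideal E" for S
    using aug_graded_preimage[OF assms(2)[of S]] by metis
  then obtain v where v: "\<And>S. v S \<in> free_on (basis F 0)"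
    "\<And>S b. homogeneous (d - int q - bdeg F 0 b) (v S b)" "\<And>S. w S - aug_map F (v S) \<in> mideal E"
    by metis
  show ?thesis
  proof (rule that)
    show "(\<lambda>b S. if card S = q then v S b else 0) \<in> FK d 0 q"
      using v by (intro FK_assemble) auto
    show "w S - augF (\<lambda>b S. if card S = q then v S b else 0) S \<in> mideal E" for S
    proof (cases "card S = q")
      case False
      then have "w S = 0" using assms(1) by (auto simp: supp_card_def)
      with False show ?thesis by (simp add: augF_def aug_map_def)
    qed (use v(3) in \<open>simp add: augF_def\<close>)
  qed
qed

text \<open>
  The other edge of the double complex is the Koszul complex with coefficients in \<open>R/I\<close>, whose strands
  are the families \<open>koszul_faces\<close>.
\<close>
lemma edge_Koszul:
  "edge_acyclic (\<lambda>p q. FK d q p) dvF dhF q \<longleftrightarrow>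
     (\<forall>a. int (total_deg a) = d \<longrightarrow> acyclic_at TYPE('k) UNIV q (koszul_faces E a))"
proof
  assume acyc: "\<forall>a. int (total_deg a) = d \<longrightarrow> acyclic_at TYPE('k) UNIV q (koszul_faces E a)"
  show "edge_acyclic (\<lambda>p q. FK d q p) dvF dhF q" unfolding edge_acyclic_def
  proof (intro ballI impI)
    fix y assume y: "y \<in> FK d 0 q" and cyc: "\<forall>q'. q = Suc q' \<longrightarrow> (\<exists>x\<in>FK d 1 q'. dvF q' y = dhF 0 x)"
    have cyc': "koszul_d (augF y) S \<in> mideal E" for S
    proof (cases q)
      case 0
      then have "koszul_d (augF y) S = 0"
        using koszul_d_card[of "augF y" S 0] augF_supp[OF y] by (auto simp: supp_card_def)
      then show ?thesis by simp
    next
      case (Suc q')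
      with cyc y have "\<forall>S. augF (dvF q' y) S \<in> mideal E"
        using augF_kernel[of "dvF q' y" d q'] dv_in by blast
      then show ?thesis by (simp add: augF_dv)
    qed
    have "\<forall>a\<in>multidegs var_expo (augF y). int (total_deg a) = d"
      using multidegs_homogeneous[OF augF_supp[OF y]] augF_hom[OF y] by blast
    then obtain w' where w': "supp_card UNIV (Suc q) w'"
        "multidegs var_expo w' \<subseteq> multidegs var_expo (augF y)"
        "\<And>S. augF y S - koszul_d w' S \<in> mideal E"
      using taylor_lift[OF _ up augF_supp[OF y], of var_expo] acyc cyc' by (metis finite_UNIV subset_UNIV finite)
    then have "\<forall>S. homogeneous (d - int (Suc q)) (w' S)"
      using multidegs_homogeneous[OF w'(1), of d] \<open>\<forall>a\<in>_. _\<close> by blast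
    then obtain z where z: "z \<in> FK d 0 (Suc q)" "\<And>S. w' S - augF z S \<in> mideal E"
      using augF_surj[OF w'(1)] by blast
    have "augF (y - dvF q z) S \<in> mideal E" for S
    proof -
      have "augF (y - dvF q z) S = (augF y S - koszul_d w' S) + koszul_d (\<lambda>S. w' S - augF z S) S"
        by (simp add: augF_diff augF_dv koszul_d_diff)
      also have "\<dots> \<in> mideal E"
        by (intro mideal_add w'(3) koszul_d_mideal[OF up] z(2))
      finally show ?thesis .
    qed
    moreover have "y - dvF q z \<in> FK d 0 q" by (intro FK_diff y dv_in z)
    ultimately obtain x where x: "x \<in> FK d 1 q" "y - dvF q z = dhF 0 x"
      using augF_kernel by blast
    then have "y = dvF q z + dhF 0 x" by (simp add: algebra_simps)
    with x z show "\<exists>z\<in>FK d 0 (Suc q). \<exists>w\<in>FK d 1 q. y = dvF q z + dhF 0 w" by blast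
  qed
next
  assume ea: "edge_acyclic (\<lambda>p q. FK d q p) dvF dhF q"
  show "\<forall>a. int (total_deg a) = d \<longrightarrow> acyclic_at TYPE('k) UNIV q (koszul_faces E a)"
  proof (intro allI impI acyclic_at_strand_facesI up)
    fix a :: "'n expo" and w :: "'n set \<Rightarrow> ('n, 'k) mpoly"
    assume a: "int (total_deg a) = d" and w: "supp_card UNIV q w" "multidegs var_expo w \<subseteq> {a}"
      and cyc: "\<And>T. T \<subseteq> UNIV \<Longrightarrow> koszul_d w T \<in> mideal E"
    have "\<forall>S. homogeneous (d - int q) (w S)"
      using multidegs_homogeneous[OF w(1), of d] w(2) a by blast
    then obtain y where y: "y \<in> FK d 0 q" "\<And>S. w S - augF y S \<in> mideal E"
      using augF_surj[OF w(1)] by blast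
    have "\<exists>x\<in>FK d 1 q'. dvF q' y = dhF 0 x" if q': "q = Suc q'" for q'
    proof -
      have "augF (dvF q' y) S \<in> mideal E" for S
      proof -
        have "augF (dvF q' y) S = koszul_d w S - koszul_d (\<lambda>S. w S - augF y S) S"
          by (simp add: augF_dv koszul_d_diff)
        also have "\<dots> \<in> mideal E"
          by (intro mideal_minus cyc koszul_d_mideal[OF up] y(2)) auto
        finally show ?thesis .
      qed
      then show ?thesis using augF_kernel[of "dvF q' y" d q'] dv_in y(1) q' by blast
    qed
    with ea y(1) obtain z x where zx: "z \<in> FK d 0 (Suc q)" "x \<in> FK d 1 q" "y = dvF q z + dhF 0 x"
      unfolding edge_acyclic_def by blast
    have "w S - koszul_d (augF z) S \<in> mideal E" for S
    proof -
      have "w S - koszul_d (augF z) S = (w S - augF y S) + augF (dhF 0 x) S"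
        by (simp add: zx(3) augF_add augF_dv)
      also have "\<dots> \<in> mideal E"
        using augF_kernel[of "dhF 0 x" d q] dh_in[of x d 0 q] zx(2)
        by (intro mideal_add y(2)) auto
      finally show ?thesis .
    qed
    then show "\<exists>w'. supp_card UNIV (Suc q) w' \<and> (\<forall>T\<subseteq>UNIV. w T - koszul_d w' T \<in> mideal E)"
      using augF_supp[OF zx(1)] by blast
  qed simp
qed

theorem tor_iff_koszul:
  "tor_cycles F i d \<noteq> tor_boundaries F i d \<longleftrightarrow>
     (\<exists>a. int (total_deg a) = d \<and> \<not> acyclic_at TYPE('k) UNIV i (koszul_faces E a))"
proof -
  interpret double_complex "FK d" dhF dvF by (rule FK_double_complex)
  show ?thesis using edge_acyclic_iff[of i] edge_Tor edge_Koszul by blast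
qed

end

section \<open>Existence of graded free resolutions\<close>

text \<open>A nonincreasing sequence of natural numbers is constant from the first minimum on.\<close>
lemma nat_seq_mono_subseq:
  fixes s :: "nat \<Rightarrow> nat"
  obtains f :: "nat \<Rightarrow> nat" where "strict_mono f" "\<And>j k. j \<le> k \<Longrightarrow> s (f j) \<le> s (f k)"
proof -
  obtain f where f: "strict_mono f" "monoseq (\<lambda>n. s (f n))" using seq_monosub[of s] by blast
  show ?thesis
  proof (cases "\<forall>m n. m \<le> n \<longrightarrow> s (f m) \<le> s (f n)")
    case True
    then show ?thesis by (intro that[OF f(1)]) simp
  next
    case False
    with f(2) have dec: "\<And>m n. m \<le> n \<Longrightarrow> s (f n) \<le> s (f m)" 
      unfolding monoseq_def by metis
    obtain N where N: "\<And>n. s (f N) \<le> s (f n)"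
      using ex_has_least_nat[of "\<lambda>_. True" 0 "\<lambda>n. s (f n)"] by auto
    show ?thesis
    proof (rule that[of "\<lambda>k. f (N + k)"])
      show "strict_mono (\<lambda>k. f (N + k))" using f(1) by (simp add: strict_mono_def)
      show "s (f (N + j)) \<le> s (f (N + k))" for j k
        using dec[of N "N + j"] N[of "N + k"] by simp
    qed
  qed
qed

text \<open>Passing to a subsequence once per variable makes every entry nondecreasing.\<close>
lemma dickson_seq:
  fixes s :: "nat \<Rightarrow> 'n::finite expo"
  shows "\<exists>i j. i < j \<and> s i \<preceq> s j"
proof -
  have "\<exists>f :: nat \<Rightarrow> nat. strict_mono f \<and> (\<forall>i\<in>A. \<forall>j k. j \<le> k \<longrightarrow> lookup (s (f j)) i \<le> lookup (s (f k)) i)"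
    if "finite A" for A
    using that
  proof induction
    case empty
    then show ?case by (intro exI[of _ id]) (simp add: strict_mono_def)
  next
    case (insert x A)
    then obtain f :: "nat \<Rightarrow> nat" where f: "strict_mono f"
        "\<And>i j k. i \<in> A \<Longrightarrow> j \<le> k \<Longrightarrow> lookup (s (f j)) i \<le> lookup (s (f k)) i" by blast
    obtain h :: "nat \<Rightarrow> nat" where h: "strict_mono h"
        "\<And>j k. j \<le> k \<Longrightarrow> lookup (s (f (h j))) x \<le> lookup (s (f (h k))) x"
      using nat_seq_mono_subseq[of "\<lambda>k. lookup (s (f k)) x"] by blast
    have "strict_mono (\<lambda>k. f (h k))" using f(1) h(1) by (simp add: strict_mono_def)
    moreover have "h j \<le> h k" if "j \<le> k" for j k
      using h(1) that by (simp add: strict_mono_less_eq)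
    ultimately show ?case using f(2) h(2) by (intro exI[of _ "\<lambda>k. f (h k)"]) auto
  qed
  from this[OF finite[of UNIV]] obtain f :: "nat \<Rightarrow> nat" where "strict_mono f \<and>
      (\<forall>i\<in>UNIV. \<forall>j k. j \<le> k \<longrightarrow> lookup (s (f j)) i \<le> lookup (s (f k)) i)" by (rule exE)
  then have "f 0 < f 1" "s (f 0) \<preceq> s (f 1)" by (auto simp: strict_mono_def edvd_def)
  then show ?thesis by blast
qed

lemma total_deg_edvd_less: "m \<preceq> m' \<Longrightarrow> m \<noteq> m' \<Longrightarrow> total_deg m < total_deg m'"
proof -
  assume m: "m \<preceq> m'" "m \<noteq> m'"
  then obtain i where "lookup m i \<noteq> lookup m' i" by (metis poly_mapping_eqI)
  with m have "lookup m i < lookup m' i" by (simp add: edvd_def le_neq_implies_less)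
  with m show ?thesis unfolding total_deg_def edvd_def by (intro sum_strict_mono_ex1) auto
qed

text \<open>The minimal elements form an antichain, hence are finitely many by the lemma on sequences.\<close>
lemma dickson:
  fixes M :: "'n::finite expo set"
  obtains G where "finite G" "G \<subseteq> M" "\<And>m. m \<in> M \<Longrightarrow> \<exists>g\<in>G. g \<preceq> m"
proof -
  define G where "G = {m\<in>M. \<forall>m'\<in>M. m' \<preceq> m \<longrightarrow> m' = m}"
  have "finite G"
  proof (rule ccontr)
    assume "infinite G"
    then obtain s :: "nat \<Rightarrow> 'n expo" where s: "inj s" "range s \<subseteq> G"
      using infinite_countable_subset by blast
    obtain i j where ij: "i < j" "s i \<preceq> s j" using dickson_seq by blast
    moreover have "s i \<in> G" "s j \<in> G" using s(2) by auto
    ultimately have "s i = s j" by (simp add: G_def)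
    with s(1) ij(1) show False by (auto dest: injD)
  qed
  moreover have "\<exists>g\<in>G. g \<preceq> m" if "m \<in> M" for m
    using that
  proof (induction "total_deg m" arbitrary: m rule: less_induct)
    case less
    show ?case
    proof (cases "m \<in> G")
      case False
      with less.prems obtain m' where m': "m' \<in> M" "m' \<preceq> m" "m' \<noteq> m" by (auto simp: G_def)
      with less.hyps[OF total_deg_edvd_less] obtain g where "g \<in> G" "g \<preceq> m'" by blast
      with m'(2) show ?thesis using edvd_trans by blast
    qed (auto intro: edvd_refl)
  qed
  ultimately show ?thesis using that[of G] by (auto simp: G_def)
qed

text \<open>
  Basis elements of a resolution are natural numbers, so the subset \<open>T\<close> of \<open>V\<close> is coded by
  \<open>set_encode T\<close>. The sum in \<open>diff\<close> has at most one nonzero term, the \<open>v\<close> that is removed from the set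
  coded by \<open>b\<close> to get the one coded by \<open>c\<close>.
\<close>
definition taylor_res :: "nat set \<Rightarrow> (nat \<Rightarrow> 'n::finite expo) \<Rightarrow> ('n, 'k::field) mpoly free_complex" where
  "taylor_res V g = \<lparr>
     basis = (\<lambda>i. set_encode ` {T. T \<subseteq> V \<and> card T = i}),
     bdeg = (\<lambda>i b. int (total_deg (lcm_expo g (set_decode b)))),
     diff = (\<lambda>i b c. \<Sum>v\<in>V - set_decode c. if insert v (set_decode c) = set_decode b
               then sgn_pos v (set_decode c) * monom (lcm_expo g (set_decode b) - lcm_expo g (set_decode c))
               else 0),
     aug = (\<lambda>_. 1)\<rparr>"

context
  fixes V :: "nat set" and g :: "nat \<Rightarrow> 'n::finite expo" and F :: "('n, 'k::field) mpoly free_complex"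
  assumes V: "finite V"
  defines "F \<equiv> taylor_res V g"
begin

private definition vec_fun :: "(nat \<Rightarrow> ('n, 'k) mpoly) \<Rightarrow> nat set \<Rightarrow> ('n, 'k) mpoly" where
  "vec_fun v T = (if finite T then v (set_encode T) else 0)"

private definition fun_vec :: "(nat set \<Rightarrow> ('n, 'k) mpoly) \<Rightarrow> nat \<Rightarrow> ('n, 'k) mpoly" where
  "fun_vec w b = w (set_decode b)"

private lemma in_basis: "b \<in> basis F i \<longleftrightarrow> set_decode b \<subseteq> V \<and> card (set_decode b) = i"
proof
  assume "b \<in> basis F i"
  then obtain T where T: "b = set_encode T" "T \<subseteq> V" "card T = i" by (auto simp: F_def taylor_res_def)
  then have "set_decode b = T" using V by (simp add: finite_subset)
  with T show "set_decode b \<subseteq> V \<and> card (set_decode b) = i" by simp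
next
  assume "set_decode b \<subseteq> V \<and> card (set_decode b) = i"
  then show "b \<in> basis F i"
    by (auto simp: F_def taylor_res_def intro!: image_eqI[of _ _ "set_decode b"])
qed

private lemma fin_basis: "finite (basis F i)"
  using V by (auto simp: F_def taylor_res_def intro!: finite_imageI finite_subset[OF _ finite_Pow_iff[THEN iffD2, OF V]])

private lemma supp_vec_fun: "v \<in> free_on (basis F i) \<Longrightarrow> supp_card V i (vec_fun v)"
  unfolding supp_card_def
proof (intro allI impI)
  fix T assume v: "v \<in> free_on (basis F i)" and "vec_fun v T \<noteq> 0"
  then have T: "finite T" "v (set_encode T) \<noteq> 0" by (auto simp: vec_fun_def split: if_splits)
  with v have "set_encode T \<in> basis F i" by (auto simp: free_on_def)
  with T(1) show "T \<subseteq> V \<and> card T = i" by (simp add: in_basis)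
qed

private lemma fun_vec_free: "supp_card V i w \<Longrightarrow> fun_vec w \<in> free_on (basis F i)"
  by (auto simp: supp_card_def free_on_def fun_vec_def in_basis)

private lemma vec_fun_vec: "supp_card V i w \<Longrightarrow> vec_fun (fun_vec w) = w"
  using V by (auto simp: supp_card_def vec_fun_def fun_vec_def fun_eq_iff dest: finite_subset)

private lemma bd_taylor:
  assumes "v \<in> free_on (basis F (Suc i))"
  shows "bd F i v c = taylor_d V g (vec_fun v) (set_decode c)"
proof -
  let ?U = "set_decode c"
  define t where "t = (\<lambda>u. sgn_pos u ?U * monom (lcm_expo g (insert u ?U) - lcm_expo g ?U) :: ('n, 'k) mpoly)"
  have "bd F i v c = (\<Sum>b\<in>basis F (Suc i). \<Sum>u\<in>V - ?U. if set_encode (insert u ?U) = b then v b * t u else 0)"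
    unfolding bd_def lin_map_def
  proof (intro sum.cong refl)
    fix b assume "b \<in> basis F (Suc i)"
    have eqv: "insert u ?U = set_decode b \<longleftrightarrow> set_encode (insert u ?U) = b" for u
      by (metis finite_insert finite_set_decode set_decode_inverse set_encode_inverse)
    have "v b * diff F i b c = (\<Sum>u\<in>V - ?U. v b * (if insert u ?U = set_decode b
        then sgn_pos u ?U * monom (lcm_expo g (set_decode b) - lcm_expo g ?U) else 0))"
      by (simp add: F_def taylor_res_def sum_distrib_left)
    also have "\<dots> = (\<Sum>u\<in>V - ?U. if set_encode (insert u ?U) = b then v b * t u else 0)"
    proof (intro sum.cong refl)
      fix u
      show "v b * (if insert u ?U = set_decode b
          then sgn_pos u ?U * monom (lcm_expo g (set_decode b) - lcm_expo g ?U) else 0)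
          = (if set_encode (insert u ?U) = b then v b * t u else 0)"
        unfolding eqv[symmetric] t_def by (simp split: if_split)
    qed
    finally show "v b * diff F i b c = (\<Sum>u\<in>V - ?U. if set_encode (insert u ?U) = b then v b * t u else 0)" .
  qed
  also have "\<dots> = (\<Sum>u\<in>V - ?U. \<Sum>b\<in>basis F (Suc i). if set_encode (insert u ?U) = b then v b * t u else 0)"
    by (rule sum.swap)
  also have "\<dots> = (\<Sum>u\<in>V - ?U. v (set_encode (insert u ?U)) * t u)"
    using assms by (intro sum.cong refl) (auto simp: sum.delta' fin_basis free_on_def)
  also have "\<dots> = taylor_d V g (vec_fun v) ?U"
    unfolding taylor_d_def by (intro sum.cong refl) (simp add: vec_fun_def t_def mult_ac)
  finally show ?thesis .
qed

private lemma bd_free: "v \<in> free_on (basis F (Suc i)) \<Longrightarrow> bd F i v \<in> free_on (basis F i)"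
  unfolding free_on_def
proof (intro CollectI allI impI, rule ccontr)
  fix c assume v: "v \<in> {v. \<forall>b. b \<notin> basis F (Suc i) \<longrightarrow> v b = 0}" and c: "c \<notin> basis F i" and nz: "bd F i v c \<noteq> 0"
  from v have v': "v \<in> free_on (basis F (Suc i))" by (simp add: free_on_def)
  let ?U = "set_decode c"
  from nz bd_taylor[OF v'] have "taylor_d V g (vec_fun v) ?U \<noteq> 0" by simp
  then obtain u where u: "u \<in> V - ?U" "vec_fun v (insert u ?U) \<noteq> 0"
    unfolding taylor_d_def by (metis (mono_tags, lifting) mult_zero_right sum.neutral)
  then have "insert u ?U \<subseteq> V" "card (insert u ?U) = Suc i"
    using supp_vec_fun[OF v'] by (auto simp: supp_card_def)
  with u(1) have "c \<in> basis F i" by (simp add: in_basis)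
  with c show False by simp
qed

private lemma bd_fun_vec:
  assumes "supp_card V (Suc i) w" "v \<in> free_on (basis F i)"
    and "\<And>T. T \<subseteq> V \<Longrightarrow> vec_fun v T = taylor_d V g w T"
  shows "bd F i (fun_vec w) = v"
proof
  fix c
  show "bd F i (fun_vec w) c = v c"
  proof (cases "c \<in> basis F i")
    case False
    then show ?thesis using bd_free[OF fun_vec_free[OF assms(1)]] assms(2) by (simp add: free_on_def)
  next
    case True
    then have "set_decode c \<subseteq> V" by (simp add: in_basis)
    with assms(3) have "taylor_d V g w (set_decode c) = vec_fun v (set_decode c)" by simp
    then show ?thesis
      by (simp add: bd_taylor[OF fun_vec_free[OF assms(1)]] vec_fun_vec[OF assms(1)])
        (simp add: vec_fun_def)
  qed
qed

private lemma basis_0: "basis F 0 = {0}"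
proof -
  have "b \<in> basis F 0 \<longleftrightarrow> b = 0" for b
  proof -
    have "b \<in> basis F 0 \<longleftrightarrow> set_decode b = {}" by (auto simp: in_basis)
    also have "\<dots> \<longleftrightarrow> b = 0" by (metis set_decode_inverse set_decode_zero set_encode_empty)
    finally show ?thesis .
  qed
  then show ?thesis by blast
qed

private lemma aug_map_eq: "aug_map F v = v 0"
  by (simp add: aug_map_def basis_0) (simp add: F_def taylor_res_def)

lemma taylor_resolves: "resolves (taylor_res V g) (mideal {m. \<exists>v\<in>V. g v \<preceq> m} :: ('n, 'k) mpoly set)"
  unfolding F_def[symmetric] resolves_def
proof (intro conjI allI)
  let ?E = "{m. \<exists>v\<in>V. g v \<preceq> m}"
  have diff_free: "diff F i b \<in> free_on (basis F i)" if b: "b \<in> basis F (Suc i)" for i b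
  proof -
    let ?e = "\<lambda>b'. if b' = b then 1 else (0 :: ('n, 'k) mpoly)"
    have "?e \<in> free_on (basis F (Suc i))" using b by (simp add: free_on_def)
    moreover have "bd F i ?e = diff F i b"
      using b fin_basis by (simp add: bd_def lin_map_def fun_eq_iff if_distrib[of "\<lambda>x. x * _"] cong: if_cong)
    ultimately show ?thesis using bd_free by metis
  qed
  have diff_hom: "homogeneous (bdeg F (Suc i) b - bdeg F i c) (diff F i b c)"
    if "b \<in> basis F (Suc i)" for i b c
  proof -
    have "homogeneous (bdeg F (Suc i) b - bdeg F i c)
        (sgn_pos v (set_decode c) * monom (lcm_expo g (set_decode b) - lcm_expo g (set_decode c)) :: ('n, 'k) mpoly)"
      if "insert v (set_decode c) = set_decode b" for v
    proof -
      have "lcm_expo g (set_decode c) \<preceq> lcm_expo g (set_decode b)"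
        using that by (intro lcm_expo_mono) auto
      from total_deg_minus[OF this]
        homogeneous_monom[of "lcm_expo g (set_decode b) - lcm_expo g (set_decode c)"]
      show ?thesis by (intro homogeneous_sgn_pos) (simp add: F_def taylor_res_def)
    qed
    then show ?thesis by (auto simp: F_def taylor_res_def intro!: homogeneous_sum)
  qed
  have "homogeneous (bdeg F 0 b) (aug F b)" if "b \<in> basis F 0" for b
    using that by (simp add: basis_0) (simp add: F_def taylor_res_def homogeneous_def total_deg_def)
  with diff_free diff_hom fin_basis show "graded_free_complex F"
    by (simp add: graded_free_complex_def)
  show "\<exists>v\<in>free_on (basis F 0). p - aug_map F v \<in> mideal ?E" for p
    by (rule bexI[of _ "\<lambda>b. if b = 0 then p else 0"]) (simp_all add: aug_map_eq free_on_def basis_0)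
  show "{v \<in> free_on (basis F 0). aug_map F v \<in> mideal ?E} = bd F 0 ` free_on (basis F 1)"
  proof (intro equalityI subsetI)
    fix v assume "v \<in> {v \<in> free_on (basis F 0). aug_map F v \<in> mideal ?E}"
    then have v: "v \<in> free_on (basis F 0)" "v 0 \<in> mideal ?E" by (auto simp: aug_map_eq)
    note w = supp_vec_fun[OF v(1)]
    have cyc: "taylor_d V g (vec_fun v) T = 0" if "T \<subseteq> V" for T
      unfolding taylor_d_def
    proof (intro sum.neutral ballI)
      fix u assume "u \<in> V - T"
      have "finite T" using that V by (rule finite_subset)
      then have "vec_fun v (insert u T) = 0" using w by (auto simp: supp_card_def)
      then show "sgn_pos u T * (monom (lcm_expo g (insert u T) - lcm_expo g T) * vec_fun v (insert u T)) = 0"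
        by simp
    qed
    have zero: "keys (vec_fun v {}) \<subseteq> ?E" using v(2) by (simp add: vec_fun_def mideal_def)
    obtain w' where w': "supp_card V (Suc 0) w'" "\<And>T. T \<subseteq> V \<Longrightarrow> vec_fun v T = taylor_d V g w' T"
      by (rule taylor_exact[OF V w cyc zero], assumption) (rule that)
    have "bd F 0 (fun_vec w') = v" by (rule bd_fun_vec[OF w'(1) v(1) w'(2)])
    then show "v \<in> bd F 0 ` free_on (basis F 1)"
      using fun_vec_free[OF w'(1)] by (auto intro!: image_eqI[of _ _ "fun_vec w'"])
  next
    fix v assume "v \<in> bd F 0 ` free_on (basis F 1)"
    then obtain u where u: "u \<in> free_on (basis F (Suc 0))" "v = bd F 0 u" by auto
    have "sgn_pos x {} * (monom (lcm_expo g {x} - lcm_expo g {}) * p) \<in> mideal ?E" if "x \<in> V" for x p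
    proof -
      have "monom (lcm_expo g {x}) \<in> (mideal ?E :: ('n, 'k) mpoly set)"
        using that lcm_expo_edvd[of "{x}" g "lcm_expo g {x}"] by auto
      then have "monom (lcm_expo g {x}) * (sgn_pos x {} * p) \<in> mideal ?E"
        by (intro mideal_mult) (auto intro: edvd_trans)
      then show ?thesis by (simp add: mult_ac)
    qed
    then have "v 0 \<in> mideal ?E"
      unfolding u(2) bd_taylor[OF u(1)] taylor_d_def by (intro mideal_sum) simp
    then show "v \<in> {v \<in> free_on (basis F 0). aug_map F v \<in> mideal ?E}"
      using bd_free[OF u(1)] by (simp add: u(2) aug_map_eq)
  qed
  fix i
  show "{v \<in> free_on (basis F (i + 1)). bd F i v = (\<lambda>_. 0)} = bd F (i + 1) ` free_on (basis F (i + 2))"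
  proof (intro equalityI subsetI)
    fix v assume "v \<in> {v \<in> free_on (basis F (i + 1)). bd F i v = (\<lambda>_. 0)}"
    then have v: "v \<in> free_on (basis F (Suc i))" "bd F i v = (\<lambda>_. 0)" by auto
    have cyc: "taylor_d V g (vec_fun v) T = 0" if "T \<subseteq> V" for T
    proof -
      have "finite T" using that V by (rule finite_subset)
      then have "taylor_d V g (vec_fun v) T = bd F i v (set_encode T)"
        by (simp add: bd_taylor[OF v(1)])
      then show ?thesis using v(2) by simp
    qed
    obtain w' where w': "supp_card V (Suc (Suc i)) w'" "\<And>T. T \<subseteq> V \<Longrightarrow> vec_fun v T = taylor_d V g w' T"
      by (rule taylor_exact[OF V supp_vec_fun[OF v(1)] cyc], assumption, simp) (rule that)
    have "bd F (Suc i) (fun_vec w') = v" by (rule bd_fun_vec[OF w'(1) v(1) w'(2)])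
    then show "v \<in> bd F (i + 1) ` free_on (basis F (i + 2))"
      using fun_vec_free[OF w'(1)] by (auto intro!: image_eqI[of _ _ "fun_vec w'"])
  next
    fix v assume "v \<in> bd F (i + 1) ` free_on (basis F (i + 2))"
    then obtain u where u: "u \<in> free_on (basis F (Suc (Suc i)))" "v = bd F (Suc i) u" by auto
    have v: "v \<in> free_on (basis F (Suc i))" unfolding u(2) by (rule bd_free[OF u(1)])
    have "bd F i v c = 0" for c
    proof -
      have "vec_fun v T = taylor_d V g (vec_fun u) T" if "finite T" for T
        using that by (simp add: vec_fun_def u(2) bd_taylor[OF u(1)])
      then have "taylor_d V g (vec_fun v) (set_decode c)
          = taylor_d V g (taylor_d V g (vec_fun u)) (set_decode c)"
        unfolding taylor_d_def[of V g "vec_fun v"] taylor_d_def[of V g "taylor_d V g (vec_fun u)"] by simp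
      then show ?thesis by (simp add: bd_taylor[OF v] taylor_d_taylor_d[OF V])
    qed
    with v show "v \<in> {v \<in> free_on (basis F (i + 1)). bd F i v = (\<lambda>_. 0)}" by auto
  qed
qed

end

lemma monomial_idealE:
  fixes I :: "('n::finite, 'k::field) mpoly set"
  assumes "monomial_ideal I"
  obtains V :: "nat set" and g where "finite V" "I = mideal {m. \<exists>v\<in>V. g v \<preceq> m}"
proof -
  from assms obtain M :: "'n expo set" where "I = ideal_gen (monom ` M)" by (auto simp: monomial_ideal_def)
  then have I: "I = mideal {m. \<exists>g\<in>M. g \<preceq> m}" by (simp add: ideal_gen_monom)
  obtain G where G: "finite G" "G \<subseteq> M" "\<And>m. m \<in> M \<Longrightarrow> \<exists>g\<in>G. g \<preceq> m" using dickson by blast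
  obtain g :: "nat \<Rightarrow> 'n expo" and N where g: "G = g ` {i. i < N}"
    using finite_imp_nat_seg_image_inj_on[OF G(1)] by metis
  have "{m. \<exists>g\<in>M. g \<preceq> m} = {m. \<exists>v\<in>{i. i < N}. g v \<preceq> m}"
    using G(2,3) edvd_trans unfolding g by blast
  with I show ?thesis by (intro that[of "{i. i < N}" g]) auto
qed

theorem Tor_nonzero_iff:
  fixes I :: "('n::{finite,linorder}, 'k::field) mpoly set"
  assumes "monomial_ideal I" "I = mideal E"
  shows "Tor_nonzero I i d \<longleftrightarrow>
    (\<exists>a. int (total_deg a) = d \<and> \<not> acyclic_at TYPE('k) UNIV i (koszul_faces E a))"
proof -
  obtain V :: "nat set" and g where V: "finite V" "I = mideal {m. \<exists>v\<in>V. g v \<preceq> m}"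
    using monomial_idealE[OF assms(1)] by blast
  with assms(2) have E: "E = {m. \<exists>v\<in>V. g v \<preceq> m}" using mideal_inject by metis
  have "resolves (taylor_res V g) I" unfolding V(2) by (rule taylor_resolves[OF V(1)])
  then have "resolves (resolution I) (mideal E)"
    unfolding resolution_def assms(2)[symmetric] by (rule someI[of "\<lambda>F. resolves F I"])
  then interpret graded_resolution "resolution I" E
    by unfold_locales (auto simp: up_closed_def E intro: edvd_trans)
  show ?thesis unfolding Tor_nonzero_def by (rule tor_iff_koszul)
qed

section \<open>The irredundant decomposition\<close>

text \<open>
  This describes the ideals \<open>Q\<^sub>\<mu>\<close>: by \<open>Q_eq\<close>, the monomial \<open>x\<^sup>m\<close> lies outside \<open>Q\<^sub>\<mu>\<close> iff \<open>m\<close> fits \<open>\<mu>\<close>.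
\<close>
definition fits :: "'n expo \<Rightarrow> ('n \<Rightarrow> enat) \<Rightarrow> bool" where
  "fits m \<mu> \<longleftrightarrow> (\<exists>\<sigma>. \<sigma> permutes UNIV \<and> (\<forall>i. enat (lookup m (\<sigma> i)) \<le> \<mu> i))"

lemma fitsI: "\<sigma> permutes UNIV \<Longrightarrow> (\<And>i. enat (lookup m (\<sigma> i)) \<le> \<mu> i) \<Longrightarrow> fits m \<mu>"
  by (auto simp: fits_def)

lemma fits_mono: "fits m \<mu> \<Longrightarrow> (\<And>i. \<mu> i \<le> \<nu> i) \<Longrightarrow> fits m \<nu>"
  unfolding fits_def by (meson order_trans)

lemma lookup_map_key: "inj \<sigma> \<Longrightarrow> lookup (Poly_Mapping.map_key \<sigma> m) i = lookup m (\<sigma> i)"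
  by (simp add: Poly_Mapping.map_key.rep_eq)

lemma Var_power: "Var i ^ e = monom (Poly_Mapping.single i e)"
proof (induction e)
  case 0
  then show ?case by (simp add: monom_def)
next
  case (Suc e)
  then show ?case by (simp add: Var_def monom_def mult_single flip: single_add)
qed

lemma map_key_inverse:
  assumes "bij \<sigma>"
  shows "Poly_Mapping.map_key \<sigma> (Poly_Mapping.map_key (inv \<sigma>) m) = m"
    and "Poly_Mapping.map_key (inv \<sigma>) (Poly_Mapping.map_key \<sigma> m) = m"
proof -
  have inj: "inj \<sigma>" "inj (inv \<sigma>)" using assms by (auto simp: bij_is_inj bij_imp_bij_inv)
  show "Poly_Mapping.map_key \<sigma> (Poly_Mapping.map_key (inv \<sigma>) m) = m"
    by (rule poly_mapping_eqI) (simp add: lookup_map_key inj)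
  show "Poly_Mapping.map_key (inv \<sigma>) (Poly_Mapping.map_key \<sigma> m) = m"
    using assms by (intro poly_mapping_eqI) (simp add: lookup_map_key inj surj_f_inv_f bij_is_surj)
qed

lemma perm_poly_mideal:
  fixes X :: "'n expo set"
  assumes "bij \<sigma>"
  shows "perm_poly \<sigma> ` mideal X = (mideal {m. Poly_Mapping.map_key \<sigma> m \<in> X} :: ('n, 'k::field) mpoly set)"
proof (intro equalityI subsetI)
  fix p :: "('n, 'k) mpoly" assume "p \<in> perm_poly \<sigma> ` mideal X"
  then show "p \<in> mideal {m. Poly_Mapping.map_key \<sigma> m \<in> X}"
    by (auto simp: mideal_def in_keys_iff lookup_perm_poly[OF assms])
next
  fix p :: "('n, 'k) mpoly" assume p: "p \<in> mideal {m. Poly_Mapping.map_key \<sigma> m \<in> X}"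
  note inv = bij_imp_bij_inv[OF assms]
  have "p = perm_poly \<sigma> (perm_poly (inv \<sigma>) p)"
    by (rule poly_mapping_eqI) (simp add: lookup_perm_poly[OF assms] lookup_perm_poly[OF inv] map_key_inverse[OF assms])
  moreover have "perm_poly (inv \<sigma>) p \<in> mideal X"
    unfolding mideal_def
  proof clarify
    fix m assume "m \<in> keys (perm_poly (inv \<sigma>) p)"
    then have "Poly_Mapping.map_key (inv \<sigma>) m \<in> keys p"
      by (simp add: in_keys_iff lookup_perm_poly[OF inv])
    with p have "Poly_Mapping.map_key \<sigma> (Poly_Mapping.map_key (inv \<sigma>) m) \<in> X"
      by (auto simp: mideal_def)
    then show "m \<in> X" by (simp add: map_key_inverse[OF assms])
  qed
  ultimately show "p \<in> perm_poly \<sigma> ` mideal X" by blast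
qed

lemma mideal_INT: "(\<Inter>x\<in>A. mideal (X x)) = mideal (\<Inter>x\<in>A. X x)"
  by (auto simp: mideal_def)

lemma Q_eq: "Q \<mu> = (mideal {m. \<not> fits m \<mu>} :: ('n, 'k::field) mpoly set)"
proof -
  let ?X = "{m :: 'n expo. \<exists>i. \<not> enat (lookup m i) \<le> \<mu> i}"
  have "{Var i ^ (the_enat (\<mu> i) + 1) | i. \<mu> i \<noteq> \<infinity>}
      = (monom ` {Poly_Mapping.single i (the_enat (\<mu> i) + 1) | i. \<mu> i \<noteq> \<infinity>} :: ('n, 'k) mpoly set)"
    by (auto simp only: Var_power)
  moreover have "{m. \<exists>g\<in>{Poly_Mapping.single i (the_enat (\<mu> i) + 1) | i. \<mu> i \<noteq> \<infinity>}. g \<preceq> m} = ?X"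
  proof -
    have 1: "Poly_Mapping.single i e \<preceq> m \<longleftrightarrow> e \<le> lookup m i" for i e and m :: "'n expo"
      by (auto simp: edvd_def lookup_single when_def)
    have 2: "\<mu> i \<noteq> \<infinity> \<and> the_enat (\<mu> i) + 1 \<le> e \<longleftrightarrow> \<not> enat e \<le> \<mu> i" for i e
      by (cases "\<mu> i") auto
    have "(\<exists>g\<in>{Poly_Mapping.single i (the_enat (\<mu> i) + 1) | i. \<mu> i \<noteq> \<infinity>}. g \<preceq> m)
        \<longleftrightarrow> (\<exists>i. \<mu> i \<noteq> \<infinity> \<and> Poly_Mapping.single i (the_enat (\<mu> i) + 1) \<preceq> m)" for m
      by blast
    then show ?thesis by (simp only: 1 2)
  qed
  ultimately have gen: "ideal_gen {Var i ^ (the_enat (\<mu> i) + 1) | i. \<mu> i \<noteq> \<infinity>} = (mideal ?X :: ('n, 'k) mpoly set)"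
    by (simp only: ideal_gen_monom)
  have "Q \<mu> = (\<Inter>\<sigma>\<in>{\<sigma>. \<sigma> permutes UNIV}. mideal {m. Poly_Mapping.map_key \<sigma> m \<in> ?X} :: ('n, 'k) mpoly set)"
    unfolding Q_def gen by (intro INF_cong refl perm_poly_mideal) (simp add: permutes_bij)
  also have "\<dots> = mideal {m. \<not> fits m \<mu>}"
    unfolding mideal_INT
    by (rule arg_cong[of _ _ mideal]) (auto simp: fits_def lookup_map_key permutes_inj)
  finally show ?thesis .
qed

text \<open>
  A permutation cannot map all indices from \<open>i\<close> onwards to indices after \<open>i\<close>. So some \<open>q \<ge> i\<close>
  has \<open>\<sigma> q \<le> i\<close>, and \<open>f i \<le> f (\<sigma> q) \<le> h q \<le> h i\<close>.
\<close>
lemma antimono_perm_le: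
  fixes f h :: "'n::{finite,linorder} \<Rightarrow> 'a::linorder"
  assumes "antimono f" "antimono h" "\<sigma> permutes UNIV" "\<And>i. f (\<sigma> i) \<le> h i"
  shows "f i \<le> h i"
proof -
  have "\<exists>q\<ge>i. \<sigma> q \<le> i"
  proof (rule ccontr)
    assume "\<not> ?thesis"
    then have "\<sigma> ` {i..} \<subseteq> {i<..}" by force
    then have "card (\<sigma> ` {i..}) \<le> card {i<..}" by (intro card_mono) auto
    moreover have "card (\<sigma> ` {i..}) = card {i..}"
      using permutes_inj[OF assms(3)] by (intro card_image) (auto intro: inj_on_subset)
    moreover have "card {i<..} < card {i..}" by (intro psubset_card_mono) auto
    ultimately show False by simp
  qed
  then obtain q where "i \<le> q" "\<sigma> q \<le> i" by blast
  then have "f i \<le> f (\<sigma> q)" "h q \<le> h i" using assms(1,2) by (auto dest: antimonoD)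
  with assms(4)[of q] show ?thesis by simp
qed

text \<open>The permutation sends the index in position \<open>p\<close> to the entry in position \<open>p\<close> of the list of all
  indices sorted by decreasing value of \<open>f\<close>.\<close>
lemma ex_antimono_perm:
  fixes f :: "'n::{finite,linorder} \<Rightarrow> nat"
  obtains \<sigma> where "\<sigma> permutes UNIV" "antimono (\<lambda>i. f (\<sigma> i))"
proof -
  obtain xs :: "'n list" where xs: "set xs = UNIV" "distinct xs"
    using finite_distinct_list[OF finite[of UNIV]] by blast
  define ys where "ys = rev (sort_key f xs)"
  have ys: "set ys = UNIV" "distinct ys" "length ys = CARD('n)"
    using xs distinct_card[OF xs(2)] by (auto simp: ys_def)
  define pos where "pos = (\<lambda>i::'n. card {..<i})"
  have pos_lt: "pos i < length ys" for i
    unfolding pos_def ys(3) by (intro psubset_card_mono) auto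
  have pos_mono: "i \<le> j \<Longrightarrow> pos i \<le> pos j" for i j
    unfolding pos_def by (intro card_mono) auto
  have pos_less: "pos i < pos j" if "i < j" for i j
    unfolding pos_def using that by (intro psubset_card_mono) (auto simp: psubset_eq)
  have "inj pos" by (rule linorder_injI) (metis pos_less less_irrefl)
  then have "inj (\<lambda>i. ys ! pos i)"
    using pos_lt ys(2) by (auto simp: inj_def nth_eq_iff_index_eq)
  then have "(\<lambda>i. ys ! pos i) permutes UNIV"
    by (intro bij_imp_permutes) (simp_all add: bij_def finite_UNIV_inj_surj)
  moreover have "antimono (\<lambda>i. f (ys ! pos i))"
  proof
    fix i j :: 'n assume "i \<le> j"
    then have "map f ys ! pos j \<le> map f ys ! pos i"
      using pos_mono pos_lt by (intro sorted_rev_nth_mono) (auto simp: ys_def rev_map[symmetric])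
    then show "f (ys ! pos j) \<le> f (ys ! pos i)" using pos_lt by simp
  qed
  ultimately show ?thesis by (rule that)
qed

definition covers :: "('n \<Rightarrow> enat) set \<Rightarrow> 'n expo set \<Rightarrow> bool" where
  "covers L E \<longleftrightarrow> (\<forall>m. m \<notin> E \<longleftrightarrow> (\<exists>\<mu>\<in>L. fits m \<mu>))"

lemma decomp_iff_covers:
  "mideal E = (\<Inter>\<mu>\<in>L. Q \<mu> :: ('n, 'k::field) mpoly set) \<longleftrightarrow> covers L E"
  unfolding Q_eq mideal_INT mideal_inject covers_def by auto

lemma finite_entries_bounded:
  fixes L :: "('n::finite \<Rightarrow> enat) set"
  assumes "finite L"
  obtains N where "\<And>\<mu> i. \<mu> \<in> L \<Longrightarrow> \<mu> i \<noteq> \<infinity> \<Longrightarrow> \<mu> i < enat N"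
proof -
  let ?S = "(\<lambda>(\<mu>, i). the_enat (\<mu> i)) ` (L \<times> UNIV)"
  have fin: "finite ?S" using assms by auto
  have "\<mu> i < enat (Suc (Max ?S))" if "\<mu> \<in> L" "\<mu> i \<noteq> \<infinity>" for \<mu> i
  proof -
    have "the_enat (\<mu> i) \<in> ?S" using that(1) by force
    then have "the_enat (\<mu> i) \<le> Max ?S" by (rule Max_ge[OF fin])
    with that(2) show ?thesis by (cases "\<mu> i") auto
  qed
  then show ?thesis by (rule that)
qed

text \<open>
  Truncating \<open>\<nu>\<close> at a height \<open>N\<close> above all finite entries gives an exponent outside the ideal. It fits
  some \<open>\<mu> \<in> L'\<close>, and an entry of \<open>\<mu>\<close> that reaches \<open>N\<close> must be infinite.
\<close>
lemma covers_le:
  fixes L L' :: "('n::{finite,linorder} \<Rightarrow> enat) set"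
  assumes "covers L E" "covers L' E" "L \<subseteq> P_inf" "L' \<subseteq> P_inf" "finite L" "finite L'" "\<nu> \<in> L"
  shows "\<exists>\<mu>\<in>L'. \<forall>i. \<nu> i \<le> \<mu> i"
proof -
  obtain N where N: "\<And>\<mu> i. \<mu> \<in> L \<union> L' \<Longrightarrow> \<mu> i \<noteq> \<infinity> \<Longrightarrow> \<mu> i < enat N"
    using finite_entries_bounded[of "L \<union> L'"] assms by blast
  define b where "b = (Abs_poly_mapping (\<lambda>i. the_enat (min (\<nu> i) (enat N))) :: 'n expo)"
  have b: "enat (lookup b i) = min (\<nu> i) (enat N)" for i
    by (cases "\<nu> i") (auto simp: b_def min_def)
  have "fits b \<nu>" by (rule fitsI[OF permutes_id]) (simp add: b)
  with assms(1,7) have "b \<notin> E" by (auto simp: covers_def)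
  with assms(2) obtain \<mu> \<sigma> where \<mu>: "\<mu> \<in> L'" "\<sigma> permutes UNIV" "\<And>i. enat (lookup b (\<sigma> i)) \<le> \<mu> i"
    by (auto simp: covers_def fits_def)
  have am: "antimono \<nu>" "antimono \<mu>" using assms(3,4,7) \<mu>(1) by (auto simp: P_inf_def)
  have "\<nu> i \<le> \<mu> i" for i
  proof -
    have "enat (lookup b i) \<le> \<mu> i"
    proof (rule antimono_perm_le[OF _ am(2) \<mu>(2,3)])
      show "antimono (\<lambda>i. enat (lookup b i))"
        unfolding b using am(1) by (auto simp: antimono_def min_def intro: order_trans)
    qed
    with b have le: "min (\<nu> i) (enat N) \<le> \<mu> i" by simp
    show ?thesis
    proof (cases "\<mu> i = \<infinity>")
      case False
      with N[of \<mu> i] \<mu>(1) le show ?thesis by (auto simp: min_def split: if_splits)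
    qed simp
  qed
  with \<mu>(1) show ?thesis by blast
qed

definition irred_cover :: "('n::linorder \<Rightarrow> enat) set \<Rightarrow> 'n expo set \<Rightarrow> bool" where
  "irred_cover L E \<longleftrightarrow> finite L \<and> L \<subseteq> P_inf \<and> covers L E \<and> (\<forall>\<mu>\<in>L. \<not> covers (L - {\<mu>}) E)"

lemma irred_cover_antichain:
  assumes "irred_cover L E" "\<mu> \<in> L" "\<nu> \<in> L" "\<And>i. \<mu> i \<le> \<nu> i"
  shows "\<mu> = \<nu>"
proof (rule ccontr)
  assume ne: "\<mu> \<noteq> \<nu>"
  have "covers (L - {\<mu>}) E" unfolding covers_def
  proof
    fix m
    have "fits m \<mu> \<Longrightarrow> fits m \<nu>" using fits_mono[of m \<mu> \<nu>] assms(4) by blast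
    then have "(\<exists>\<mu>'\<in>L. fits m \<mu>') \<longleftrightarrow> (\<exists>\<mu>'\<in>L - {\<mu>}. fits m \<mu>')"
      using assms(3) ne by (metis DiffD1 DiffI singletonD)
    then show "m \<notin> E \<longleftrightarrow> (\<exists>\<mu>'\<in>L - {\<mu>}. fits m \<mu>')"
      using assms(1) by (simp add: irred_cover_def covers_def)
  qed
  with assms(1,2) show False by (simp add: irred_cover_def)
qed

lemma irred_cover_unique:
  fixes L L' :: "('n::{finite,linorder} \<Rightarrow> enat) set"
  assumes "irred_cover L E" "irred_cover L' E"
  shows "L = L'"
proof -
  have "L \<subseteq> L'" if LL: "irred_cover L E" "irred_cover L' E" for L L' :: "('n \<Rightarrow> enat) set"
  proof
    note L = LL[unfolded irred_cover_def]
    fix \<nu> assume \<nu>: "\<nu> \<in> L"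
    obtain \<mu> where \<mu>: "\<mu> \<in> L'" "\<forall>i. \<nu> i \<le> \<mu> i"
      using covers_le[of L E L'] L \<nu> by blast
    obtain \<nu>' where \<nu>': "\<nu>' \<in> L" "\<forall>i. \<mu> i \<le> \<nu>' i"
      using covers_le[of L' E L] L \<mu>(1) by blast
    have "\<nu> = \<nu>'" using \<mu>(2) \<nu>'(2) by (intro irred_cover_antichain[OF LL(1) \<nu> \<nu>'(1)]) (meson order_trans)
    with \<mu>(2) \<nu>'(2) have "\<nu> = \<mu>" by (intro ext antisym) auto
    with \<mu>(1) show "\<nu> \<in> L'" by simp
  qed
  with assms show ?thesis by blast
qed

text \<open>
  Let \<open>N\<close> bound the entries of the generators. Membership in \<open>E\<close> does not change when an entry that is
  at least \<open>N\<close> is replaced by any other such number, so replacing the entries \<open>\<ge> N\<close> of a sorted exponent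
  outside \<open>E\<close> by \<open>\<infinity>\<close> gives a \<open>\<mu>\<close> that only exponents outside \<open>E\<close> fit. There are finitely many of these, and a covering
  subset of minimal size is irredundant.
\<close>
lemma irred_cover_exists:
  fixes E :: "'n::{finite,linorder} expo set"
  assumes V: "finite V" "E = {m. \<exists>v\<in>V. g v \<preceq> m}" and ne: "E \<noteq> {}"
    and sym: "\<And>\<sigma> m. \<sigma> permutes UNIV \<Longrightarrow> m \<in> E \<Longrightarrow> Poly_Mapping.map_key \<sigma> m \<in> E"
  shows "\<exists>L. irred_cover L E"
proof -
  let ?S = "(\<lambda>(v, i). lookup (g v) i) ` (V \<times> UNIV)"
  define N where "N = Max (insert 0 ?S)"
  have N: "lookup (g v) i \<le> N" if "v \<in> V" for v i
    unfolding N_def using V(1) that by (intro Max_ge) force+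
  have trunc: "m' \<in> E" if "m \<in> E" "\<And>i. lookup m i \<le> lookup m' i \<or> N \<le> lookup m' i" for m m'
  proof -
    from that(1) V(2) obtain v where v: "v \<in> V" "g v \<preceq> m" by blast
    have "lookup (g v) i \<le> lookup m' i" for i
      using that(2)[of i] N[OF v(1), of i] v(2)[unfolded edvd_def, rule_format, of i] by linarith
    with v(1) show ?thesis unfolding V(2) edvd_def by blast
  qed
  define L0 where "L0 = {\<mu>\<in>P_inf. (\<forall>i. \<mu> i \<in> insert \<infinity> (enat ` {..<N})) \<and> (\<forall>m. fits m \<mu> \<longrightarrow> m \<notin> E)}"
  have "finite {\<mu> :: 'n \<Rightarrow> enat. \<forall>x. (x \<in> UNIV \<longrightarrow> \<mu> x \<in> insert \<infinity> (enat ` {..<N})) \<and> (x \<notin> UNIV \<longrightarrow> \<mu> x = 0)}"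
    by (intro finite_set_of_finite_funs) auto
  then have "finite L0" by (rule rev_finite_subset) (auto simp: L0_def)
  have "\<exists>\<mu>\<in>L0. fits m \<mu>" if m: "m \<notin> E" for m
  proof -
    obtain \<sigma> where \<sigma>: "\<sigma> permutes UNIV" "antimono (\<lambda>i. lookup m (\<sigma> i))"
      using ex_antimono_perm by blast
    define b where "b = Poly_Mapping.map_key \<sigma> m"
    have lb: "lookup b i = lookup m (\<sigma> i)" for i
      using \<sigma>(1) by (simp add: b_def lookup_map_key permutes_inj)
    have bE: "b \<notin> E"
    proof
      assume "b \<in> E"
      from sym[OF permutes_inv[OF \<sigma>(1)] this] have "m \<in> E"
        by (simp add: b_def map_key_inverse(2)[OF permutes_bij[OF \<sigma>(1)]])
      with m show False by simp
    qed
    define \<mu> where "\<mu> = (\<lambda>i. if lookup b i < N then enat (lookup b i) else \<infinity>)"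
    have "antimono \<mu>" using \<sigma>(2) by (fastforce simp: antimono_def \<mu>_def lb)
    moreover have "\<exists>i. \<mu> i \<noteq> \<infinity>"
    proof (rule ccontr)
      assume "\<not> ?thesis"
      then have "\<mu> i = \<infinity>" for i by blast
      then have "N \<le> lookup b i" for i using \<mu>_def by (metis enat.distinct(1) not_le)
      moreover obtain m0 where "m0 \<in> E" using ne by blast
      ultimately have "b \<in> E" using trunc[of m0 b] by blast
      with bE show False by simp
    qed
    moreover have "m' \<notin> E" if "fits m' \<mu>" for m'
    proof
      assume m': "m' \<in> E"
      from that obtain \<tau> where \<tau>: "\<tau> permutes UNIV" "\<And>i. enat (lookup m' (\<tau> i)) \<le> \<mu> i"
        by (auto simp: fits_def)
      have "lookup (Poly_Mapping.map_key \<tau> m') i \<le> lookup b i \<or> N \<le> lookup b i" for i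
        using \<tau>(2)[of i] by (auto simp: \<mu>_def lookup_map_key permutes_inj[OF \<tau>(1)] split: if_splits)
      with trunc[OF sym[OF \<tau>(1) m']] bE show False by blast
    qed
    ultimately have "\<mu> \<in> L0" by (auto simp: L0_def P_inf_def \<mu>_def)
    moreover have "fits m \<mu>" using \<sigma>(1) by (intro fitsI[of \<sigma>]) (auto simp: \<mu>_def lb)
    ultimately show ?thesis by blast
  qed
  then have L0: "covers L0 E" by (auto simp: covers_def L0_def)
  obtain L where L: "L \<subseteq> L0" "covers L E" "\<And>L'. L' \<subseteq> L0 \<Longrightarrow> covers L' E \<Longrightarrow> card L \<le> card L'"
    using ex_has_least_nat[of "\<lambda>L. L \<subseteq> L0 \<and> covers L E" L0 card] L0 by auto
  have finL: "finite L" using L(1) \<open>finite L0\<close> by (rule finite_subset)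
  have "\<not> covers (L - {\<mu>}) E" if "\<mu> \<in> L" for \<mu>
  proof
    assume "covers (L - {\<mu>}) E"
    with L(1) have "card L \<le> card (L - {\<mu>})" by (intro L(3)) auto
    with finL that show False by (metis card_Diff1_less not_le)
  qed
  with finL L have "irred_cover L E" by (auto simp: irred_cover_def L0_def)
  then show ?thesis ..
qed

lemma Lambda_star_irred_cover:
  fixes I :: "('n::{finite,linorder}, 'k::field) mpoly set"
  assumes mon: "monomial_ideal I" and sym: "sym_invariant I" and ne: "I \<noteq> {0}" and IE: "I = mideal E"
  shows "irred_cover (Lambda_star I) E"
proof -
  obtain V :: "nat set" and g where V: "finite V" "I = mideal {m. \<exists>v\<in>V. g v \<preceq> m}"
    using monomial_idealE[OF mon] by blast
  with IE have E: "E = {m. \<exists>v\<in>V. g v \<preceq> m}" using mideal_inject by metis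
  have symE: "Poly_Mapping.map_key \<sigma> m \<in> E" if \<sigma>: "\<sigma> permutes UNIV" and m: "m \<in> E" for \<sigma> m
  proof -
    have "mideal E = (mideal {m. Poly_Mapping.map_key \<sigma> m \<in> E} :: ('n, 'k) mpoly set)"
      using sym \<sigma> unfolding sym_invariant_def IE perm_poly_mideal[OF permutes_bij[OF \<sigma>], symmetric]
      by simp
    then have "E = {m. Poly_Mapping.map_key \<sigma> m \<in> E}" by (simp only: mideal_inject)
    with m show ?thesis by blast
  qed
  have "E \<noteq> {}" using ne IE by (auto simp: mideal_def)
  then obtain L where L: "irred_cover L E"
    using irred_cover_exists[OF V(1) E] symE by blast
  have "irredundant_decomp I L \<longleftrightarrow> irred_cover L E" for L
    unfolding irredundant_decomp_def irred_cover_def IE decomp_iff_covers ..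
  then have "Lambda_star I = (THE L. irred_cover L E)" by (simp add: Lambda_star_def)
  also have "\<dots> = L" using L irred_cover_unique[OF _ L] by (rule the_equality)
  finally have "Lambda_star I = L" .
  with L show ?thesis by simp
qed

section \<open>Regularity and projective dimension\<close>

lemma mu_plus_props:
  fixes \<mu> :: "'n::{finite,linorder} \<Rightarrow> enat"
  assumes "\<mu> \<in> P_inf"
  obtains k c where "\<mu> k = enat c" "\<And>i. \<mu> i = \<infinity> \<Longrightarrow> mu_plus \<mu> i = Suc c"
    "\<And>i. \<mu> i \<noteq> \<infinity> \<Longrightarrow> \<mu> i = enat (mu_plus \<mu> i) \<and> mu_plus \<mu> i \<le> c"
proof -
  let ?F = "{i. \<mu> i \<noteq> \<infinity>}" and ?k = "LEAST k. \<mu> k \<noteq> \<infinity>"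
  have ne: "?F \<noteq> {}" and am: "antimono \<mu>" using assms by (auto simp: P_inf_def)
  have k: "?k = Min ?F" using ne by (intro Least_Min) auto
  have "?k \<in> ?F" unfolding k by (rule Min_in) (use ne in auto)
  then obtain c where c: "\<mu> ?k = enat c" by auto
  show ?thesis
  proof (rule that[OF c])
    show "mu_plus \<mu> i = Suc c" if "\<mu> i = \<infinity>" for i
      using that c by (simp add: mu_plus_def)
    fix i assume i: "\<mu> i \<noteq> \<infinity>"
    then have "?k \<le> i" unfolding k by (intro Min_le) auto
    with am have "\<mu> i \<le> enat c" unfolding c[symmetric] by (rule antimonoD)
    with i show "\<mu> i = enat (mu_plus \<mu> i) \<and> mu_plus \<mu> i \<le> c"
      by (auto simp: mu_plus_def)
  qed
qed

lemma lcm_var_edvd: "lcm_expo var_expo S \<preceq> a \<longleftrightarrow> (\<forall>i\<in>S. lookup a i \<noteq> 0)"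
  for a :: "'n::finite expo"
  by (auto simp: edvd_def lookup_lcm_var Suc_le_eq split: if_splits)

lemma koszul_faces_iff:
  "S \<in> koszul_faces E a \<longleftrightarrow> (\<forall>i\<in>S. lookup a i \<noteq> 0) \<and> a - lcm_expo var_expo S \<notin> E"
  by (simp add: strand_faces_def lcm_var_edvd)

lemma lookup_minus_lcm_var:
  "lookup (a - lcm_expo var_expo S) i = (if i \<in> S then lookup a i - 1 else lookup a i)"
  by (simp add: lookup_minus lookup_lcm_var)

lemma nonacyclic_cardE:
  fixes \<Gamma> :: "'v::linorder set set"
  assumes "\<not> acyclic_at TYPE('r::comm_ring_1) V q \<Gamma>"
  obtains T where "T \<in> \<Gamma>" "card T = q"
proof (rule ccontr)
  assume "\<not> thesis"
  with that have none: "\<And>T. T \<in> \<Gamma> \<Longrightarrow> card T \<noteq> q" by blast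
  have "acyclic_at TYPE('r) V q \<Gamma>" unfolding acyclic_at_def
  proof (intro allI impI exI[of _ "\<lambda>_. 0"])
    fix f :: "'v set \<Rightarrow> 'r" assume "\<forall>T. f T \<noteq> 0 \<longrightarrow> T \<in> \<Gamma> \<and> card T = q"
    with none have "f T = 0" for T by blast
    then show "(\<forall>T. (0::'r) \<noteq> 0 \<longrightarrow> T \<in> \<Gamma> \<and> card T = Suc q) \<and> (\<forall>T\<in>\<Gamma>. f T = altsum V (\<lambda>_. 0) T)"
      by (simp add: altsum_def)
  qed
  with assms show False by simp
qed

text \<open>The contrapositive of \<open>acyclic_cone\<close> for the Koszul strands.\<close>
lemma nonacyclic_koszulE:
  fixes a :: "'n::{finite,linorder} expo"
  assumes "up_closed E" "\<not> acyclic_at TYPE('r::comm_ring_1) UNIV q (koszul_faces E a)" "lookup a v \<noteq> 0"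
  obtains S where "card S = q" "v \<in> S" "\<And>i. i \<in> S \<Longrightarrow> lookup a i \<noteq> 0"
    "a - lcm_expo var_expo S \<notin> E" "a - lcm_expo var_expo (S - {v}) \<in> E"
proof (rule ccontr)
  note witness = that
  assume no: "\<not> thesis"
  have "acyclic_at TYPE('r) UNIV q (koszul_faces E a)"
  proof (rule acyclic_cone[of UNIV v "{i. lookup a i \<noteq> 0}"])
    show "T' \<in> koszul_faces E a" if "T \<in> koszul_faces E a" "T \<subseteq> T'" "T' \<subseteq> {i. lookup a i \<noteq> 0}" for T T'
      using that(3) by (intro strand_faces_up[OF assms(1) _ that(1,2)]) (auto simp: lcm_var_edvd)
    show "T - {v} \<in> koszul_faces E a" if "T \<in> koszul_faces E a" "card T = q" "v \<in> T" for T
    proof (rule ccontr)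
      assume "T - {v} \<notin> koszul_faces E a"
      with that(1) have "a - lcm_expo var_expo (T - {v}) \<in> E" by (simp add: koszul_faces_iff)
      then have thesis using that by (intro witness[of T]) (simp_all add: koszul_faces_iff)
      with no show False by simp
    qed
  qed (use assms(3) in \<open>auto simp: koszul_faces_iff\<close>)
  with assms(2) show False by simp
qed

lemma total_deg_fits_le:
  fixes m :: "'n::finite expo"
  assumes "\<sigma> permutes UNIV" "\<And>i. lookup m (\<sigma> i) \<le> h i"
  shows "total_deg m \<le> (\<Sum>i\<in>UNIV. h i)"
proof -
  have "total_deg m = (\<Sum>i\<in>UNIV. lookup m (\<sigma> i))"
    unfolding total_deg_def by (rule sum.permute[OF assms(1), unfolded o_def])
  also have "\<dots> \<le> (\<Sum>i\<in>UNIV. h i)" by (intro sum_mono assms)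
  finally show ?thesis .
qed

lemma total_deg_minus_lcm_var:
  fixes a :: "'n::finite expo"
  assumes "\<And>i. i \<in> S \<Longrightarrow> lookup a i \<noteq> 0"
  shows "int (total_deg (a - lcm_expo var_expo S)) = int (total_deg a) - int (card S)"
proof -
  have "lcm_expo var_expo S \<preceq> a" using assms by (simp add: lcm_var_edvd)
  from total_deg_minus[OF this] show ?thesis by simp
qed

locale irredundant_cover =
  fixes L :: "('n::{finite,linorder} \<Rightarrow> enat) set" and E :: "'n expo set"
  assumes irred: "irred_cover L E" and up: "up_closed E"
begin

lemma not_in_E: "m \<notin> E \<longleftrightarrow> (\<exists>\<mu>\<in>L. fits m \<mu>)"
  using irred by (simp add: irred_cover_def covers_def)

lemma L_P_inf: "\<mu> \<in> L \<Longrightarrow> \<mu> \<in> P_inf"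
  using irred by (auto simp: irred_cover_def)

lemma ex_max_entry:
  fixes a :: "'n expo"
  obtains v where "\<And>i. lookup a i \<le> lookup a v"
proof -
  have "Max (range (lookup a)) \<in> range (lookup a)" by (rule Max_in) auto
  then obtain v where "lookup a v = Max (range (lookup a))" by (metis rangeE)
  then show ?thesis by (intro that[of v]) simp
qed

text \<open>
  The exponent \<open>b = a - 1\<^sub>S\<close> has degree \<open>\<bar>a\<bar> - q\<close> and fits some \<open>\<nu>\<close>. As \<open>b + e\<^sub>v\<close> does not, the entry
  of \<open>\<nu>\<close> that bounds \<open>b\<^sub>v = a\<^sub>v - 1\<close> is less than \<open>a\<^sub>v\<close>. Therefore the infinite entries of \<open>\<nu>\<close> are
  replaced in \<open>\<nu>\<^sup>+\<close> by a number that is at least \<open>a\<^sub>v\<close>, the largest entry of \<open>a\<close>, and \<open>b\<close> stays below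
  \<open>\<nu>\<^sup>+\<close>.
\<close>
lemma regularity_upper_bound:
  assumes nac: "\<not> acyclic_at TYPE('r::comm_ring_1) UNIV q (koszul_faces E a)"
  shows "\<exists>\<nu>\<in>L. int (total_deg a) - int q \<le> int (\<Sum>i\<in>UNIV. mu_plus \<nu> i)"
proof -
  obtain v where v: "\<And>i. lookup a i \<le> lookup a v" using ex_max_entry[of a] by blast
  show ?thesis
  proof (cases "lookup a v = 0")
    case True
    with v have "a = 0" by (intro poly_mapping_eqI) (simp add: le_zero_eq)
    then have "total_deg a = 0" by (simp add: total_deg_def)
    moreover obtain S where "S \<in> koszul_faces E a" using nonacyclic_cardE[OF nac] by blast
    then obtain \<nu> where "\<nu> \<in> L" using not_in_E by (auto simp: koszul_faces_iff)
    moreover have "0 \<le> int (\<Sum>i\<in>UNIV. mu_plus \<nu> i)" by (rule of_nat_0_le_iff)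
    ultimately show ?thesis by (intro bexI[of _ \<nu>]) linarith+
  next
    case False
    obtain S where S: "card S = q" "v \<in> S" "\<And>i. i \<in> S \<Longrightarrow> lookup a i \<noteq> 0"
      "a - lcm_expo var_expo S \<notin> E" "a - lcm_expo var_expo (S - {v}) \<in> E"
      using nonacyclic_koszulE[OF up nac False] by blast
    let ?b = "a - lcm_expo var_expo S"
    obtain \<nu> \<sigma> where \<nu>: "\<nu> \<in> L" "\<sigma> permutes UNIV" "\<And>i. enat (lookup ?b (\<sigma> i)) \<le> \<nu> i"
      using S(4) unfolding not_in_E fits_def by blast
    define q' where "q' = inv \<sigma> v"
    have q': "\<sigma> q' = v" using \<nu>(2) by (simp add: q'_def permutes_inverses)
    obtain k c where c: "\<nu> k = enat c" "\<And>i. \<nu> i = \<infinity> \<Longrightarrow> mu_plus \<nu> i = Suc c"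
      "\<And>i. \<nu> i \<noteq> \<infinity> \<Longrightarrow> \<nu> i = enat (mu_plus \<nu> i) \<and> mu_plus \<nu> i \<le> c"
      using mu_plus_props[OF L_P_inf[OF \<nu>(1)]] by metis
    have "\<not> enat (lookup a v) \<le> \<nu> q'"
    proof
      assume le: "enat (lookup a v) \<le> \<nu> q'"
      have "fits (a - lcm_expo var_expo (S - {v})) \<nu>"
      proof (rule fitsI[OF \<nu>(2)])
        fix i
        show "enat (lookup (a - lcm_expo var_expo (S - {v})) (\<sigma> i)) \<le> \<nu> i"
        proof (cases "\<sigma> i = v")
          case True
          with q' \<nu>(2) have "i = q'" by (metis permutes_inverses(2))
          with le q' show ?thesis by (simp add: lookup_minus_lcm_var)
        next
          case False
          with \<nu>(3)[of i] show ?thesis by (simp add: lookup_minus_lcm_var)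
        qed
      qed
      with S(5) \<nu>(1) not_in_E show False by blast
    qed
    moreover have "enat (lookup a v - 1) \<le> \<nu> q'"
      using \<nu>(3)[of q'] S(2) q' by (simp add: lookup_minus_lcm_var)
    ultimately have lt: "\<nu> q' < enat (lookup a v)" and ge: "enat (lookup a v - 1) \<le> \<nu> q'"
      by (simp_all add: not_le)
    from lt have "\<nu> q' \<noteq> \<infinity>" by (cases "\<nu> q'") auto
    from c(3)[OF this] have "\<nu> q' = enat (mu_plus \<nu> q')" "mu_plus \<nu> q' \<le> c" by auto
    moreover from this(1) ge have "lookup a v - 1 \<le> mu_plus \<nu> q'" by (metis enat_ord_simps(1))
    ultimately have "lookup a v \<le> Suc c" by linarith
    have "lookup ?b (\<sigma> i) \<le> mu_plus \<nu> i" for i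
    proof (cases "\<nu> i = \<infinity>")
      case True
      have "lookup ?b (\<sigma> i) \<le> lookup a v" using v[of "\<sigma> i"] by (auto simp: lookup_minus_lcm_var)
      with True c(2) \<open>lookup a v \<le> Suc c\<close> show ?thesis by simp
    next
      case False
      with c(3)[OF False] \<nu>(3)[of i] show ?thesis by (metis enat_ord_simps(1))
    qed
    from total_deg_fits_le[OF \<nu>(2) this]
    have "int (total_deg ?b) \<le> int (\<Sum>i\<in>UNIV. mu_plus \<nu> i)" by (simp only: of_nat_le_iff)
    moreover have "int (total_deg ?b) = int (total_deg a) - int q"
      using total_deg_minus_lcm_var[OF S(3)] S(1) by simp
    ultimately show ?thesis using \<nu>(1) by (intro bexI[of _ \<nu>]) simp_all
  qed
qed

text \<open>
  A set \<open>S\<close> with more than \<open>n - m\<close> elements meets an infinite entry of \<open>\<nu>\<close>. If \<open>v\<close> meets a finite entry,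
  it can be exchanged with an element \<open>s\<close> of \<open>S\<close> that meets an infinite one, because
  \<open>b\<^sub>s = a\<^sub>s - 1 \<le> a\<^sub>v - 1 = b\<^sub>v\<close>. After the exchange \<open>b\<^sub>v\<close> may be raised.
\<close>
lemma projdim_upper_bound:
  assumes nac: "\<not> acyclic_at TYPE('r::comm_ring_1) UNIV q (koszul_faces E a)"
    and m: "\<And>\<nu>. \<nu> \<in> L \<Longrightarrow> m \<le> ell \<nu>"
  shows "q \<le> CARD('n) - m"
proof (rule ccontr)
  assume "\<not> ?thesis"
  then have q: "CARD('n) - m < q" by simp
  obtain v where v: "\<And>i. lookup a i \<le> lookup a v" using ex_max_entry[of a] by blast
  obtain T where T: "T \<in> koszul_faces E a" "card T = q" using nonacyclic_cardE[OF nac] by blast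
  with q have "T \<noteq> {}" by auto
  then obtain t where "lookup a t \<noteq> 0" using T by (auto simp: koszul_faces_iff)
  with v[of t] have "lookup a v \<noteq> 0" by simp
  then obtain S where S: "card S = q" "v \<in> S" "\<And>i. i \<in> S \<Longrightarrow> lookup a i \<noteq> 0"
      "a - lcm_expo var_expo S \<notin> E" "a - lcm_expo var_expo (S - {v}) \<in> E"
    using nonacyclic_koszulE[OF up nac] by blast
  let ?b = "a - lcm_expo var_expo S" and ?b' = "a - lcm_expo var_expo (S - {v})"
  obtain \<nu> \<sigma> where \<nu>: "\<nu> \<in> L" "\<sigma> permutes UNIV" "\<And>i. enat (lookup ?b (\<sigma> i)) \<le> \<nu> i"
    using S(4) unfolding not_in_E fits_def by blast
  define q' where "q' = inv \<sigma> v"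
  have q': "\<sigma> q' = v" using \<nu>(2) by (simp add: q'_def permutes_inverses)
  have inj: "\<sigma> i = \<sigma> j \<longleftrightarrow> i = j" for i j using permutes_inj[OF \<nu>(2)] by (auto simp: inj_eq)
  have b': "lookup ?b' i = (if i = v then lookup a v else lookup ?b i)" for i
    by (simp add: lookup_minus_lcm_var)
  have "fits ?b' \<nu>"
  proof (cases "\<nu> q' = \<infinity>")
    case True
    show ?thesis
    proof (rule fitsI[OF \<nu>(2)])
      fix i show "enat (lookup ?b' (\<sigma> i)) \<le> \<nu> i"
        using \<nu>(3)[of i] True q' inj[of i q'] by (cases "i = q'") (auto simp: b')
    qed
  next
    case False
    have "card {i. \<nu> i \<noteq> \<infinity>} = CARD('n) - ell \<nu>"
    proof -
      have "{i. \<nu> i \<noteq> \<infinity>} = UNIV - {i. \<nu> i = \<infinity>}" by auto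
      then show ?thesis unfolding ell_def by (simp add: card_Diff_subset)
    qed
    also have "\<dots> < card (inv \<sigma> ` S)"
      using q m[OF \<nu>(1)] S(1) card_image[OF inj_on_subset[OF permutes_inj[OF permutes_inv[OF \<nu>(2)]]], of S]
      by simp
    finally have "\<not> inv \<sigma> ` S \<subseteq> {i. \<nu> i \<noteq> \<infinity>}" by (metis card_mono finite not_le)
    then obtain s where "s \<in> S" "\<nu> (inv \<sigma> s) = \<infinity>" by auto
    then obtain s' where s': "\<nu> s' = \<infinity>" "\<sigma> s' \<in> S"
      using permutes_inverses(1)[OF \<nu>(2)] by metis
    with False have ne: "s' \<noteq> q'" by auto
    let ?\<tau> = "\<sigma> \<circ> transpose q' s'"
    have "?\<tau> permutes UNIV" by (intro permutes_compose permutes_swap_id \<nu>(2)) auto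
    then show ?thesis
    proof (rule fitsI)
      fix i
      show "enat (lookup ?b' (?\<tau> i)) \<le> \<nu> i"
      proof (cases "i = q'")
        case True
        have "lookup ?b' (\<sigma> s') \<le> lookup ?b v"
          using v[of "\<sigma> s'"] s'(2) S(2) ne q' inj[of s' q'] by (auto simp: lookup_minus_lcm_var)
        then show ?thesis using True \<nu>(3)[of q'] q' by (simp add: order_trans[OF _ \<nu>(3)[of q']])
      next
        case False
        then show ?thesis
          using \<nu>(3)[of i] s'(1) q' inj[of i q'] by (cases "i = s'") (auto simp: b' transpose_def)
      qed
    qed
  qed
  with S(5) \<nu>(1) not_in_E show False by blast
qed

text \<open>
  The class of the single set \<open>S\<^sub>0\<close> of finite positions of \<open>\<mu>\<close>, in multidegree \<open>a = \<mu>\<^sup>+ + 1\<^bsub>S\<^sub>0\<^esub>\<close>. It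
  is a cycle because \<open>\<mu>\<^sup>+ + e\<^sub>j\<close> fits no \<open>\<nu>\<close>, which is where the extremality of \<open>\<mu>\<close> enters. Let \<open>c\<close> and
  \<open>d\<close> be the first finite entries of \<open>\<mu>\<close> and \<open>\<nu>\<close>, and suppose that \<open>\<mu>\<^sup>+ + e\<^sub>j\<close> fits \<open>\<nu>\<close>.
  If \<open>c \<le> d\<close>, it is even below \<open>\<nu>\<^sup>+\<close> after a permutation, so \<open>\<bar>\<mu>\<^sup>+\<bar> < \<bar>\<nu>\<^sup>+\<bar>\<close>; in particular
  \<open>\<mu> \<noteq> \<nu>\<close>, and \<open>\<mu> \<le> \<nu>\<close> is impossible, as it would give \<open>\<mu> = \<nu>\<close> by irredundancy. If \<open>\<ell>(\<mu>)\<close> is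
  minimal, the infinite entries of \<open>\<mu>\<close> are among those of \<open>\<nu>\<close>, so \<open>\<mu> \<le> \<nu>\<close>. If \<open>\<bar>\<mu>\<^sup>+\<bar>\<close> is maximal,
  then \<open>d < c\<close>, hence the entries \<open>\<ge> c\<close> of \<open>\<mu>\<^sup>+ + e\<^sub>j\<close> meet infinite entries of \<open>\<nu>\<close>, and again
  \<open>\<mu> \<le> \<nu>\<close>.
\<close>
lemma koszul_class:
  assumes \<mu>: "\<mu> \<in> L"
    and max: "(\<forall>\<nu>\<in>L. (\<Sum>i\<in>UNIV. mu_plus \<nu> i) \<le> (\<Sum>i\<in>UNIV. mu_plus \<mu> i)) \<or> (\<forall>\<nu>\<in>L. ell \<mu> \<le> ell \<nu>)"
  shows "\<exists>a. int (total_deg a) = int (\<Sum>i\<in>UNIV. mu_plus \<mu> i) + int (CARD('n) - ell \<mu>)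
     \<and> \<not> acyclic_at TYPE('r::comm_ring_1) UNIV (CARD('n) - ell \<mu>) (koszul_faces E a)"
proof -
  define S0 where "S0 = {i. \<mu> i \<noteq> \<infinity>}"
  define M where "M = (Abs_poly_mapping (mu_plus \<mu>) :: 'n expo)"
  define a where "a = M + lcm_expo var_expo S0"
  have M: "lookup M i = mu_plus \<mu> i" for i by (simp add: M_def)
  have am: "antimono \<mu>" using L_P_inf[OF \<mu>] by (simp add: P_inf_def)
  obtain k c where c: "\<mu> k = enat c" "\<And>i. \<mu> i = \<infinity> \<Longrightarrow> mu_plus \<mu> i = Suc c"
      "\<And>i. \<mu> i \<noteq> \<infinity> \<Longrightarrow> \<mu> i = enat (mu_plus \<mu> i) \<and> mu_plus \<mu> i \<le> c"
    using mu_plus_props[OF L_P_inf[OF \<mu>]] by metis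
  have cardS0: "card S0 = CARD('n) - ell \<mu>"
  proof -
    have "S0 = UNIV - {i. \<mu> i = \<infinity>}" by (auto simp: S0_def)
    then show ?thesis unfolding ell_def by (simp add: card_Diff_subset)
  qed
  have degM: "total_deg M = (\<Sum>i\<in>UNIV. mu_plus \<mu> i)"
    unfolding total_deg_def by (simp add: M)
  have antimono_mu_plus: "antimono (mu_plus \<mu>)"
  proof
    fix i j :: 'n assume "i \<le> j"
    with am have le: "\<mu> j \<le> \<mu> i" by (rule antimonoD)
    show "mu_plus \<mu> j \<le> mu_plus \<mu> i"
    proof (cases "\<mu> i = \<infinity>")
      case True
      with c(2)[of i] c(2)[of j] c(3)[of j] show ?thesis by (cases "\<mu> j = \<infinity>") auto
    next
      case False
      with le have "\<mu> j \<noteq> \<infinity>" by (cases "\<mu> i"; cases "\<mu> j") auto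
      with False le c(3)[of i] c(3)[of j] show ?thesis by (metis enat_ord_simps(1))
    qed
  qed
  have cycle: "M + var_expo j \<in> E" if j: "j \<in> S0" for j
  proof (rule ccontr)
    let ?b = "M + var_expo j"
    assume "?b \<notin> E"
    then obtain \<nu> \<sigma> where \<nu>: "\<nu> \<in> L" "\<sigma> permutes UNIV" "\<And>i. enat (lookup ?b (\<sigma> i)) \<le> \<nu> i"
      unfolding not_in_E fits_def by blast
    have amn: "antimono \<nu>" using L_P_inf[OF \<nu>(1)] by (simp add: P_inf_def)
    obtain k' d where d: "\<nu> k' = enat d" "\<And>i. \<nu> i = \<infinity> \<Longrightarrow> mu_plus \<nu> i = Suc d"
        "\<And>i. \<nu> i \<noteq> \<infinity> \<Longrightarrow> \<nu> i = enat (mu_plus \<nu> i) \<and> mu_plus \<nu> i \<le> d"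
      using mu_plus_props[OF L_P_inf[OF \<nu>(1)]] by metis
    have Mb: "mu_plus \<mu> i \<le> lookup ?b i" for i by (simp add: lookup_add M)
    have b_le: "lookup ?b i \<le> Suc c" for i
      using j c(2)[of i] c(3)[of i] by (cases "\<mu> i = \<infinity>") (auto simp: lookup_add M lookup_var_expo S0_def)
    have big: "(\<Sum>i\<in>UNIV. mu_plus \<mu> i) < (\<Sum>i\<in>UNIV. mu_plus \<nu> i)" if cd: "c \<le> d"
    proof -
      have "lookup ?b (\<sigma> i) \<le> mu_plus \<nu> i" for i
      proof (cases "\<nu> i = \<infinity>")
        case True
        with d(2) b_le[of "\<sigma> i"] cd show ?thesis by simp
      next
        case False
        with d(3)[OF False] \<nu>(3)[of i] show ?thesis by (metis enat_ord_simps(1))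
      qed
      from total_deg_fits_le[OF \<nu>(2) this] show ?thesis by (simp add: total_deg_add degM)
    qed
    have not_below: "\<not> (\<forall>i. \<mu> i \<le> \<nu> i)"
    proof
      assume "\<forall>i. \<mu> i \<le> \<nu> i"
      then have "\<mu> = \<nu>" using irred_cover_antichain[OF irred \<mu> \<nu>(1)] by blast
      then have "c \<le> d" using d(3)[of k] c(1) by auto
      with big \<open>\<mu> = \<nu>\<close> show False by simp
    qed
    show False
    proof (cases "\<forall>\<nu>\<in>L. ell \<mu> \<le> ell \<nu>")
      case True
      have "{i. \<mu> i = \<infinity>} \<subseteq> {i. \<nu> i = \<infinity>}"
      proof
        fix i assume i: "i \<in> {i. \<mu> i = \<infinity>}"
        show "i \<in> {i. \<nu> i = \<infinity>}"
        proof (rule ccontr)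
          assume ni: "i \<notin> {i. \<nu> i = \<infinity>}"
          have "{j. \<nu> j = \<infinity>} \<subseteq> {j. \<mu> j = \<infinity>} - {i}"
          proof
            fix j assume j: "j \<in> {j. \<nu> j = \<infinity>}"
            have "\<not> i \<le> j" using antimonoD[OF amn, of i j] j ni by auto
            then have "j \<le> i" by simp
            then have "\<mu> i \<le> \<mu> j" by (rule antimonoD[OF am])
            with i j ni show "j \<in> {j. \<mu> j = \<infinity>} - {i}" by auto
          qed
          then have "ell \<nu> \<le> card ({j. \<mu> j = \<infinity>} - {i})" unfolding ell_def by (intro card_mono) auto
          also have "\<dots> < ell \<mu>" unfolding ell_def using i by (intro card_Diff1_less) auto
          finally show False using True \<nu>(1) by auto
        qed
      qed
      moreover have "enat (mu_plus \<mu> i) \<le> \<nu> i" for i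
      proof (rule antimono_perm_le[OF _ amn \<nu>(2)])
        show "antimono (\<lambda>i. enat (mu_plus \<mu> i))" using antimono_mu_plus by (simp add: antimono_def)
        show "enat (mu_plus \<mu> (\<sigma> i)) \<le> \<nu> i" for i
          using \<nu>(3)[of i] Mb[of "\<sigma> i"] by (meson enat_ord_simps(1) order_trans)
      qed
      ultimately have "\<mu> i \<le> \<nu> i" for i using c(3)[of i] by (cases "\<mu> i = \<infinity>") auto
      with not_below show False by blast
    next
      case False
      with max \<nu>(1) have "\<not> c \<le> d" using big by (meson not_le)
      then have dc: "d < c" by simp
      have "\<mu> (\<sigma> i) \<le> \<nu> i" for i
      proof (cases "\<nu> i = \<infinity>")
        case False
        with d(3)[OF False] \<nu>(3)[of i] have "lookup ?b (\<sigma> i) \<le> d" by (metis enat_ord_simps(1) le_trans)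
        with dc Mb[of "\<sigma> i"] c(2)[of "\<sigma> i"] have "\<mu> (\<sigma> i) \<noteq> \<infinity>" by auto
        then have "\<mu> (\<sigma> i) = enat (mu_plus \<mu> (\<sigma> i))" using c(3) by blast
        with Mb[of "\<sigma> i"] \<nu>(3)[of i] show ?thesis by (metis enat_ord_simps(1) order_trans)
      qed simp
      then have "\<mu> i \<le> \<nu> i" for i by (rule antimono_perm_le[OF am amn \<nu>(2)])
      with not_below show False by blast
    qed
  qed
  have la: "lookup a i = mu_plus \<mu> i + (if i \<in> S0 then 1 else 0)" for i
    by (simp add: a_def lookup_add M lookup_lcm_var)
  have a_pos: "lookup a i \<noteq> 0" for i
    using c(2)[of i] by (cases "\<mu> i = \<infinity>") (auto simp: la S0_def)
  have kS0: "k \<in> S0" using c(1) by (simp add: S0_def)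
  have "\<not> acyclic_at TYPE('r) UNIV (card S0) (koszul_faces E a)"
  proof
    assume acyc: "acyclic_at TYPE('r) UNIV (card S0) (koszul_faces E a)"
    define W where "W = S0 - {k}"
    \<comment> \<open>For \<open>v \<notin> S\<^sub>0\<close> the entry at \<open>v\<close> drops to \<open>c\<close> and the one at \<open>k\<close> is \<open>c + 1\<close>; the transposition repairs this.\<close>
    have W_cofaces: "insert v W \<in> koszul_faces E a" if v: "v \<notin> W" for v
    proof -
      let ?m = "a - lcm_expo var_expo (insert v W)"
      have "\<mu> k = enat (mu_plus \<mu> k)" using c(3)[of k] c(1) by simp
      then have mk: "mu_plus \<mu> k = c" using c(1) by simp
      have "enat (lookup ?m (transpose k v i)) \<le> \<mu> i" for i
      proof (cases "\<mu> i = \<infinity>")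
        case False
        then have i: "i \<in> S0" by (simp add: S0_def)
        show ?thesis
        proof (cases "i = k")
          case True
          have "lookup ?m v \<le> c"
            using v mk c(2)[of v] by (cases "v = k") (auto simp: lookup_minus_lcm_var la S0_def W_def)
          with True c(1) show ?thesis by simp
        next
          case False
          with i have "i \<in> W" by (simp add: W_def)
          with v False have "transpose k v i = i" by (auto simp: transpose_def)
          with \<open>i \<in> W\<close> i c(3)[of i] show ?thesis by (simp add: lookup_minus_lcm_var la S0_def)
        qed
      qed simp
      then have "fits ?m \<mu>" by (intro fitsI[OF permutes_swap_id]) auto
      with \<mu> not_in_E a_pos show ?thesis by (auto simp: koszul_faces_iff)
    qed
    have insertS0: "insert v W = S0 \<longleftrightarrow> v = k" if "v \<notin> W" for v
      using that kS0 by (auto simp: W_def)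
    define f where "f = (\<lambda>T. if T = S0 then 1 else (0 :: 'r))"
    have "S0 \<in> koszul_faces E a" using W_cofaces[of k] insertS0[of k] by (simp add: W_def insert_absorb kS0)
    then have "\<forall>T. f T \<noteq> 0 \<longrightarrow> T \<in> koszul_faces E a \<and> card T = card S0" by (simp add: f_def)
    moreover have "\<forall>T\<in>koszul_faces E a. altsum UNIV f T = 0"
    proof
      fix T assume T: "T \<in> koszul_faces E a"
      show "altsum UNIV f T = 0" unfolding altsum_def
      proof (intro sum.neutral ballI)
        fix v assume v: "v \<in> UNIV - T"
        have "insert v T \<noteq> S0"
        proof
          assume eq: "insert v T = S0"
          have "a - lcm_expo var_expo T = M + var_expo v"
            using v by (intro poly_mapping_eqI)
              (auto simp: lookup_minus_lcm_var la lookup_add M lookup_var_expo eq[symmetric])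
          with cycle[of v] eq T show False by (auto simp: koszul_faces_iff)
        qed
        then show "sgn_pos v T * f (insert v T) = 0" by (simp add: f_def)
      qed
    qed
    ultimately obtain g :: "'n set \<Rightarrow> 'r" where g: "\<And>T. T \<in> koszul_faces E a \<Longrightarrow> f T = altsum UNIV g T"
      using acyc unfolding acyclic_at_def by blast
    \<comment> \<open>All cofaces of \<open>W\<close> belong to the family, so the values of \<open>\<partial>g\<close> that enter here are those of \<open>f\<close>.\<close>
    have "altsum UNIV f W = altsum UNIV (altsum UNIV g) W"
      using W_cofaces g by (intro altsum_cong) auto
    also have "\<dots> = 0" by (simp add: altsum_altsum)
    finally have "altsum UNIV f W = 0" .
    moreover have "altsum UNIV f W = (\<Sum>v\<in>UNIV - W. if v = k then sgn_pos k W else 0)"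
      unfolding altsum_def by (intro sum.cong refl) (auto simp: f_def insertS0)
    moreover have "\<dots> = sgn_pos k W" by (subst sum.delta) (auto simp: W_def)
    ultimately show False using sgn_pos_sq[of k W, where 'r = 'r] by simp
  qed
  moreover have "int (total_deg a) = int (\<Sum>i\<in>UNIV. mu_plus \<mu> i) + int (card S0)"
    by (simp add: a_def total_deg_add degM)
  ultimately show ?thesis unfolding cardS0 by blast
qed

end

theorem corollary5p12:
  fixes I :: "('n::{finite,linorder}, 'k::field) mpoly set"
  assumes "monomial_ideal I"
    and "sym_invariant I"
    and "I \<noteq> {0}"
  shows "reg_quot I = Max {int (\<Sum>i\<in>UNIV. mu_plus \<mu> i) | \<mu>. \<mu> \<in> Lambda_star I} \<and>
         pd_quot I = Max {CARD('n) - ell \<mu> | \<mu>. \<mu> \<in> Lambda_star I}"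
proof -
  obtain V :: "nat set" and g where V: "finite V" "I = mideal {m. \<exists>v\<in>V. g v \<preceq> m}"
    using monomial_idealE[OF assms(1)] by blast
  define E where "E = {m. \<exists>v\<in>V. g v \<preceq> m}"
  have IE: "I = mideal E" using V(2) by (simp add: E_def)
  let ?L = "Lambda_star I"
  interpret irredundant_cover ?L E
    using Lambda_star_irred_cover[OF assms IE]
    by unfold_locales (auto simp: up_closed_def E_def intro: edvd_trans)
  note Tor = Tor_nonzero_iff[OF assms(1) IE]
  have finL: "finite ?L" using irred by (simp add: irred_cover_def)
  let ?w = "\<lambda>\<mu> :: 'n \<Rightarrow> enat. \<Sum>i\<in>UNIV. mu_plus \<mu> i" and ?h = "\<lambda>\<mu> :: 'n \<Rightarrow> enat. CARD('n) - ell \<mu>"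
  let ?A = "{j - int i | i j. Tor_nonzero I i j}" and ?B = "{int (?w \<mu>) | \<mu>. \<mu> \<in> ?L}"
  let ?C = "{i. \<exists>j. Tor_nonzero I i j}" and ?D = "{?h \<mu> | \<mu>. \<mu> \<in> ?L}"
  have Tor_reg: "\<exists>\<nu>\<in>?L. j - int i \<le> int (?w \<nu>)" if "Tor_nonzero I i j" for i j
    using that regularity_upper_bound unfolding Tor by blast
  have Tor_pd: "i \<le> CARD('n) - m" if "Tor_nonzero I i j" "\<And>\<nu>. \<nu> \<in> ?L \<Longrightarrow> m \<le> ell \<nu>" for i j m
    using that projdim_upper_bound unfolding Tor by blast
  show ?thesis
  proof (cases "?L = {}")
    case True
    \<comment> \<open>\<open>I = R\<close>: all four sets of values are empty\<close>
    then have "\<not> Tor_nonzero I i j" for i j using Tor_reg by blast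
    with True show ?thesis by (simp add: reg_quot_def pd_quot_def)
  next
    case False
    have B: "finite ?B" "?B \<noteq> {}" using finL False by auto
    have "reg_quot I = Max ?B" unfolding reg_quot_def
    proof (rule Max_eqI)
      have "i \<le> CARD('n) \<and> 0 \<le> j \<and> j - int i \<le> Max ?B" if t: "Tor_nonzero I i j" for i j
      proof -
        from Tor_reg[OF t] obtain \<nu> where "\<nu> \<in> ?L" "j - int i \<le> int (?w \<nu>)" by blast
        moreover have "int (?w \<nu>) \<le> Max ?B" using B(1) \<open>\<nu> \<in> ?L\<close> by (intro Max_ge) auto
        ultimately show ?thesis using Tor_pd[OF t, of 0] t unfolding Tor by force
      qed
      then have A: "\<And>x. x \<in> ?A \<Longrightarrow> - int CARD('n) \<le> x \<and> x \<le> Max ?B" by fastforce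
      then have "?A \<subseteq> {- int CARD('n)..Max ?B}" by (intro subsetI atLeastAtMost_iff[THEN iffD2])
      then show "finite ?A" by (rule finite_subset) simp
      show "x \<le> Max ?B" if "x \<in> ?A" for x using A[OF that] by simp
      from Max_in[OF B] obtain \<mu> where \<mu>: "\<mu> \<in> ?L" "Max ?B = int (?w \<mu>)" by blast
      have "?w \<nu> \<le> ?w \<mu>" if "\<nu> \<in> ?L" for \<nu>
      proof -
        have "int (?w \<nu>) \<in> ?B" using that by blast
        then have "int (?w \<nu>) \<le> int (?w \<mu>)" unfolding \<mu>(2)[symmetric] by (rule Max_ge[OF B(1)])
        then show ?thesis by (simp only: of_nat_le_iff)
      qed
      then have "Tor_nonzero I (?h \<mu>) (int (?w \<mu>) + int (?h \<mu>))"
        using koszul_class[OF \<mu>(1)] unfolding Tor by blast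
      then show "Max ?B \<in> ?A" unfolding \<mu>(2) by force
    qed
    moreover have "pd_quot I = Max ?D" unfolding pd_quot_def
    proof -
      obtain \<mu> where \<mu>: "\<mu> \<in> ?L" "\<And>\<nu>. \<nu> \<in> ?L \<Longrightarrow> ell \<mu> \<le> ell \<nu>"
        using ex_has_least_nat[of "\<lambda>\<mu>. \<mu> \<in> ?L" _ ell] False by blast
      have "Max ?D = ?h \<mu>"
        using finL \<mu> by (intro Max_eqI) (auto intro: diff_le_mono2)
      moreover have "Max ?C = ?h \<mu>"
      proof (rule Max_eqI)
        show "i \<le> ?h \<mu>" if "i \<in> ?C" for i using that Tor_pd \<mu>(2) by blast
        then show "finite ?C" by (intro finite_subset[of ?C "{..?h \<mu>}"]) auto
        show "?h \<mu> \<in> ?C" using koszul_class[OF \<mu>(1)] \<mu>(2) unfolding Tor by blast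
      qed
      ultimately show "Max ?C = Max ?D" by simp
    qed
    ultimately show ?thesis by blast
  qed
qed

end
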